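(* Let $\mathbb{K}$ be a finite field with at least three elements, and let $V$ be a maximal linear subspace of $\mathrm{M}_n(\mathbb{K})$ with a trivial spectrum. Then there are matrices $M_1,\dots,M_p$, each of which is either equal to $0\in\mathrm{M}_1(\mathbb{K})$ or belongs to $\mathrm{M}_2(\mathbb{K})$ and has no eigenvalue in $\mathbb{K}$, such that $$V\simeq \mathbb{K}M_1\vee\cdots\vee\mathbb{K}M_p.$$ Each $M_k$ is then uniquely determined by $V$ up to similarity and multiplication by a non-zero scalar (that is, if $M'_1,\dots,M'_{p'}$ is another list of matrices of the same kind with $V\simeq \mathbb{K}M'_1\vee\cdots\vee\mathbb{K}M'_{p'}$, then $p'=p$ and, for every $k$, $M'_k$ is similar to a non-zero scalar multiple of $M_k$).
   Context: $\mathrm{M}_n(\mathbb{K})$ is the algebra of $n\times n$ matrices over $\mathbb{K}$; $\mathbb{K}M$ denotes the linear span of $M$. A linear subspace $H$ of $\mathrm{M}_n(\mathbb{K})$ has a trivial spectrum if no matrix $M\in H$ has a non-zero vector $X\in\mathbb{K}^n$ with $MX=X$. Such a subspace is called maximal if its dimension is $\binom{n}{2}$. Two linear subspaces $V,W$ of $\mathrm{M}_n(\mathbb{K})$ are similar, written $V\simeq W$, if $W=RVR^{-1}$ for some $R\in\mathrm{GL}_n(\mathbb{K})$. For subsets $V\subset \mathrm{M}_n(\mathbb{K})$ and $W\subset \mathrm{M}_p(\mathbb{K})$, $V\vee W:=\left\{\begin{bmatrix}A&B\\0&C\end{bmatrix} \mid A\in V,\ B\in \mathrm{M}_{n,p}(\mathbb{K}),\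 C\in W\right\}\subset \mathrm{M}_{n+p}(\mathbb{K})$, where $\mathrm{M}_{n,p}(\mathbb{K})$ is the space of $n\times p$ matrices; the operation $\vee$ is associative. *)

theory Defs
  imports "Jordan_Normal_Form.Char_Poly" "Jordan_Normal_Form.VS_Connect"
begin

abbreviation mat_space :: "nat \<Rightarrow> ('a :: field, 'a mat) module" where
  "mat_space n \<equiv> module_mat TYPE('a) n n"

text \<open>The locale predicate \<open>VectorSpace.subspace\<close> also demands that the ambient module
  is a vector space; the following shows that this part always holds.\<close>

lemma vectorspace_mat_space:
  "vectorspace (class_ring :: 'a :: field ring) (mat_space n)"
  using matrix_vs by (auto simp: class_field_def)

definition mat_subspace :: "nat \<Rightarrow> 'a :: field mat set \<Rightarrow> bool" where
  "mat_subspace n V \<longleftrightarrow> VectorSpace.subspace class_ring V (mat_space n)"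

definition mat_dim :: "nat \<Rightarrow> 'a :: field mat set \<Rightarrow> nat" where
  "mat_dim n V = vectorspace.dim class_ring ((mat_space n)\<lparr>carrier := V\<rparr>)"

definition trivial_spectrum :: "nat \<Rightarrow> 'a :: field mat set \<Rightarrow> bool" where
  "trivial_spectrum n V \<longleftrightarrow>
    \<not> (\<exists>M\<in>V. \<exists>X\<in>carrier_vec n. X \<noteq> 0\<^sub>v n \<and> M *\<^sub>v X = X)"

definition maximal_trivial_spectrum :: "nat \<Rightarrow> 'a :: field mat set \<Rightarrow> bool" where
  "maximal_trivial_spectrum n V \<longleftrightarrow>
    mat_subspace n V \<and> trivial_spectrum n V \<and> mat_dim n V = n choose 2"

definition similar_mat_sets :: "nat \<Rightarrow> 'a :: field mat set \<Rightarrow> 'a mat set \<Rightarrow> bool" where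
  "similar_mat_sets n V W \<longleftrightarrow>
    (\<exists>R\<in>carrier_mat n n. \<exists>R'\<in>carrier_mat n n.
       R * R' = 1\<^sub>m n \<and> R' * R = 1\<^sub>m n \<and> W = (\<lambda>M. R * M * R') ` V)"

definition mat_line :: "'a :: field mat \<Rightarrow> 'a mat set" where
  "mat_line M = {c \<cdot>\<^sub>m M | c. True}"

lemma mat_line_eq_span:
  assumes M: "M \<in> carrier_mat n n"
  shows "mat_line M = module.span class_ring (mat_space n) {M}"
proof -
  interpret vectorspace class_ring "mat_space n :: ('a, 'a mat) module"
    by (rule vectorspace_mat_space)
  have in_car: "{M} \<subseteq> carrier (mat_space n)"
    using M by (simp add: module_mat_simps)
  have lc: "lincomb a {M} = a M \<cdot>\<^sub>m M" for a
    using M by (simp add: lincomb_def module_mat_simps)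
  have "span {M} = {lincomb a {M} | a. a \<in> {M} \<rightarrow> carrier class_ring}"
    by (rule finite_span[OF _ in_car]) simp
  then show ?thesis
    unfolding mat_line_def lc by auto
qed

text \<open>Meant for sets of square matrices of one common size each; the sizes of the blocks
  are read off from the matrices.\<close>

definition mat_join :: "'a :: field mat set \<Rightarrow> 'a mat set \<Rightarrow> 'a mat set" where
  "mat_join V W =
    {four_block_mat A B (0\<^sub>m (dim_row C) (dim_col A)) C | A B C.
       A \<in> V \<and> B \<in> carrier_mat (dim_row A) (dim_col C) \<and> C \<in> W}"

text \<open>The empty join is the set of all \<open>0 \<times> 0\<close> matrices, the neutral element
  of the join.\<close>

definition mat_joins :: "'a :: field mat set list \<Rightarrow> 'a mat set" where
  "mat_joins Vs = foldr mat_join Vs {0\<^sub>m 0 0}"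

definition basic_block :: "'a :: field mat \<Rightarrow> bool" where
  "basic_block M \<longleftrightarrow>
    M = 0\<^sub>m 1 1 \<or> (M \<in> carrier_mat 2 2 \<and> \<not> (\<exists>k. eigenvalue M k))"

definition block_decomposition :: "nat \<Rightarrow> 'a :: field mat set \<Rightarrow> 'a mat list \<Rightarrow> bool" where
  "block_decomposition n V Ms \<longleftrightarrow>
    (\<forall>M\<in>set Ms. basic_block M) \<and> similar_mat_sets n V (mat_joins (map mat_line Ms))"

end

theory Submission
  imports Defs "HOL-Library.Cardinality" "HOL-Library.Function_Algebras"
begin

text \<open>Let \<open>V\<close> be a maximal space with trivial spectrum acting on \<open>E\<close>. For every \<open>x \<noteq> 0\<close> some
  functional kills \<open>V x\<close> but not \<open>x\<close>. Call \<open>x\<close> bad if \<open>V\<close> contains a rank-one operator with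
  image \<open>K x\<close>. Bad vectors do not span \<open>E\<close>, and for a good \<open>z\<close> the space \<open>V z\<close> is a hyperplane,
  so the functional \<open>\<phi>(z)\<close> killing \<open>V z\<close> is unique up to scalars, and the operators of \<open>V\<close> killing
  \<open>z\<close> induce a maximal space on \<open>E / K z\<close>; this gives an induction on the dimension.
  For generic good \<open>z, u\<close> with independent functionals the relation
  \<open>\<phi>(u)(M z) + c \<phi>(z)(M u) = 0\<close> holds for all \<open>M \<in> V\<close>, because also some functional kills
  \<open>V (z + t u)\<close> for two different \<open>t \<noteq> 0\<close>; this is where three scalars are needed.
  Hence \<open>\<phi>\<close> is induced by a linear map \<open>\<Phi>\<close> from \<open>E\<close> to its dual
  with \<open>\<Phi>(x)(x) \<noteq> 0\<close> outside the kernel. As ternary quadratic forms over a finite field are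
  isotropic, \<open>\<Phi>\<close> has rank at most two, and its kernel, the set of bad vectors, is invariant.
  Applied to the transposes this yields a \<open>V\<close>-invariant subspace of dimension one or two;
  by maximality \<open>V\<close> is then the join of what it induces there and on the quotient.
  The decomposition is unique since the first block is the least nonzero invariant subspace.\<close>


section \<open>Ternary quadratic forms over finite fields\<close>

text \<open>The identity behind everything is \<open>\<Phi>(x)(M x) = 0\<close>: it makes each map
  (x, y) \<mapsto> \<open>\<Phi>(x)(M y)\<close> alternating, and polarising it gives the relation
  between two vectors. The obstacle is that \<phi> is known only at good vectors and only up to
  scalars there, so \<Phi> cannot be written down. It is in fact never formed: its values f, g, h at
  one, two or three vectors are fixed, and the relation with z determines every other value up to a
  multiple of f. Independent values at three vectors are excluded by means of the quotient. All that
  the induction transports from there is what the kernel of \<Phi> would provide, an invariant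
  subspace killed by the functionals of all vectors outside it. Finiteness enters a second time
  through counting: dimensions are compared as cardinalities, so that maximality is the case of
  equality in a chain of estimates. The transposes are needed because the kernel of \<Phi> has
  codimension at most two and would split off the last block, whereas the functionals vanishing on
  it form a small invariant space of the transposed operators.\<close>

lemma card_squares:
  assumes "(2::'a::{field,finite}) \<noteq> 0"
  shows "CARD('a) < 2 * card (range (\<lambda>x::'a. x\<^sup>2))"
proof -
  let ?S = "range (\<lambda>x::'a. x\<^sup>2)"
  have le: "card {x::'a. x\<^sup>2 = s} \<le> (if s = 0 then 1 else 2)" if s: "s \<in> ?S" for s
  proof -
    obtain y where y: "s = y\<^sup>2" using s by blast
    have sub: "{x::'a. x\<^sup>2 = s} \<subseteq> {y, - y}" by (auto simp: y power2_eq_iff)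
    show ?thesis
    proof (cases "s = 0")
      case True
      then have "{x::'a. x\<^sup>2 = s} \<subseteq> {0}" by auto
      then show ?thesis using True card_mono[of "{0::'a}" "{x::'a. x\<^sup>2 = s}"] by simp
    next
      case False
      have "card {x::'a. x\<^sup>2 = s} \<le> card {y, - y}" by (rule card_mono[OF _ sub]) simp
      also have "\<dots> \<le> 2" by (simp add: card_insert_if)
      finally show ?thesis using False by simp
    qed
  qed
  have "CARD('a) = (\<Sum>x\<in>(UNIV :: 'a set). 1)" by simp
  also have "\<dots> = (\<Sum>s\<in>?S. \<Sum>x\<in>{x \<in> UNIV. x\<^sup>2 = s}. 1)"
    by (rule sum.image_gen) simp
  also have "\<dots> = (\<Sum>s\<in>?S. card {x::'a. x\<^sup>2 = s})" by simp
  also have "\<dots> \<le> (\<Sum>s\<in>?S. if s = 0 then 1 else 2)" by (rule sum_mono) (rule le)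
  \<comment> \<open>Strict because 0 has only one square root.\<close>
  also have "\<dots> < (\<Sum>s\<in>?S. 2)"
  proof (rule sum_strict_mono_ex1)
    show "\<exists>s\<in>?S. (if s = 0 then 1 else 2) < (2::nat)"
      by (rule bexI[of _ 0]) (auto intro: image_eqI[of _ _ 0])
  qed auto
  finally show ?thesis by simp
qed

text \<open>Pigeonhole: the values \<open>a * x\<^sup>2\<close> and the values
  \<open>k - b * y\<^sup>2\<close> each fill more than half of the field, so the two sets
  meet.\<close>

lemma binary_square_form_surj:
  fixes a b k :: "'a::{field,finite}"
  assumes "(2::'a) \<noteq> 0" "a \<noteq> 0" "b \<noteq> 0"
  shows "\<exists>x y. a * x\<^sup>2 + b * y\<^sup>2 = k"
proof (rule ccontr)
  assume no: "\<not> ?thesis"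
  let ?S = "range (\<lambda>x::'a. x\<^sup>2)"
  let ?A = "(\<lambda>s. a * s) ` ?S" and ?B = "(\<lambda>s. k - b * s) ` ?S"
  have "?A \<inter> ?B = {}"
  proof -
    have "a * x\<^sup>2 \<noteq> k - b * y\<^sup>2" for x y using no by (metis diff_add_cancel)
    then show ?thesis by auto
  qed
  then have "card (?A \<union> ?B) = card ?A + card ?B" by (intro card_Un_disjoint) auto
  moreover have "card ?A = card ?S" using assms by (intro card_image inj_onI) simp
  moreover have "card ?B = card ?S" using assms by (intro card_image inj_onI) simp
  moreover have "card (?A \<union> ?B) \<le> CARD('a)" by (rule card_mono) auto
  ultimately show False using card_squares[OF assms(1)] by simp
qed

text \<open>Signs disappear in characteristic two, so squaring is injective and, on a finite field,
  surjective.\<close>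

lemma square_surj_char_2:
  assumes "(2::'a::{field,finite}) = 0"
  shows "\<exists>x::'a. x\<^sup>2 = k"
proof -
  have "inj (\<lambda>x::'a. x\<^sup>2)"
  proof (rule injI)
    fix x y :: 'a assume "x\<^sup>2 = y\<^sup>2"
    then have "x = y \<or> x = - y" by (simp add: power2_eq_iff)
    moreover have "- y = y" using assms by (metis mult_2 mult_zero_left neg_eq_iff_add_eq_0)
    ultimately show "x = y" by auto
  qed
  then have "surj (\<lambda>x::'a. x\<^sup>2)" by (rule finite_UNIV_inj_surj[OF finite])
  then obtain x where "k = x\<^sup>2" by (rule surjE)
  then show ?thesis by (intro exI[of _ x]) simp
qed

text \<open>A case of Chevalley's theorem, done by hand: if 2 is invertible, completing squares
  reduces the claim to a diagonal binary form representing a given scalar; in characteristic two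
  every scalar has a square root.\<close>

lemma ternary_form_isotropic:
  fixes a b c d e g :: "'a::{field,finite}"
  shows "\<exists>x y w. \<not> (x = 0 \<and> y = 0 \<and> w = 0) \<and>
    a * x\<^sup>2 + b * y\<^sup>2 + c * w\<^sup>2 + d * x * y + e * x * w + g * y * w = 0"
proof (cases "a = 0")
  case True
  then show ?thesis by (intro exI[of _ 1] exI[of _ 0]) simp
next
  case a: False
  show ?thesis
  proof (cases "(2::'a) = 0")
    case two: True
    show ?thesis
    proof (cases "d = 0")
      case True
      obtain x where "x\<^sup>2 = - b / a" using square_surj_char_2[OF two] by blast
      then show ?thesis using a True by (intro exI[of _ x] exI[of _ 1] exI[of _ 0]) simp
    next
      case False
      \<comment> \<open>At w = 1 both partial derivatives of the form, in x and in y, vanish at this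
        point. Moving x by t then changes the value only by \<open>a * t\<^sup>2\<close>, and t can
        be a square root.\<close>
      define x0 y0 where "x0 = g / d" and "y0 = e / d"
      define k where "k = a * x0\<^sup>2 + b * y0\<^sup>2 + c + d * x0 * y0 + e * x0 + g * y0"
      obtain t where t: "t\<^sup>2 = - k / a" using square_surj_char_2[OF two] by blast
      have dy: "d * y0 = e" using False by (simp add: y0_def)
      have "a * (x0 + t)\<^sup>2 + b * y0\<^sup>2 + c * 1\<^sup>2 + d * (x0 + t) * y0 + e * (x0 + t) * 1 + g * y0 * 1
        = k + a * t\<^sup>2 + 2 * (a * x0 * t) + t * (d * y0) + t * e"
        by (simp add: k_def power2_eq_square algebra_simps)
      also have "\<dots> = k + a * t\<^sup>2 + 2 * (a * x0 * t) + 2 * (t * e)" unfolding dy by (simp add: algebra_simps)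
      also have "\<dots> = 0" using two a t by simp
      finally show ?thesis by (intro exI[of _ "x0 + t"] exI[of _ y0] exI[of _ 1]) simp
    qed
  next
    case two: False
    \<comment> \<open>The coefficients that remain in y and w once the square in x has been
      completed.\<close>
    define b' where "b' = b - d\<^sup>2 / (4 * a)"
    define c' where "c' = c - e\<^sup>2 / (4 * a)"
    define g' where "g' = g - d * e / (2 * a)"
    have four: "(4::'a) \<noteq> 0" using two by (metis mult_2_right mult_eq_0_iff numeral_Bit0)
    have sq: "a * (x - (d * y + e * w) / (2 * a))\<^sup>2 + b * y\<^sup>2 + c * w\<^sup>2 + d * (x - (d * y + e * w) / (2 * a)) * y
        + e * (x - (d * y + e * w) / (2 * a)) * w + g * y * w
        = a * x\<^sup>2 + b' * y\<^sup>2 + c' * w\<^sup>2 + g' * y * w" for x y w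
    proof -
      define m where "m = (d * y + e * w) / (2 * a)"
      have m: "d * y + e * w = 2 * a * m" using two a by (simp add: m_def)
      have am: "a * m\<^sup>2 = d\<^sup>2 / (4 * a) * y\<^sup>2 + e\<^sup>2 / (4 * a) * w\<^sup>2 + d * e / (2 * a) * y * w"
      proof -
        define i where "i = inverse (4 * a)"
        have i: "4 * a * i = 1" using four a by (simp add: i_def)
        have i2: "x / (2 * a) = 2 * i * x" and i4: "x / (4 * a) = i * x" for x
          using two four a by (simp_all add: i_def field_simps)
        have "a * m\<^sup>2 = (4 * a * i) * (i * (d * y + e * w)\<^sup>2)"
          unfolding m_def i2 by (simp add: power2_eq_square algebra_simps)
        then show ?thesis unfolding i i2 i4 by (simp add: power2_eq_square algebra_simps)
      qed
      have "a * (x - m)\<^sup>2 + b * y\<^sup>2 + c * w\<^sup>2 + d * (x - m) * y + e * (x - m) * w + g * y * w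
        = a * (x - m)\<^sup>2 + b * y\<^sup>2 + c * w\<^sup>2 + (x - m) * (d * y + e * w) + g * y * w"
        by (simp add: algebra_simps)
      also have "\<dots> = a * x\<^sup>2 - a * m\<^sup>2 + b * y\<^sup>2 + c * w\<^sup>2 + g * y * w"
        unfolding m by (simp add: power2_eq_square algebra_simps)
      also have "\<dots> = a * x\<^sup>2 + b' * y\<^sup>2 + c' * w\<^sup>2 + g' * y * w"
        unfolding am b'_def c'_def g'_def by (simp add: algebra_simps)
      finally show ?thesis unfolding m_def .
    qed
    show ?thesis
    proof (cases "b' = 0")
      case True
      then show ?thesis using sq[of 0 1 0]
        by (intro exI[of _ "0 - (d * 1 + e * 0) / (2 * a)"] exI[of _ 1] exI[of _ 0]) simp
    next
      case b': False
      \<comment> \<open>Shifting Y by l absorbs the mixed term at w = 1, leaving a diagonal binary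
        form that has to take one prescribed value.\<close>
      define l where "l = g' / (2 * b')"
      obtain X Y where XY: "a * X\<^sup>2 + b' * Y\<^sup>2 = b' * l\<^sup>2 - c'"
        using binary_square_form_surj[OF two a b'] by blast
      have "g' = 2 * b' * l" using two b' by (simp add: l_def)
      then have "a * X\<^sup>2 + b' * (Y - l)\<^sup>2 + c' * 1\<^sup>2 + g' * (Y - l) * 1 = a * X\<^sup>2 + b' * Y\<^sup>2 - b' * l\<^sup>2 + c'"
        by (simp add: power2_eq_square algebra_simps)
      also have "\<dots> = 0" using XY by simp
      finally show ?thesis using sq[of X "Y - l" 1]
        by (intro exI[of _ "X - (d * (Y - l) + e * 1) / (2 * a)"] exI[of _ "Y - l"] exI[of _ 1]) simp
    qed
  qed
qed

section \<open>Counting along fibres, and vectors in general position\<close>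

lemma card_image_kernel:
  fixes f :: "'c \<Rightarrow> 'd"
  assumes fin: "finite V"
    and fib: "\<And>y. y \<in> f ` V \<Longrightarrow> card {M \<in> V. f M = y} = k"
  shows "card V = card (f ` V) * k"
proof -
  have "card V = (\<Sum>x\<in>V. 1)" by simp
  also have "\<dots> = (\<Sum>y\<in>f ` V. \<Sum>x\<in>{x \<in> V. f x = y}. 1)"
    by (rule sum.image_gen[OF fin])
  also have "\<dots> = (\<Sum>y\<in>f ` V. k)"
    by (intro sum.cong) (simp_all add: fib)
  finally show ?thesis by simp
qed

lemma exists_avoiding_two:
  assumes "CARD('a::finite) \<ge> 3"
  shows "\<exists>t::'a. t \<noteq> a \<and> t \<noteq> b"
proof (rule ccontr)
  assume "\<not> ?thesis"
  then have "(UNIV :: 'a set) \<subseteq> {a, b}" by blast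
  then have "CARD('a) \<le> card {a, b}" by (intro card_mono) auto
  also have "\<dots> \<le> 2" by (simp add: card_insert_if)
  finally show False using assms by simp
qed

context vector_space
begin

lemma avoid_two_subspaces:
  fixes B C E :: "'b set"
  assumes sub: "subspace B" "subspace C" "subspace E" and B: "\<not> E \<subseteq> B" and C: "\<not> E \<subseteq> C"
  shows "\<exists>w\<in>E. w \<notin> B \<and> w \<notin> C"
proof -
  obtain b c where bc: "b \<in> E" "b \<notin> B" "c \<in> E" "c \<notin> C" using B C by blast
  show ?thesis
  proof (cases "b \<in> C \<and> c \<in> B")
    case True
    have "b + c \<notin> B" using True bc subspace_diff[OF sub(1), of "b + c" c] by auto
    moreover have "b + c \<notin> C" using True bc subspace_diff[OF sub(2), of "b + c" b] by auto
    ultimately show ?thesis using bc subspace_add[OF sub(3)] by blast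
  next
    case False
    then show ?thesis using bc by blast
  qed
qed

lemma at_most_one_translate:
  assumes S: "subspace S" and w: "w \<notin> S" and "u + s *s w \<in> S" "u + t *s w \<in> S"
  shows "s = t"
proof (rule ccontr)
  assume ne: "s \<noteq> t"
  have "(u + s *s w) - (u + t *s w) \<in> S" using assms subspace_diff by blast
  then have "(s - t) *s w \<in> S" by (simp add: scale_left_diff_distrib)
  then have "inverse (s - t) *s (s - t) *s w \<in> S" by (rule subspace_scale[OF S])
  then show False using ne w by simp
qed

end

text \<open>Lets a claim that is linear in u be checked only outside two proper subspaces. For w
  outside both, the line u + t w meets each of them for at most one t, and \<open>q\<close> supplies
  a t that avoids both values.\<close>

lemma (in vector_space) generic_difference:
  fixes B C E :: "'b set" and u :: 'b
  assumes q: "\<And>x y :: 'a. \<exists>t. t \<noteq> x \<and> t \<noteq> y"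
    and sub: "subspace B" "subspace C" "subspace E" and B: "\<not> E \<subseteq> B" and C: "\<not> E \<subseteq> C"
    and u: "u \<in> E"
  obtains s w t where "s \<in> E" "s \<notin> B" "s \<notin> C" "w \<in> E" "w \<notin> B" "w \<notin> C" "u = s + t *s w"
proof -
  obtain w where w: "w \<in> E" "w \<notin> B" "w \<notin> C"
    using avoid_two_subspaces[OF sub B C] by blast
  obtain b where b: "\<And>t. t \<noteq> b \<Longrightarrow> u + t *s w \<notin> B"
    using at_most_one_translate[OF sub(1) w(2), of u] by blast
  obtain c where c: "\<And>t. t \<noteq> c \<Longrightarrow> u + t *s w \<notin> C"
    using at_most_one_translate[OF sub(2) w(3), of u] by blast
  obtain t where t: "t \<noteq> b" "t \<noteq> c" using q by blast
  show ?thesis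
  proof (rule that[of "u + t *s w" w "- t"])
    show "u + t *s w \<in> E" using u w sub(3) by (intro subspace_add subspace_scale)
  qed (use w b c t in auto)
qed

section \<open>Operator spaces without fixed vectors\<close>

text \<open>The space acted upon is the range of the projection \<open>P\<close>, and every operator satisfies
  \<open>M = P M P\<close>. Passing to the quotient by a vector then means replacing \<open>P\<close> by a smaller
  projection on the same type.\<close>

locale operator_space = vector_space scale
  for scale :: "'a::{field,finite} \<Rightarrow> 'b::ab_group_add \<Rightarrow> 'b" (infixr \<open>*s\<close> 75) +
  fixes P :: "'b \<Rightarrow> 'b" and V :: "('b \<Rightarrow> 'b) set"
  assumes P_add: "P (x + y) = P x + P y"
    and P_scale: "P (c *s x) = c *s P x"
    and P_idem: "P (P x) = P x"
    and finite_range: "finite (range P)"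
    and op_add: "M \<in> V \<Longrightarrow> M (x + y) = M x + M y"
    and op_scale: "M \<in> V \<Longrightarrow> M (c *s x) = c *s M x"
    and P_op: "M \<in> V \<Longrightarrow> P (M x) = M x"
    and op_P: "M \<in> V \<Longrightarrow> M (P x) = M x"
    and V_zero: "(\<lambda>x. 0) \<in> V"
    and V_add: "M \<in> V \<Longrightarrow> N \<in> V \<Longrightarrow> (\<lambda>x. M x + N x) \<in> V"
    and V_scale: "M \<in> V \<Longrightarrow> (\<lambda>x. c *s M x) \<in> V"
    and no_fixed: "M \<in> V \<Longrightarrow> M x = x \<Longrightarrow> x = 0"
begin

text \<open>The last clause makes f depend only on its restriction to \<open>range P\<close>, so
  that these functions represent the dual of the space acted upon without repetition.\<close>

definition functional :: "('b \<Rightarrow> 'a) \<Rightarrow> bool" where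
  "functional f \<longleftrightarrow> (\<forall>x y. f (x + y) = f x + f y) \<and> (\<forall>c x. f (c *s x) = c * f x)
     \<and> (\<forall>x. f (P x) = f x)"

definition ann :: "'b \<Rightarrow> ('b \<Rightarrow> 'a) set" where
  "ann x = {f. functional f \<and> (\<forall>M\<in>V. f (M x) = 0)}"

definition bad :: "'b \<Rightarrow> bool" where
  "bad x \<longleftrightarrow> x \<in> range P \<and> x \<noteq> 0 \<and>
     (\<exists>l. functional l \<and> l \<noteq> (\<lambda>_. 0) \<and> (\<lambda>y. l y *s x) \<in> V)"

text \<open>Q is the kernel of \<Phi>, described without \<Phi>. The last clause says that the
  values \<Phi>(z) vanish on it; the passage from the quotient back to the whole space rests on this
  clause and on invariance.\<close>

definition radical :: "'b set \<Rightarrow> bool" where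
  "radical Q \<longleftrightarrow> subspace Q \<and> Q \<subseteq> range P \<and> Q \<noteq> range P \<and> (\<forall>M\<in>V. \<forall>x\<in>Q. M x \<in> Q)
     \<and> (\<forall>x\<in>range P. x \<noteq> 0 \<longrightarrow> (x \<in> Q \<longleftrightarrow> bad x))
     \<and> (\<forall>z\<in>range P - Q. \<forall>f\<in>ann z. \<forall>x\<in>Q. f x = 0)"

lemma in_range_iff: "x \<in> range P \<longleftrightarrow> P x = x"
  by (metis P_idem rangeE rangeI)

lemma subspace_range: "subspace (range P)"
proof (rule subspaceI)
  show "0 \<in> range P" using P_scale[of 0 0] by (simp add: in_range_iff)
qed (auto simp: in_range_iff P_add P_scale P_idem)

lemmas range_add = subspace_add[OF subspace_range]
  and range_scale = subspace_scale[OF subspace_range]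
  and range_diff = subspace_diff[OF subspace_range]
  and range_zero = subspace_0[OF subspace_range]

lemma range_trivial: "card (range P) = 1 \<Longrightarrow> range P = {0}"
  using range_zero by (metis card_1_singletonE singletonD)

lemma op_in_range: "M \<in> V \<Longrightarrow> M x \<in> range P"
  using P_op in_range_iff by blast

lemma op_0: "M \<in> V \<Longrightarrow> M 0 = 0"
  using op_scale[of M 0 0] by simp

lemma op_minus: "M \<in> V \<Longrightarrow> M (- x) = - M x"
  using op_scale[of M "- 1" x] by simp

lemma op_diff: "M \<in> V \<Longrightarrow> M (x - y) = M x - M y"
  using op_add[of M x "- y"] op_minus[of M y] by simp

lemma V_diff: assumes "M \<in> V" "N \<in> V" shows "(\<lambda>x. M x - N x) \<in> V"
  using V_add[OF assms(1) V_scale[OF assms(2), of "- 1"]] by simp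

lemma V_sum: "finite S \<Longrightarrow> (\<And>s. s \<in> S \<Longrightarrow> F s \<in> V) \<Longrightarrow> (\<lambda>x. \<Sum>s\<in>S. F s x) \<in> V"
  by (induction S rule: finite_induct) (auto simp: V_zero intro: V_add)

lemma functional_add: "functional f \<Longrightarrow> f (x + y) = f x + f y"
  and functional_scale: "functional f \<Longrightarrow> f (c *s x) = c * f x"
  and functional_P: "functional f \<Longrightarrow> f (P x) = f x"
  by (auto simp: functional_def)

lemma functional_0: "functional f \<Longrightarrow> f 0 = 0"
  using functional_scale[of f 0 0] by simp

lemma functional_minus: "functional f \<Longrightarrow> f (- x) = - f x"
  using functional_scale[of f "- 1" x] by simp

lemma functional_diff: "functional f \<Longrightarrow> f (x - y) = f x - f y"
  using functional_add[of f x "- y"] functional_minus[of f y] by simp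

lemmas functional_simps = functional_add functional_scale functional_diff functional_minus functional_0

lemmas op_simps = op_add op_scale op_diff op_minus op_0

lemma functional_sum: "functional f \<Longrightarrow> f (sum g S) = (\<Sum>s\<in>S. f (g s))"
  by (induction S rule: infinite_finite_induct) (auto simp: functional_simps)

lemma functional_lincomb:
  "functional f \<Longrightarrow> functional g \<Longrightarrow> functional (\<lambda>x. a * f x + b * g x)"
  by (auto simp: functional_def algebra_simps)

lemma functional_mult: "functional f \<Longrightarrow> functional (\<lambda>x. a * f x)"
  by (auto simp: functional_def algebra_simps)

lemma functional_kernel: "functional f \<Longrightarrow> subspace {x. f x = 0}"
  by (rule subspaceI) (auto simp: functional_simps)

lemma functional_eq_0I: "functional f \<Longrightarrow> (\<And>x. x \<in> range P \<Longrightarrow> f x = 0) \<Longrightarrow> f = (\<lambda>_. 0)"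
  by (metis functional_P rangeI)

lemma finite_ops: "finite V"
proof (rule finite_imageD)
  have "(\<lambda>M. restrict M (range P)) ` V \<subseteq> (range P \<rightarrow>\<^sub>E range P)"
    using op_in_range by auto
  then show "finite ((\<lambda>M. restrict M (range P)) ` V)"
    by (rule finite_subset) (intro finite_PiE finite_range)
  show "inj_on (\<lambda>M. restrict M (range P)) V"
  proof (rule inj_onI, rule ext)
    fix M N x assume "M \<in> V" "N \<in> V" "restrict M (range P) = restrict N (range P)"
    then show "M x = N x" by (metis op_P rangeI restrict_apply')
  qed
qed

lemma exists_functional:
  assumes S: "subspace S" "S \<subseteq> range P" and x: "x \<in> range P" "x \<notin> S"
  obtains f where "functional f" "f x = 1" "\<And>y. y \<in> S \<Longrightarrow> f y = 0"
proof -
  obtain B where B: "B \<subseteq> S" "independent B" "S \<subseteq> span B"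
    using maximal_independent_subset by blast
  have spB: "span B = S" using B S(1) span_subspace by blast
  have ind: "independent (insert x B)"
    using B(2) x(2) spB independent_insertI by blast
  interpret sc: vector_space "(*) :: 'a \<Rightarrow> 'a \<Rightarrow> 'a"
    by unfold_locales (auto simp: algebra_simps)
  interpret vp: vector_space_pair scale "(*) :: 'a \<Rightarrow> 'a \<Rightarrow> 'a" ..
  obtain g where lin: "Vector_Spaces.linear scale (*) g"
    and g: "\<And>y. y \<in> insert x B \<Longrightarrow> g y = (if y = x then 1 else 0)"
    using vp.linear_independent_extend[OF ind, of "\<lambda>y. if y = x then 1 else 0"] by blast
  interpret g: Vector_Spaces.linear scale "(*)" g by (fact lin)
  have xB: "x \<notin> B" using x(2) spB span_superset by blast
  have "g y = 0" if "y \<in> S" for y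
  proof -
    have "y \<in> span B" using that spB by simp
    then show ?thesis
      by (rule g.eq_0_on_span[rotated]) (use g xB in auto)
  qed
  show ?thesis
  proof (rule that[of "\<lambda>y. g (P y)"])
    show "functional (\<lambda>y. g (P y))"
      by (auto simp: functional_def P_add P_scale P_idem g.add g.scale)
    show "g (P x) = 1" using x g by (simp add: in_range_iff)
    show "g (P y) = 0" if "y \<in> S" for y
      using that \<open>\<And>y. y \<in> S \<Longrightarrow> g y = 0\<close>[OF that] in_range_iff[of y] S(2) by auto
  qed
qed

lemma subspace_orbit: "subspace ((\<lambda>M. M x) ` V)"
proof (rule subspaceI)
  show "0 \<in> (\<lambda>M. M x) ` V" using V_zero by (rule rev_image_eqI) simp
next
  fix a b assume "a \<in> (\<lambda>M. M x) ` V" "b \<in> (\<lambda>M. M x) ` V"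
  then obtain M N where "M \<in> V" "N \<in> V" "a = M x" "b = N x" by blast
  then show "a + b \<in> (\<lambda>M. M x) ` V"
    by (intro image_eqI[of _ _ "\<lambda>x. M x + N x"]) (auto intro: V_add)
next
  fix c a assume "a \<in> (\<lambda>M. M x) ` V"
  then obtain M where "M \<in> V" "a = M x" by blast
  then show "c *s a \<in> (\<lambda>M. M x) ` V"
    by (intro image_eqI[of _ _ "\<lambda>x. c *s M x"]) (auto intro: V_scale)
qed

lemma orbit_subset: "(\<lambda>M. M x) ` V \<subseteq> range P"
  using op_in_range by blast

lemma not_in_orbit: "x \<noteq> 0 \<Longrightarrow> x \<notin> (\<lambda>M. M x) ` V"
  using no_fixed by force

text \<open>Absence of fixed vectors means that x lies outside the subspace \<open>V x\<close>, so a
  functional separates the two.\<close>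

lemma exists_ann:
  assumes "x \<in> range P" "x \<noteq> 0"
  obtains f where "f \<in> ann x" "f x = 1"
proof -
  obtain f where f: "functional f" "f x = 1" "\<And>y. y \<in> (\<lambda>M. M x) ` V \<Longrightarrow> f y = 0"
    using exists_functional[OF subspace_orbit orbit_subset assms(1) not_in_orbit[OF assms(2)]]
    by blast
  then have "f \<in> ann x" by (simp add: ann_def)
  then show ?thesis using f(2) by (rule that)
qed

text \<open>A minimal nonempty set of basis vectors on which no functional of the corresponding
  rank-one operators vanishes carries a fixed vector, namely its sum.\<close>

lemma bad_vectors_not_spanning:
  assumes nz: "range P \<noteq> {0}"
  shows "\<not> range P \<subseteq> span {x. bad x}"
proof
  assume sp: "range P \<subseteq> span {x. bad x}"
  obtain A where A: "A \<subseteq> {x. bad x}" "independent A" "{x. bad x} \<subseteq> span A"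
    using maximal_independent_subset by blast
  have spA: "range P \<subseteq> span A"
    using sp A(3) span_minimal[OF A(3) subspace_span] by blast
  have Asub: "A \<subseteq> range P" using A(1) bad_def by blast
  then have finA: "finite A" using finite_range finite_subset by blast
  have "\<forall>b\<in>A. \<exists>l. functional l \<and> l \<noteq> (\<lambda>_. 0) \<and> (\<lambda>y. l y *s b) \<in> V"
    using A(1) bad_def by blast
  then obtain l where l: "\<And>b. b \<in> A \<Longrightarrow> functional (l b)" "\<And>b. b \<in> A \<Longrightarrow> l b \<noteq> (\<lambda>_. 0)"
    "\<And>b. b \<in> A \<Longrightarrow> (\<lambda>y. l b y *s b) \<in> V"
    by metis
  have ex: "\<exists>c\<in>A. l b c \<noteq> 0" if b: "b \<in> A" for b
  proof (rule ccontr)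
    assume "\<not> ?thesis"
    then have "A \<subseteq> {x. l b x = 0}" by blast
    then have "span A \<subseteq> {x. l b x = 0}"
      by (rule span_minimal) (rule functional_kernel[OF l(1)[OF b]])
    then show False using functional_eq_0I[OF l(1)[OF b]] l(2)[OF b] spA by blast
  qed
  have Ane: "A \<noteq> {}"
    using spA nz subspace_0[OF subspace_range] by auto
  define \<S> where "\<S> = {S. S \<subseteq> A \<and> S \<noteq> {} \<and> (\<forall>b\<in>S. \<exists>c\<in>S. l b c \<noteq> 0)}"
  have "A \<in> \<S>" using ex Ane by (auto simp: \<S>_def)
  moreover have "finite \<S>"
    by (rule finite_subset[of _ "Pow A"]) (auto simp: \<S>_def finA)
  ultimately obtain S where S: "S \<in> \<S>" "\<And>T. T \<in> \<S> \<Longrightarrow> T \<subseteq> S \<Longrightarrow> S = T"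
    using finite_has_minimal[of \<S>] by blast
  have SA: "S \<subseteq> A" and Sne: "S \<noteq> {}" using S(1) by (auto simp: \<S>_def)
  have finS: "finite S" using SA finA finite_subset by blast
  \<comment> \<open>Removing c from the minimal set S breaks the condition at some b, and the
    functional of this b is then nonzero on S at c alone.\<close>
  have "\<exists>b\<in>S. l b c \<noteq> 0 \<and> (\<forall>d\<in>S. d \<noteq> c \<longrightarrow> l b d = 0)" if c: "c \<in> S" for c
  proof (cases "S = {c}")
    case True
    then show ?thesis using S(1) by (auto simp: \<S>_def)
  next
    case False
    have "S - {c} \<notin> \<S>" using S(2)[of "S - {c}"] c by blast
    then obtain b where b: "b \<in> S - {c}" "\<forall>d\<in>S - {c}. l b d = 0"
      using False SA c unfolding \<S>_def by auto
    moreover have "\<exists>d\<in>S. l b d \<noteq> 0" using b(1) S(1) by (auto simp: \<S>_def)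
    ultimately show ?thesis by blast
  qed
  then obtain g where g: "\<And>c. c \<in> S \<Longrightarrow> g c \<in> S" "\<And>c. c \<in> S \<Longrightarrow> l (g c) c \<noteq> 0"
    "\<And>c d. c \<in> S \<Longrightarrow> d \<in> S \<Longrightarrow> d \<noteq> c \<Longrightarrow> l (g c) d = 0"
    by metis
  have inj: "inj_on g S"
    by (rule inj_onI) (metis g(2,3))
  then have gS: "g ` S = S" using endo_inj_surj[OF finS _ inj] g(1) by blast
  define x where "x = \<Sum> S"
  \<comment> \<open>On x the functional \<open>l (g c)\<close> reads off the contribution of c, so
    each summand sends x to \<open>g c\<close>. As g permutes S, these vectors add up to x
    again.\<close>
  define M where "M = (\<lambda>y. \<Sum>c\<in>S. inverse (l (g c) c) *s l (g c) y *s g c)"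
  have "M \<in> V" unfolding M_def
    by (rule V_sum[OF finS]) (intro V_scale l(3) subsetD[OF SA] g(1))
  moreover have "M x = x"
  proof -
    have "l (g c) x = l (g c) c" if c: "c \<in> S" for c
    proof -
      have "l (g c) x = (\<Sum>d\<in>S. l (g c) d)"
        unfolding x_def using c g(1) SA by (intro functional_sum l(1)) auto
      also have "\<dots> = (\<Sum>d\<in>S. if d = c then l (g c) c else 0)"
        by (rule sum.cong) (use c g(3) in auto)
      finally show ?thesis using finS c by simp
    qed
    then have "M x = (\<Sum>c\<in>S. g c)"
      unfolding M_def by (intro sum.cong) (simp_all add: g(2))
    also have "\<dots> = x"
      unfolding x_def using sum.reindex[OF inj, of "\<lambda>x. x"] gS by simp
    finally show ?thesis .
  qed
  ultimately have "x = 0" by (rule no_fixed)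
  then have "(\<Sum>v\<in>S. 1 *s v) = 0" by (simp add: x_def)
  moreover obtain v where "v \<in> S" using Sne by blast
  ultimately have "(1::'a) = 0"
    using independentD[OF A(2) finS SA, of "\<lambda>_. 1" v] by simp
  then show False by simp
qed

text \<open>The sum of S and the line of z is direct. If its cardinality is that of
  \<open>range P\<close>, then S is a hyperplane complementary to z.\<close>

lemma card_hyperplane_le:
  assumes S: "subspace S" "S \<subseteq> range P" and z: "z \<in> range P" "z \<notin> S"
  shows "card S * CARD('a) \<le> card (range P)"
    and "card S * CARD('a) = card (range P) \<Longrightarrow> x \<in> range P \<Longrightarrow>
      \<exists>v\<in>S. \<exists>c. x = v + c *s z"
proof -
  define h where "h = (\<lambda>(v, c). v + c *s z)"
  have inj: "inj_on h (S \<times> UNIV)"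
  proof (rule inj_onI, clarsimp simp: h_def)
    fix v c v' c' assume v: "v \<in> S" "v' \<in> S" and eq: "v + c *s z = v' + c' *s z"
    have "0 + (c - c') *s z = v' - v"
      using eq by (simp add: scale_left_diff_distrib algebra_simps)
    then have "0 + (c - c') *s z \<in> S" using v subspace_diff[OF S(1)] by simp
    then have "c - c' = 0"
      using at_most_one_translate[OF S(1) z(2), of 0 "c - c'" 0] subspace_0[OF S(1)] by simp
    then show "v = v' \<and> c = c'" using eq by simp
  qed
  have sub: "h ` (S \<times> UNIV) \<subseteq> range P"
    using S(2) z(1) by (auto simp: h_def intro!: subspace_add[OF subspace_range] subspace_scale[OF subspace_range])
  have card: "card (h ` (S \<times> UNIV)) = card S * CARD('a)"
    using card_image[OF inj] by (simp add: card_cartesian_product)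
  show "card S * CARD('a) \<le> card (range P)"
    using card_mono[OF finite_range sub] card by simp
  show "\<exists>v\<in>S. \<exists>c. x = v + c *s z"
    if "card S * CARD('a) = card (range P)" "x \<in> range P"
  proof -
    have "h ` (S \<times> UNIV) = range P"
      using card_subset_eq[OF finite_range sub] card that(1) by simp
    then have "x \<in> h ` (S \<times> UNIV)" using that(2) by simp
    then show ?thesis by (auto simp: h_def)
  qed
qed

end

section \<open>The quotient by a vector and the cardinality bound\<close>

context operator_space
begin

text \<open>With \<open>f z = 1\<close>, the quotient by z is realised as the kernel of f: M is
  followed by the projection along z onto this kernel. For M = P the result is the projection of the
  smaller space.\<close>

definition deflate :: "('b \<Rightarrow> 'a) \<Rightarrow> 'b \<Rightarrow> ('b \<Rightarrow> 'b) \<Rightarrow> 'b \<Rightarrow> 'b" where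
  "deflate f z M = (\<lambda>x. M x - f (M x) *s z)"

text \<open>For z \<noteq> 0, an operator of V that preserves the line of z must kill z, since
  otherwise a multiple of it would fix z. Hence these are all the operators that act on the
  quotient.\<close>

definition deflate_ops :: "('b \<Rightarrow> 'a) \<Rightarrow> 'b \<Rightarrow> ('b \<Rightarrow> 'b) set" where
  "deflate_ops f z = deflate f z ` {M \<in> V. M z = 0}"

context
  fixes f z assumes z: "z \<in> range P" and f: "functional f" and fz: "f z = 1"
begin

lemma deflate_P: "deflate f z P x = P x - f x *s z"
  by (simp add: deflate_def functional_P[OF f])

lemma range_deflate_iff: "x \<in> range (deflate f z P) \<longleftrightarrow> x \<in> range P \<and> f x = 0"
proof
  assume "x \<in> range (deflate f z P)"
  then obtain y where y: "x = P y - f y *s z" using deflate_P by auto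
  then have "x \<in> range P" by (simp only:) (intro range_diff range_scale z rangeI)
  then show "x \<in> range P \<and> f x = 0" using y f fz by (simp add: functional_simps functional_P)
next
  assume "x \<in> range P \<and> f x = 0"
  then have "deflate f z P x = x" by (simp add: deflate_P in_range_iff)
  then show "x \<in> range (deflate f z P)" by (metis rangeI)
qed

lemma card_range_deflate: "card (range P) = card (range (deflate f z P)) * CARD('a)"
proof -
  have "bij_betw (\<lambda>x. (deflate f z P x, f x)) (range P) (range (deflate f z P) \<times> UNIV)"
  proof (rule bij_betwI[of _ _ _ "\<lambda>(h, c). h + c *s z"])
    show "(\<lambda>(h, c). h + c *s z) \<in> range (deflate f z P) \<times> UNIV \<rightarrow> range P"
    proof (rule funcsetI)
      fix y assume "y \<in> range (deflate f z P) \<times> (UNIV :: 'a set)"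
      then obtain h c where "y = (h, c)" "h \<in> range (deflate f z P)" by blast
      then show "(\<lambda>(h, c). h + c *s z) y \<in> range P"
        using z range_deflate_iff[of h] range_add range_scale by simp
    qed
  next
    fix x assume "x \<in> range P"
    then show "(\<lambda>(h, c). h + c *s z) (deflate f z P x, f x) = x"
      by (simp add: deflate_P in_range_iff)
  next
    fix y assume "y \<in> range (deflate f z P) \<times> (UNIV :: 'a set)"
    then obtain h c where "y = (h, c)" "h \<in> range (deflate f z P)" by blast
    then have "y = (h, c)" "h \<in> range P" "f h = 0" using range_deflate_iff by auto
    then show "(deflate f z P ((\<lambda>(h, c). h + c *s z) y), f ((\<lambda>(h, c). h + c *s z) y)) = y"
      using f fz z by (simp add: deflate_P in_range_iff P_add P_scale functional_simps)
  qed auto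
  then show ?thesis
    using bij_betw_same_card by (fastforce simp: card_cartesian_product)
qed

lemma operator_space_deflate: "operator_space scale (deflate f z P) (deflate_ops f z)"
proof
  fix x y c
  show "deflate f z P (x + y) = deflate f z P x + deflate f z P y"
    by (simp add: deflate_P P_add functional_simps f algebra_simps scale_left_distrib)
  show "deflate f z P (c *s x) = c *s deflate f z P x"
    by (simp add: deflate_P P_scale functional_simps f algebra_simps scale_right_diff_distrib)
  show "deflate f z P (deflate f z P x) = deflate f z P x"
    using range_deflate_iff[of "deflate f z P x"] deflate_P[of "deflate f z P x"]
      in_range_iff[of "deflate f z P x"] by simp
  have "range (deflate f z P) \<subseteq> range P" using range_deflate_iff by blast
  then show "finite (range (deflate f z P))" using finite_range finite_subset by blast
  show "(\<lambda>x. 0) \<in> deflate_ops f z"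
    unfolding deflate_ops_def
    by (rule image_eqI[of _ _ "\<lambda>x. 0"]) (auto simp: deflate_def V_zero functional_0[OF f])
next
  fix M N c assume "M \<in> deflate_ops f z" "N \<in> deflate_ops f z"
  then obtain M' N' where MN: "M' \<in> V" "M' z = 0" "M = deflate f z M'" "N' \<in> V" "N' z = 0" "N = deflate f z N'"
    unfolding deflate_ops_def by blast
  show "(\<lambda>x. M x + N x) \<in> deflate_ops f z"
    unfolding deflate_ops_def
    by (rule image_eqI[of _ _ "\<lambda>x. M' x + N' x"])
      (use MN f in \<open>auto simp: deflate_def functional_simps algebra_simps scale_left_distrib intro!: V_add\<close>)
next
  fix M c assume "M \<in> deflate_ops f z"
  then obtain M' where MN: "M' \<in> V" "M' z = 0" "M = deflate f z M'"
    unfolding deflate_ops_def by blast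
  show "(\<lambda>x. c *s M x) \<in> deflate_ops f z"
    unfolding deflate_ops_def
    by (rule image_eqI[of _ _ "\<lambda>x. c *s M' x"])
      (use MN f in \<open>auto simp: deflate_def functional_simps algebra_simps scale_right_diff_distrib intro!: V_scale\<close>)
  fix x y
  show "M (x + y) = M x + M y"
    using MN f by (simp add: deflate_def functional_simps op_simps algebra_simps scale_left_distrib)
  show "M (c *s x) = c *s M x"
    using MN f by (simp add: deflate_def functional_simps op_simps algebra_simps scale_right_diff_distrib)
  have "M x \<in> range P"
    unfolding MN(3) deflate_def by (intro range_diff range_scale z op_in_range MN(1))
  moreover have "f (M x) = 0"
    using MN(3) f fz by (simp add: deflate_def functional_simps)
  ultimately show "deflate f z P (M x) = M x"
    by (simp add: deflate_P in_range_iff)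
  show "M (deflate f z P x) = M x"
    using MN by (simp add: deflate_P) (simp add: deflate_def op_simps op_P)
  assume fx: "M x = x"
  obtain c where c: "c = f (M' x)" by blast
  have eq: "M' x = x + c *s z"
  proof -
    have "M' x - c *s z = x" using fx unfolding MN(3) deflate_def c .
    then show ?thesis by (metis diff_add_cancel)
  qed
  \<comment> \<open>A vector fixed modulo z lifts to a truly fixed one: M' kills z, so adding
    \<open>c *s z\<close> does not change the image.\<close>
  have "M' (x + c *s z) = x + c *s z"
    using MN by (simp add: op_simps eq)
  then have "x + c *s z = 0" using MN(1) no_fixed by blast
  then have "M' x = 0" by (simp add: eq)
  then have "c = 0" by (simp add: c functional_0[OF f])
  with \<open>x + c *s z = 0\<close> show "x = 0" by simp
qed

text \<open>An operator that deflates to zero has its image in the line of z. If it were nonzero it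
  would be of rank one and z would be bad.\<close>

lemma deflate_inj:
  assumes good: "\<not> bad z" "z \<noteq> 0"
  shows "inj_on (deflate f z) {M \<in> V. M z = 0}"
proof (rule inj_onI)
  fix M N assume M: "M \<in> {M \<in> V. M z = 0}" and N: "N \<in> {M \<in> V. M z = 0}"
    and eq: "deflate f z M = deflate f z N"
  define D where "D = (\<lambda>x. M x - N x)"
  have D: "D \<in> V" using M N V_diff by (simp add: D_def)
  have "D x = f (D x) *s z" for x
  proof -
    have "M x - f (M x) *s z = N x - f (N x) *s z"
      using fun_cong[OF eq, of x] unfolding deflate_def .
    then have "M x - N x = f (M x) *s z - f (N x) *s z"
      by (metis add_diff_cancel_right diff_add_cancel diff_diff_eq2 add.commute)
    then show ?thesis
      unfolding D_def functional_diff[OF f] scale_left_diff_distrib .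
  qed
  then have Deq: "D = (\<lambda>x. f (D x) *s z)" by (rule ext)
  have "functional (\<lambda>x. f (D x))"
    using D f by (auto simp: functional_def op_simps op_P)
  moreover have "(\<lambda>x. f (D x) *s z) \<in> V" using D Deq by simp
  ultimately have "(\<lambda>x. f (D x)) = (\<lambda>_. 0)" using good z unfolding bad_def by blast
  then have "D = (\<lambda>_. 0)" using Deq by (metis scale_zero_left)
  then show "M = N" by (auto simp: D_def fun_eq_iff)
qed

end

text \<open>Rank-nullity for the evaluation at z, in terms of cardinalities.\<close>

lemma card_ops: "card V = card ((\<lambda>M. M z) ` V) * card {M \<in> V. M z = 0}"
proof (rule card_image_kernel[OF finite_ops])
  fix y assume "y \<in> (\<lambda>M. M z) ` V"
  then obtain M0 where M0: "M0 \<in> V" "y = M0 z" by blast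
  have "bij_betw (\<lambda>M x. M x + M0 x) {M \<in> V. M z = 0} {M \<in> V. M z = y}"
  proof (rule bij_betwI[of _ _ _ "\<lambda>M x. M x - M0 x"])
    show "(\<lambda>M x. M x + M0 x) \<in> {M \<in> V. M z = 0} \<rightarrow> {M \<in> V. M z = y}"
    proof (rule funcsetI)
      fix M assume "M \<in> {M \<in> V. M z = 0}"
      then show "(\<lambda>x. M x + M0 x) \<in> {M \<in> V. M z = y}" using V_add[of M M0] M0 by simp
    qed
    show "(\<lambda>M x. M x - M0 x) \<in> {M \<in> V. M z = y} \<rightarrow> {M \<in> V. M z = 0}"
    proof (rule funcsetI)
      fix M assume "M \<in> {M \<in> V. M z = y}"
      then show "(\<lambda>x. M x - M0 x) \<in> {M \<in> V. M z = 0}" using V_diff[of M M0] M0 by simp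
    qed
  qed simp_all
  then show "card {M \<in> V. M z = y} = card {M \<in> V. M z = 0}"
    using bij_betw_same_card by fastforce
qed

lemma exists_good:
  assumes "range P \<noteq> {0}"
  obtains z where "z \<in> range P" "z \<noteq> 0" "\<not> bad z"
proof -
  obtain z where z: "z \<in> range P" "z \<notin> span {x. bad x}"
    using bad_vectors_not_spanning[OF assms] by blast
  show ?thesis
  proof (rule that[OF z(1)])
    show "z \<noteq> 0" using z(2) span_zero by auto
    show "\<not> bad z" using z(2) span_base[of z "{x. bad x}"] by auto
  qed
qed

end

lemma card_field_ge_2: "2 \<le> CARD('a::{field,finite})"
proof -
  have "card {0, 1 :: 'a} \<le> CARD('a)" by (rule card_mono) auto
  then show ?thesis by simp
qed

lemma choose_two_Suc: "Suc n choose 2 = n + (n choose 2)"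
  by (simp add: numeral_2_eq_2)

text \<open>Evaluate at a good z. The orbit \<open>V z\<close> misses z, so it is at most a
  hyperplane; the operators killing z embed into the quotient, where induction applies. The
  exponents add up by Pascal's rule.\<close>

lemma card_ops_le:
  fixes scale :: "'a::{field,finite} \<Rightarrow> 'b::ab_group_add \<Rightarrow> 'b" (infixr \<open>*s\<close> 75)
  assumes "operator_space scale P V" and "card (range P) = CARD('a) ^ n"
  shows "card V \<le> CARD('a) ^ (n choose 2)"
  using assms
proof (induction n arbitrary: P V)
  case 0
  interpret operator_space scale P V by (fact 0)
  have "range P = {0}" using 0(2) range_trivial by simp
  then have "V \<subseteq> {\<lambda>x. 0}" using op_in_range by fastforce
  then show ?case using card_mono[of "{\<lambda>x. 0 :: 'b}" V] by (simp add: numeral_2_eq_2)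
next
  case (Suc n)
  let ?q = "CARD('a)"
  interpret operator_space scale P V by (fact Suc.prems)
  have q0: "?q > 0" by (simp add: card_gt_0_iff)
  have q2: "?q \<ge> 2" by (rule card_field_ge_2)
  have "?q ^ Suc n > 1" using q2 by (intro one_less_power) auto
  then have "card (range P) > 1" using Suc.prems(2) by simp
  then have "range P \<noteq> {0}" by auto
  then obtain z where z: "z \<in> range P" "z \<noteq> 0" "\<not> bad z" by (rule exists_good)
  obtain f where f: "f \<in> ann z" "f z = 1" by (rule exists_ann[OF z(1,2)])
  have fn: "functional f" using f(1) by (simp add: ann_def)
  have "card (range (deflate f z P)) = ?q ^ n"
    using card_range_deflate[OF z(1) fn f(2)] Suc.prems(2) q0 by simp
  from Suc.IH[OF operator_space_deflate[OF z(1) fn f(2)] this]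
  have "card (deflate_ops f z) \<le> ?q ^ (n choose 2)" .
  moreover have "card (deflate_ops f z) = card {M \<in> V. M z = 0}"
    unfolding deflate_ops_def by (rule card_image[OF deflate_inj[OF z(1) fn f(2) z(3,2)]])
  moreover have "card ((\<lambda>M. M z) ` V) \<le> ?q ^ n"
    using card_hyperplane_le(1)[OF subspace_orbit orbit_subset z(1) not_in_orbit[OF z(2)]]
      Suc.prems(2) q0 by simp
  ultimately have "card V \<le> ?q ^ n * ?q ^ (n choose 2)"
    using card_ops[of z] by (simp add: mult_le_mono)
  then show ?case by (simp add: choose_two_Suc power_add)
qed

section \<open>Equality in the cardinality bound\<close>

locale maximal_operator_space = operator_space scale P V
  for scale :: "'a::{field,finite} \<Rightarrow> 'b::ab_group_add \<Rightarrow> 'b" (infixr \<open>*s\<close> 75) and P V +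
  fixes n :: nat
  assumes card_range: "card (range P) = CARD('a) ^ n"
    and card_maximal: "card V = CARD('a) ^ (n choose 2)"
begin

text \<open>Maximality turns both estimates behind the bound into equalities: the orbit of z is the
  whole kernel of f, and the deflated space is again maximal.\<close>

lemma maximal_good:
  assumes z: "z \<in> range P" "z \<noteq> 0" "\<not> bad z"
  shows "\<exists>f. functional f \<and> f z = 1 \<and> (\<forall>M\<in>V. f (M z) = 0)
    \<and> (\<forall>x\<in>range P. f x = 0 \<longrightarrow> (\<exists>M\<in>V. M z = x))
    \<and> maximal_operator_space scale (deflate f z P) (deflate_ops f z) (n - 1) \<and> n \<ge> 1"
proof -
  let ?q = "CARD('a)"
  have q2: "?q \<ge> 2" by (rule card_field_ge_2)
  then have q0: "?q > 0" by simp
  obtain f where f: "f \<in> ann z" "f z = 1" by (rule exists_ann[OF z(1,2)])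
  have fn: "functional f" and fV: "\<And>M. M \<in> V \<Longrightarrow> f (M z) = 0" using f(1) by (auto simp: ann_def)
  have n: "n \<ge> 1"
  proof (rule ccontr)
    assume "\<not> n \<ge> 1"
    then have "card (range P) = 1" using card_range by simp
    then have "range P = {0}" by (rule range_trivial)
    then show False using z by simp
  qed
  then obtain m where m: "n = Suc m" by (cases n) auto
  have cr: "card (range (deflate f z P)) = ?q ^ m"
    using card_range_deflate[OF z(1) fn f(2)] card_range m q0 by simp
  have le1: "card (deflate_ops f z) \<le> ?q ^ (m choose 2)"
    by (rule card_ops_le[OF operator_space_deflate[OF z(1) fn f(2)] cr])
  have eq1: "card (deflate_ops f z) = card {M \<in> V. M z = 0}"
    unfolding deflate_ops_def by (rule card_image[OF deflate_inj[OF z(1) fn f(2) z(3,2)]])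
  have le2: "card ((\<lambda>M. M z) ` V) \<le> ?q ^ m"
    using card_hyperplane_le(1)[OF subspace_orbit orbit_subset z(1) not_in_orbit[OF z(2)]]
      card_range m q0 by simp
  have prod: "card ((\<lambda>M. M z) ` V) * card (deflate_ops f z) = ?q ^ m * ?q ^ (m choose 2)"
    using card_ops[of z] card_maximal eq1 m by (simp add: choose_two_Suc power_add)
  have pos: "?q ^ m > 0" "?q ^ (m choose 2) > 0" using q0 by auto
  have e1: "card (deflate_ops f z) = ?q ^ (m choose 2)"
  proof (rule ccontr)
    assume "\<not> ?thesis"
    then have "card (deflate_ops f z) < ?q ^ (m choose 2)" using le1 by simp
    then have "card ((\<lambda>M. M z) ` V) * card (deflate_ops f z) < ?q ^ m * ?q ^ (m choose 2)"
      using le2 pos by (metis mult_le_mono1 mult_less_mono2 order_le_less_trans)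
    then show False using prod by simp
  qed
  then have e2: "card ((\<lambda>M. M z) ` V) = ?q ^ m" using prod pos by simp
  have onto: "\<exists>M\<in>V. M z = x" if x: "x \<in> range P" "f x = 0" for x
  proof -
    have "card ((\<lambda>M. M z) ` V) * ?q = card (range P)" using e2 card_range m by simp
    from card_hyperplane_le(2)[OF subspace_orbit orbit_subset z(1) not_in_orbit[OF z(2)] this x(1)]
    obtain M c where M: "M \<in> V" "x = M z + c *s z" by blast
    then have "f x = c" using fn f(2) fV by (simp add: functional_simps)
    then show "\<exists>M\<in>V. M z = x" using M x(2) by auto
  qed
  have max: "maximal_operator_space scale (deflate f z P) (deflate_ops f z) (n - 1)"
  proof -
    interpret D: operator_space scale "deflate f z P" "deflate_ops f z"
      by (rule operator_space_deflate[OF z(1) fn f(2)])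
    show ?thesis by unfold_locales (use cr e1 m in auto)
  qed
  show ?thesis
  proof (intro exI[of _ f] conjI ballI impI)
    show "\<exists>M\<in>V. M z = x" if "x \<in> range P" "f x = 0" for x using that by (rule onto)
    show "f (M z) = 0" if "M \<in> V" for M using that by (rule fV)
  qed (fact fn f(2) max n)+
qed

text \<open>The orbit of a good z is a hyperplane avoiding z, so a functional killing it is
  determined by its value at z.\<close>

lemma good_ann_line:
  assumes z: "z \<in> range P" "z \<noteq> 0" "\<not> bad z" and f: "f \<in> ann z" and g: "g \<in> ann z" "g \<noteq> (\<lambda>_. 0)"
  obtains c where "\<And>x. f x = c * g x"
proof -
  obtain h where h: "functional h" "h z = 1"
    "\<forall>x\<in>range P. h x = 0 \<longrightarrow> (\<exists>M\<in>V. M z = x)"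
    using maximal_good[OF z] by blast
  have eq: "k x = k z * h x" if k: "k \<in> ann z" for k x
  proof -
    have fk: "functional k" using k by (simp add: ann_def)
    have "P x - h x *s z \<in> range P"
      by (intro range_diff range_scale z rangeI)
    moreover have "h (P x - h x *s z) = 0"
      using h by (simp add: functional_simps functional_P)
    ultimately obtain M where "M \<in> V" "M z = P x - h x *s z" using h(3) by blast
    then have "k (P x - h x *s z) = 0" using k unfolding ann_def by (metis (mono_tags, lifting) mem_Collect_eq)
    then show ?thesis using fk by (simp add: functional_simps functional_P)
  qed
  have gz: "g z \<noteq> 0"
  proof
    assume "g z = 0"
    then have "g x = 0" for x using eq[OF g(1), of x] by simp
    then show False using g(2) by blast
  qed
  show ?thesis
  proof (rule that[of "f z / g z"])
    fix x
    have "f z / g z * g x = f z / g z * (g z * h x)" by (simp only: eq[OF g(1), of x])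
    also have "\<dots> = f x" using gz by (simp add: eq[OF f, of x])
    finally show "f x = f z / g z * g x" ..
  qed
qed

end

section \<open>Good vectors and their functionals\<close>

text \<open>A good vector \<open>z\<close> with its functional \<open>f\<close>, where \<open>Q\<close> is the set of bad vectors of the space
  induced on the quotient by \<open>z\<close>, as provided by the induction hypothesis.\<close>

locale pivot = maximal_operator_space scale P V n
  for scale :: "'a::{field,finite} \<Rightarrow> 'b::ab_group_add \<Rightarrow> 'b" (infixr \<open>*s\<close> 75) and P V n +
  fixes z :: 'b and f :: "'b \<Rightarrow> 'a" and Q :: "'b set"
  assumes card_ge_3: "CARD('a) \<ge> 3"
    and z: "z \<in> range P" "z \<noteq> 0" "\<not> bad z"
    and f: "functional f" "f z = 1"
    and f_op_z: "\<And>M. M \<in> V \<Longrightarrow> f (M z) = 0"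
    and maximal_deflate: "maximal_operator_space scale (deflate f z P) (deflate_ops f z) (n - 1)"
    and radical_deflate: "operator_space.radical scale (deflate f z P) (deflate_ops f z) Q"
begin

interpretation D: maximal_operator_space scale "deflate f z P" "deflate_ops f z" "n - 1"
  by (rule maximal_deflate)

lemmas rad = radical_deflate[unfolded D.radical_def]

lemmas f_simps = functional_simps[OF f(1)]

text \<open>The preimage of the bad set of the quotient. It is proper and contains z, and a vector
  outside it is good modulo z.\<close>

definition C :: "'b set" where "C = {x \<in> range P. deflate f z P x \<in> Q}"

text \<open>The annihilator of the orbit of u under the stabiliser of z only. It contains
  \<open>ann u\<close> and also the annihilators of all z + s u with s \<noteq> 0, and for u outside
  \<open>C\<close> its dimension is at most two.\<close>

definition stab_ann :: "'b \<Rightarrow> ('b \<Rightarrow> 'a) set" where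
  "stab_ann u = {g. functional g \<and> (\<forall>M\<in>V. M z = 0 \<longrightarrow> g (M u) = 0)}"

lemma dP: "deflate f z P x = P x - f x *s z"
  by (rule deflate_P[OF z(1) f])

lemma subspace_C: "subspace C"
proof (rule subspaceI)
  have Q: "subspace Q" using rad by blast
  show "0 \<in> C" using subspace_0[OF Q] range_zero in_range_iff[of 0] by (simp add: C_def dP f_simps)
  show "x + y \<in> C" if "x \<in> C" "y \<in> C" for x y
    using that subspace_add[OF Q] range_add D.P_add by (simp add: C_def)
  show "c *s x \<in> C" if "x \<in> C" for c x
    using that subspace_scale[OF Q] range_scale D.P_scale by (simp add: C_def)
qed

lemma z_in_C: "z \<in> C"
proof -
  have "subspace Q" using rad by blast
  then show ?thesis using z(1) f(2) subspace_0 in_range_iff[of z] by (simp add: C_def dP)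
qed

lemma C_proper: "\<not> range P \<subseteq> C"
proof
  assume sub: "range P \<subseteq> C"
  have "range (deflate f z P) \<subseteq> Q"
  proof
    fix x assume x: "x \<in> range (deflate f z P)"
    then have "x \<in> C" using sub range_deflate_iff[OF z(1) f] by blast
    moreover have "deflate f z P x = x" using x D.in_range_iff by blast
    ultimately show "x \<in> Q" by (simp add: C_def)
  qed
  then show False using rad by blast
qed

lemma deflate_good:
  assumes "u \<in> range P" "u \<notin> C"
  shows "deflate f z P u \<in> range (deflate f z P)" "deflate f z P u \<notin> Q"
    "deflate f z P u \<noteq> 0" "\<not> D.bad (deflate f z P u)"
proof -
  show 1: "deflate f z P u \<in> range (deflate f z P)" by simp
  show 2: "deflate f z P u \<notin> Q" using assms by (simp add: C_def)
  then show 3: "deflate f z P u \<noteq> 0" using rad subspace_0 by metis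
  show "\<not> D.bad (deflate f z P u)" using 1 2 3 rad by blast
qed

lemma deflate_op: "M \<in> V \<Longrightarrow> M z = 0 \<Longrightarrow> deflate f z M (deflate f z P u) = M u - f (M u) *s z"
  by (simp add: dP deflate_def[of f z M] op_simps op_P)

text \<open>As \<open>g z = 0\<close>, g descends to the quotient by z. There u is good, so its
  orbit is a hyperplane avoiding it; g kills this hyperplane as well as u.\<close>

lemma stab_ann_eq_0:
  assumes u: "u \<in> range P" "u \<notin> C" and g: "g \<in> stab_ann u" "g z = 0" "g u = 0"
  shows "g x = 0"
proof -
  have gf: "functional g" using g by (simp add: stab_ann_def)
  let ?u = "deflate f z P u"
  obtain h where h: "D.functional h" "h ?u = 1"
    "\<forall>x\<in>range (deflate f z P). h x = 0 \<longrightarrow> (\<exists>N\<in>deflate_ops f z. N ?u = x)"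
    using D.maximal_good[OF deflate_good(1,3,4)[OF u]] by blast
  have gu: "g ?u = 0" using g gf by (simp add: dP functional_simps functional_P)
  define y where "y = deflate f z P x - h x *s ?u"
  have "y \<in> range (deflate f z P)" unfolding y_def
    by (intro D.range_diff D.range_scale rangeI)
  moreover have "h y = 0" using h(1,2) by (simp add: y_def D.functional_simps D.functional_P)
  ultimately obtain M where M: "M \<in> V" "M z = 0" "y = deflate f z M ?u"
    using h(3) by (auto simp: deflate_ops_def)
  have "g y = g (M u)" unfolding M(3) deflate_op[OF M(1,2)] using gf g(2) by (simp add: functional_simps)
  also have "\<dots> = 0" using g(1) M by (simp add: stab_ann_def)
  finally have "g (deflate f z P x) = 0" using gf gu by (simp add: y_def functional_simps)
  then show ?thesis using gf g(2) by (simp add: dP functional_simps functional_P)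
qed

text \<open>Elements of \<open>stab_ann u\<close> are determined by their values at z and u, so two
  independent ones span it; a and b come from Cramer's rule.\<close>

lemma stab_ann_span:
  assumes u: "u \<in> range P" "u \<notin> C" and g: "g \<in> stab_ann u" and h: "h \<in> stab_ann u"
    and nz: "\<exists>x. g x \<noteq> 0" and ind: "\<And>c. \<exists>x. h x \<noteq> c * g x" and k: "k \<in> stab_ann u"
  shows "\<exists>a b. \<forall>x. k x = a * g x + b * h x"
proof -
  have lin: "(\<lambda>x. a * g x + b * h x + c * k x) \<in> stab_ann u" for a b c
    using g h k functional_lincomb[of "\<lambda>x. a * g x + b * h x" k 1 c] functional_lincomb[of g h a b]
    by (auto simp: stab_ann_def)
  have zero: "a * g x + b * h x + c * k x = 0"
    if "a * g z + b * h z + c * k z = 0" "a * g u + b * h u + c * k u = 0" for a b c x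
    using stab_ann_eq_0[OF u lin, of a b c] that by blast
  define d where "d = g z * h u - g u * h z"
  have d: "d \<noteq> 0"
  proof
    assume d0: "d = 0"
    have 1: "h z * g x - g z * h x = 0" for x
      using zero[of "h z" "- g z" 0 x] d0 by (simp add: d_def algebra_simps)
    have 2: "h u * g x - g u * h x = 0" for x
      using zero[of "h u" "- g u" 0 x] d0 by (simp add: d_def algebra_simps)
    have gz: "g z = 0"
    proof (rule ccontr)
      assume "g z \<noteq> 0"
      then have "h x = h z / g z * g x" for x using 1[of x] by (simp add: field_simps)
      then show False using ind by blast
    qed
    have gu: "g u = 0"
    proof (rule ccontr)
      assume "g u \<noteq> 0"
      then have "h x = h u / g u * g x" for x using 2[of x] by (simp add: field_simps)
      then show False using ind by blast
    qed
    show False using nz stab_ann_eq_0[OF u g gz gu] by blast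
  qed
  define a where "a = (k z * h u - k u * h z) / d"
  define b where "b = (g z * k u - g u * k z) / d"
  have "a * g z + b * h z = k z" "a * g u + b * h u = k u"
    unfolding a_def b_def using d
    by (simp_all add: field_simps, simp_all add: d_def algebra_simps)
  then have "a * g x + b * h x + (- 1) * k x = 0" for x
    using zero[of a b "- 1" x] by simp
  then show ?thesis by (metis add_uminus_conv_diff eq_iff_diff_eq_0 mult_minus1)
qed

lemma ann_z: assumes "functional g" "\<And>M. M \<in> V \<Longrightarrow> g (M z) = 0" shows "g x = g z * f x"
proof -
  have g: "g \<in> ann z" and fz: "f \<in> ann z" using assms f f_op_z by (auto simp: ann_def)
  have "f \<noteq> (\<lambda>_. 0)" using f(2) by auto
  then obtain c where c: "\<And>x. g x = c * f x" using good_ann_line[OF z g fz] by blast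
  then show ?thesis using c[of z] f(2) by simp
qed

text \<open>The functionals w and v of z + u and z + t u lie in the plane \<open>stab_ann u\<close>
  together with g. Comparing them forces w into the span of f and g, and the relation that w
  satisfies becomes the first claim. For the second, k lies in the same plane, and h differs from a
  multiple of g by something that kills \<open>V z\<close>.\<close>

lemma pencil:
  assumes u: "u \<in> range P" "u \<notin> C" "\<not> bad u" and g: "g \<in> ann u" and ind: "\<And>c. \<exists>x. g x \<noteq> c * f x"
  shows "\<exists>c. c \<noteq> 0 \<and> (\<forall>M\<in>V. g (M z) + c * f (M u) = 0)" (is ?th1)
    and "functional h \<Longrightarrow> functional k \<Longrightarrow> (\<And>M. M \<in> V \<Longrightarrow> h (M z) + k (M u) = 0) \<Longrightarrow>
      (\<exists>a b. \<forall>x. h x = a * f x + b * g x) \<and> (\<exists>a b. \<forall>x. k x = a * f x + b * g x)"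
proof -
  have gf: "functional g" and gu: "\<And>M. M \<in> V \<Longrightarrow> g (M u) = 0" using g by (auto simp: ann_def)
  have gA: "g \<in> stab_ann u" using g by (auto simp: ann_def stab_ann_def)
  have gnz: "\<exists>x. g x \<noteq> 0" using ind[of 0] by simp
  have u0: "u \<noteq> 0" using u(2) subspace_0[OF subspace_C] by auto
  obtain t :: 'a where t: "t \<noteq> 0" "t \<noteq> 1" using exists_avoiding_two[OF card_ge_3] by blast
  have line: "\<exists>w. functional w \<and> (\<forall>M\<in>V. w (M z) + s * w (M u) = 0) \<and> w \<in> stab_ann u
      \<and> (\<forall>c. \<exists>x. w x \<noteq> c * g x)" if s: "s \<noteq> 0" for s
  proof -
    have "z + s *s u \<noteq> 0"
    proof
      assume "z + s *s u = 0"
      then have "s *s u = - z" using eq_neg_iff_add_eq_0 add.commute by metis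
      then have "s *s u \<in> C" using subspace_neg[OF subspace_C z_in_C] by simp
      then have "inverse s *s s *s u \<in> C" by (rule subspace_scale[OF subspace_C])
      then show False using u(2) s by simp
    qed
    moreover have "z + s *s u \<in> range P" by (intro range_add range_scale z u)
    ultimately obtain w where w: "w \<in> ann (z + s *s u)" "w (z + s *s u) = 1" using exists_ann by blast
    have wf: "functional w" using w by (simp add: ann_def)
    have wV: "w (M z) + s * w (M u) = 0" if M: "M \<in> V" for M
      using w(1) M wf by (auto simp: ann_def op_simps functional_simps)
    have wA: "w \<in> stab_ann u" unfolding stab_ann_def
    proof (intro CollectI conjI ballI impI)
      fix M assume "M \<in> V" "M z = 0"
      then show "w (M u) = 0" using wV[of M] s functional_0[OF wf] by simp
    qed (rule wf)
    \<comment> \<open>If w were a multiple of g, it would kill \<open>V u\<close>, hence by its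
      relation also \<open>V z\<close>; it would then be a multiple of f, and so would g.\<close>
    have "\<exists>x. w x \<noteq> c * g x" for c
    proof (rule ccontr)
      assume "\<not> ?thesis"
      then have wg: "w x = c * g x" for x by blast
      have "w (M z) = 0" if "M \<in> V" for M using wV[OF that] gu[OF that] by (simp add: wg)
      then have wf': "w x = w z * f x" for x using ann_z[OF wf] by blast
      have "c \<noteq> 0" using wg[of "z + s *s u"] w(2) by auto
      then have "g x = (w z / c) * f x" for x using wg[of x] wf'[of x] by (simp add: field_simps)
      then show False using ind by blast
    qed
    then show ?thesis using wf wV wA by blast
  qed
  obtain w where w: "functional w" "\<And>M. M \<in> V \<Longrightarrow> w (M z) + w (M u) = 0" "w \<in> stab_ann u"
    "\<And>c. \<exists>x. w x \<noteq> c * g x" using line[of 1] by auto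
  obtain v where v: "functional v" "\<And>M. M \<in> V \<Longrightarrow> v (M z) + t * v (M u) = 0" "v \<in> stab_ann u"
    "\<And>c. \<exists>x. v x \<noteq> c * g x" using line[OF t(1)] by auto
  obtain a b where ab: "\<And>x. v x = a * g x + b * w x"
    using stab_ann_span[OF u(1,2) gA w(3) gnz w(4) v(3)] by blast
  have b: "b \<noteq> 0" using v(4)[of a] ab by auto
  \<comment> \<open>Substituting \<open>v = a g + b w\<close> into the relation of v and eliminating
    \<open>w (M u) = - w (M z)\<close> shows that this combination kills \<open>V z\<close>, so it
    is a multiple of f.\<close>
  have "functional (\<lambda>x. a * g x + (b * (1 - t)) * w x)" by (rule functional_lincomb[OF gf w(1)])
  moreover have "a * g (M z) + (b * (1 - t)) * w (M z) = 0" if M: "M \<in> V" for M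
  proof -
    have "w (M u) = - w (M z)" using w(2)[OF M] by (simp add: eq_neg_iff_add_eq_0 add.commute)
    then show ?thesis using v(2)[OF M] gu[OF M] by (simp add: ab algebra_simps)
  qed
  ultimately obtain e where e: "\<And>x. a * g x + (b * (1 - t)) * w x = e * f x"
    using ann_z by blast
  define c where "c = e / (b * (1 - t))"
  define d where "d = - a / (b * (1 - t))"
  have bt: "b * (1 - t) \<noteq> 0" using b t by simp
  have wcd: "w x = c * f x + d * g x" for x
  proof -
    have "w x = (e * f x - a * g x) / (b * (1 - t))"
      using e[of x] bt by (simp add: field_simps)
    then show ?thesis by (simp add: c_def d_def diff_divide_distrib)
  qed
  have c0: "c \<noteq> 0" using w(4)[of d] wcd by auto
  have rel: "d * g (M z) + c * f (M u) = 0" if "M \<in> V" for M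
    using w(2)[OF that] gu[OF that] f_op_z[OF that] by (simp add: wcd)
  \<comment> \<open>Otherwise f would lie in \<open>ann u\<close>, which is a line and contains
    g.\<close>
  have d0: "d \<noteq> 0"
  proof
    assume "d = 0"
    then have "f (M u) = 0" if "M \<in> V" for M using rel[OF that] c0 by simp
    then have "f \<in> ann u" using f by (simp add: ann_def)
    moreover have "f \<noteq> (\<lambda>_. 0)" using f(2) by auto
    ultimately obtain r where "\<And>x. g x = r * f x"
      using good_ann_line[OF u(1) u0 u(3) g] by blast
    then show False using ind by blast
  qed
  have rel': "g (M z) = - (c / d) * f (M u)" if "M \<in> V" for M
    using rel[OF that] d0 by (simp add: field_simps eq_neg_iff_add_eq_0)
  show ?th1 using rel' c0 d0 by (intro exI[of _ "c / d"]) auto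
  assume hk: "functional h" "functional k" and hkV: "\<And>M. M \<in> V \<Longrightarrow> h (M z) + k (M u) = 0"
  have "k \<in> stab_ann u" unfolding stab_ann_def
  proof (intro CollectI conjI ballI impI)
    fix M assume "M \<in> V" "M z = 0"
    then show "k (M u) = 0" using hkV[of M] functional_0[OF hk(1)] by simp
  qed (rule hk)
  then obtain k1 k2 where k12: "\<And>x. k x = k1 * g x + k2 * w x"
    using stab_ann_span[OF u(1,2) gA w(3) gnz w(4)] by blast
  then have kk: "k x = (k2 * c) * f x + (k1 + k2 * d) * g x" for x by (simp add: wcd algebra_simps)
  have "functional (\<lambda>x. 1 * h x + (- (k2 * d)) * g x)" by (rule functional_lincomb[OF hk(1) gf])
  moreover have "1 * h (M z) + (- (k2 * d)) * g (M z) = 0" if M: "M \<in> V" for M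
    using hkV[OF M] gu[OF M] rel'[OF M] d0 by (simp add: kk mult.assoc)
  ultimately obtain r where r: "\<And>x. 1 * h x + (- (k2 * d)) * g x = r * f x"
    using ann_z by blast
  then have "h x = r * f x + (k2 * d) * g x" for x
    using r[of x] by (simp add: algebra_simps)
  then show "(\<exists>a b. \<forall>x. h x = a * f x + b * g x) \<and> (\<exists>a b. \<forall>x. k x = a * f x + b * g x)"
    using kk by blast
qed

lemma span_bad_proper: "\<not> range P \<subseteq> span {x. bad x}"
  using bad_vectors_not_spanning z by blast

lemma generic_induct [consumes 1, case_names generic lin]:
  assumes "u \<in> range P"
    and gen: "\<And>u. u \<in> range P \<Longrightarrow> u \<notin> C \<Longrightarrow> u \<notin> span {x. bad x} \<Longrightarrow> R u"
    and lin: "\<And>s w t. s \<in> range P \<Longrightarrow> w \<in> range P \<Longrightarrow> R s \<Longrightarrow> R w \<Longrightarrow> R (s + t *s w)"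
  shows "R u"
proof -
  obtain s w t where "s \<in> range P" "s \<notin> span {x. bad x}" "s \<notin> C" "w \<in> range P"
    "w \<notin> span {x. bad x}" "w \<notin> C" "u = s + t *s w"
    by (rule generic_difference[OF exists_avoiding_two[OF card_ge_3] subspace_span[of "{x. bad x}"] subspace_C
          subspace_range span_bad_proper C_proper assms(1)])
  then show ?thesis using gen lin by blast
qed

text \<open>The functional g is a value \<Phi>(u), normalised against \<Phi>(z) = f and unique up to
  multiples of f. For generic u it is a multiple of a functional in \<open>ann u\<close>; the
  relation is linear in u and so extends to all vectors.\<close>

lemma polar:
  assumes "u \<in> range P"
  shows "\<exists>g. functional g \<and> (\<forall>M\<in>V. g (M z) + f (M u) = 0)"
  using assms
proof (induction rule: generic_induct)
  case (generic u)
  have ub: "\<not> bad u" using generic(3) span_base[of u "{x. bad x}"] by auto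
  have u0: "u \<noteq> 0" using generic(3) span_zero by auto
  obtain g where g: "g \<in> ann u" "g u = 1" by (rule exists_ann[OF generic(1) u0])
  have gf: "functional g" using g by (simp add: ann_def)
  show ?case
  proof (cases "\<exists>c. \<forall>x. g x = c * f x")
    case True
    then obtain c where c: "\<And>x. g x = c * f x" by blast
    have "c \<noteq> 0" using c[of u] g(2) by auto
    moreover have "g (M u) = 0" if "M \<in> V" for M using g(1) that by (simp add: ann_def)
    ultimately have "f (M u) = 0" if "M \<in> V" for M using c that by simp
    moreover have "functional (\<lambda>_. 0)" by (simp add: functional_def)
    ultimately show ?thesis by (intro exI[of _ "\<lambda>_. 0"]) simp
  next
    case False
    then obtain c where c: "c \<noteq> 0" "\<And>M. M \<in> V \<Longrightarrow> g (M z) + c * f (M u) = 0"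
      using pencil(1)[OF generic(1,2) ub g(1)] by blast
    have "inverse c * g (M z) + f (M u) = 0" if "M \<in> V" for M
    proof -
      have "inverse c * (g (M z) + c * f (M u)) = 0" using c(2)[OF that] by simp
      then show ?thesis using c(1) by (simp add: distrib_left mult.assoc[symmetric])
    qed
    then show ?thesis using functional_mult[OF gf, of "inverse c"] by blast
  qed
next
  case (lin s w t)
  then obtain g h where g: "functional g" "\<forall>M\<in>V. g (M z) + f (M s) = 0"
    and h: "functional h" "\<forall>M\<in>V. h (M z) + f (M w) = 0" by blast
  have "functional (\<lambda>x. 1 * g x + t * h x)" by (rule functional_lincomb[OF g(1) h(1)])
  moreover have "(1 * g (M z) + t * h (M z)) + f (M (s + t *s w)) = 0" if M: "M \<in> V" for M
  proof -
    have "(g (M z) + f (M s)) + t * (h (M z) + f (M w)) = 0" using g(2) h(2) M by simp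
    then show ?thesis using M by (simp add: op_simps f_simps algebra_simps)
  qed
  ultimately show ?case by blast
qed

text \<open>Puts f into every \<open>stab_ann u\<close>, so that one further functional suffices to
  span it.\<close>

lemma f_stab:
  assumes "M \<in> V" "M z = 0"
  shows "f (M u) = 0"
proof -
  obtain g where "functional g" "g (M z) + f (M (P u)) = 0" using polar[of "P u"] assms by blast
  then show ?thesis by (simp add: functional_0 op_P assms)
qed

text \<open>Apply the polar relation to the rank-one operator with image the line of x. If
  \<open>f x\<close> were nonzero, f killing \<open>V z\<close> would give \<open>l z = 0\<close>,
  and the relation would then make l vanish everywhere.\<close>

lemma f_bad: assumes "bad x" shows "f x = 0"
proof (rule ccontr)
  assume fx: "f x \<noteq> 0"
  obtain l where l: "functional l" "l \<noteq> (\<lambda>_. 0)" "(\<lambda>y. l y *s x) \<in> V" using assms bad_def by blast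
  have lz: "l z = 0" using f_op_z[OF l(3)] fx by (simp add: f_simps)
  have "l u = 0" if u: "u \<in> range P" for u
  proof -
    obtain g where "functional g" "\<forall>M\<in>V. g (M z) + f (M u) = 0" using polar[OF u] by blast
    then have "g (l z *s x) + f (l u *s x) = 0" using l(3) by fast
    then show ?thesis using lz fx \<open>functional g\<close> by (simp add: functional_0 f_simps)
  qed
  then show False using l functional_eq_0I by blast
qed

end

section \<open>Excluding independent functionals at three vectors\<close>

context pivot
begin

interpretation D: maximal_operator_space scale "deflate f z P" "deflate_ops f z" "n - 1"
  by (rule maximal_deflate)

text \<open>Subtracting \<open>g z\<close> times f lets g descend to the quotient without changing
  its value at \<open>M k\<close>, where f vanishes. There it annihilates the orbit of v, so it
  kills Q by the last clause of \<open>radical\<close>, and Q contains the class of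
  \<open>M k\<close> by invariance.\<close>

lemma stab_ann_kills_C:
  assumes v: "v \<in> range P" "v \<notin> C" and g: "g \<in> stab_ann v" and k: "k \<in> C" and M: "M \<in> V" "M z = 0"
  shows "g (M k) = 0"
proof -
  have rad: "D.radical Q" by (rule radical_deflate)
  have gf: "functional g" using g by (simp add: stab_ann_def)
  define g' where "g' = (\<lambda>x. g x - g z * f x)"
  have Mk: "deflate f z N (deflate f z P x) = N x" if "N \<in> V" "N z = 0" for N x
    using deflate_op[OF that] f_stab[OF that] by simp
  have "D.functional g'"
    unfolding D.functional_def g'_def
    using gf f by (simp add: dP functional_simps functional_P algebra_simps)
  moreover have "g' (N (deflate f z P v)) = 0" if "N \<in> deflate_ops f z" for N
  proof -
    obtain N' where N': "N' \<in> V" "N' z = 0" "N = deflate f z N'" using \<open>N \<in> deflate_ops f z\<close> by (auto simp: deflate_ops_def)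
    then show ?thesis using Mk[OF N'(1,2)] f_stab[OF N'(1,2)] g by (simp add: g'_def stab_ann_def)
  qed
  ultimately have "g' \<in> D.ann (deflate f z P v)" by (simp add: D.ann_def)
  then have kill: "g' x = 0" if "x \<in> Q" for x
    using that rad deflate_good(1,2)[OF v] unfolding D.radical_def by blast
  have "deflate f z M (deflate f z P k) \<in> Q"
  proof -
    have "deflate f z M \<in> deflate_ops f z" using M by (auto simp: deflate_ops_def)
    then show ?thesis using rad k unfolding D.radical_def C_def by blast
  qed
  then have "g' (M k) = 0" using kill Mk[OF M] by simp
  then show ?thesis using f_stab[OF M] by (simp add: g'_def)
qed

lemma stab_ann_span_f:
  assumes u: "u \<in> range P" "u \<notin> C" and g: "g \<in> stab_ann u" "\<And>c. \<exists>x. g x \<noteq> c * f x" and h: "h \<in> stab_ann u"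
  shows "\<exists>a b. \<forall>x. h x = a * f x + b * g x"
proof (rule stab_ann_span[OF u _ g(1) _ g(2) h])
  show "f \<in> stab_ann u" using f f_stab by (simp add: stab_ann_def)
  show "\<exists>x. f x \<noteq> 0" using f(2) by (metis zero_neq_one)
qed

text \<open>On the span of \<open>z, v, u\<close> the form \<open>(x, y) \<mapsto> \<Phi>(x)(y)\<close> with
  \<open>\<Phi>(z) = f\<close>, \<open>\<Phi>(v) = g\<close>, \<open>\<Phi>(u) = h\<close> would be anisotropic of rank three.\<close>

lemma no_triple:
  assumes v: "v \<in> range P" "v \<notin> C" and u: "u \<in> range P" "u \<notin> C"
    and g: "functional g" and h: "functional h"
    and gv: "\<And>M. M \<in> V \<Longrightarrow> g (M v) = 0" and hu: "\<And>M. M \<in> V \<Longrightarrow> h (M u) = 0"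
    and gz: "\<And>M. M \<in> V \<Longrightarrow> g (M z) + f (M v) = 0"
    and hz: "\<And>M. M \<in> V \<Longrightarrow> h (M z) + f (M u) = 0"
    and hv: "\<And>M. M \<in> V \<Longrightarrow> h (M v) + s * f (M v) + g (M u) = 0"
    and ind: "\<And>a b c. (\<And>x. a * f x + b * g x + c * h x = 0) \<Longrightarrow> a = 0 \<and> b = 0 \<and> c = 0"
  shows False
proof -
  have fv: "f (M v) = - g (M z)" and fu: "f (M u) = - h (M z)" if "M \<in> V" for M
    using gz[OF that] hz[OF that] by (simp_all add: eq_neg_iff_add_eq_0 add.commute)
  have hv': "h (M v) = - s * f (M v) - g (M u)" if "M \<in> V" for M
    using hv[OF that] by (simp add: algebra_simps eq_neg_iff_add_eq_0)
  have stab: "h (M v) + g (M u) = 0" if "M \<in> V" "M z = 0" for M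
    using hv[OF that(1)] f_stab[OF that] by simp
  have gind: "\<exists>x. a * f x + b * g x + c * h x \<noteq> r * f x" if "b \<noteq> 0 \<or> c \<noteq> 0" for a b c r
  proof (rule ccontr)
    assume "\<not> ?thesis"
    then have "(a - r) * f x + b * g x + c * h x = 0" for x by (simp add: algebra_simps)
    then show False using ind[of "a - r" b c] that by blast
  qed
  \<comment> \<open>Only multiples of f kill \<open>V z\<close>, so g and h remain independent on
    \<open>V z\<close>.\<close>
  have kz: "b = 0 \<and> c = 0" if "\<And>M. M \<in> V \<Longrightarrow> b * g (M z) + c * h (M z) = 0" for b c
  proof -
    have "b * g x + c * h x = (b * g z + c * h z) * f x" for x
      by (rule ann_z[of "\<lambda>x. b * g x + c * h x"]) (rule functional_lincomb[OF g h], rule that)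
    then obtain e where eq: "\<And>x. b * g x + c * h x = e * f x" by blast
    show ?thesis
    proof (rule ccontr)
      assume "\<not> (b = 0 \<and> c = 0)"
      then have "b \<noteq> 0 \<or> c \<noteq> 0" by simp
      from gind[OF this, of 0 e] show False by (simp add: eq)
    qed
  qed
  have outside: "r *s z + a *s v + b *s u \<notin> C" if ab: "a \<noteq> 0 \<or> b \<noteq> 0" for r a b
  proof
    assume k: "r *s z + a *s v + b *s u \<in> C"
    show False
    proof (cases "b = 0")
      case True
      then have "r *s z + a *s v - r *s z \<in> C"
        using subspace_diff[OF subspace_C k subspace_scale[OF subspace_C z_in_C, of r]] by simp
      then have "a *s v \<in> C" by simp
      then have "inverse a *s a *s v \<in> C" by (rule subspace_scale[OF subspace_C])
      then show False using ab True v(2) by simp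
    next
      case False
      \<comment> \<open>For k in \<open>C\<close> and M killing z, g vanishes at \<open>M k\<close>
        and at \<open>M v\<close>, hence at \<open>M u\<close>. The plane \<open>stab_ann u\<close>
        would then contain f, g and h.\<close>
      have gA: "g \<in> stab_ann v" using g gv by (simp add: stab_ann_def)
      have "g (M u) = 0" if M: "M \<in> V" "M z = 0" for M
        using stab_ann_kills_C[OF v gA k M] M False g gv[OF M(1)] by (simp add: op_simps functional_simps)
      then have gA: "g \<in> stab_ann u" using g by (simp add: stab_ann_def)
      have hA: "h \<in> stab_ann u" using h hu by (simp add: stab_ann_def)
      have gc: "\<exists>x. g x \<noteq> c * f x" for c using gind[of 1 0 0 c] by simp
      obtain p q where "\<And>x. h x = p * f x + q * g x" using stab_ann_span_f[OF u gA gc hA] by blast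
      then have "p * f x + q * g x + (- 1) * h x = 0" for x by simp
      then show False using ind[of p q "- 1"] by simp
    qed
  qed
  \<comment> \<open>The number s measures how far g and h are from satisfying the polar relation
    between v and u. The functional annihilating the orbit of v + u is a combination of f and g + h,
    and evaluating it on this orbit leaves no room for s.\<close>
  have s: "s = 0"
  proof -
    define x where "x = 0 *s z + 1 *s v + 1 *s u"
    have x: "x \<in> range P" "x \<notin> C" unfolding x_def by (intro range_add range_scale z v u) (rule outside, simp)
    then have "x \<noteq> 0" using subspace_0[OF subspace_C] by auto
    then obtain w where w: "w \<in> ann x" "w x = 1" using exists_ann[OF x(1)] by blast
    have wA: "w \<in> stab_ann x" using w(1) by (simp add: ann_def stab_ann_def)
    have gh: "(\<lambda>x. 1 * g x + 1 * h x) \<in> stab_ann x"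
      unfolding stab_ann_def
    proof (intro CollectI conjI ballI impI)
      fix M assume M: "M \<in> V" "M z = 0"
      then show "1 * g (M x) + 1 * h (M x) = 0"
        using stab[OF M] g h gv[OF M(1)] hu[OF M(1)] by (simp add: x_def op_simps functional_simps algebra_simps)
    qed (rule functional_lincomb[OF g h])
    have ghc: "\<exists>x. 1 * g x + 1 * h x \<noteq> c * f x" for c using gind[of 1 1 0 c] by simp
    obtain p r where w': "\<And>y. w y = p * f y + r * (1 * g y + 1 * h y)"
      using stab_ann_span_f[OF x gh ghc wA] by blast
    have "(r * s - p) * g (M z) + (- p) * h (M z) = 0" if M: "M \<in> V" for M
    proof -
      have "w (M x) = 0" using w(1) M by (simp add: ann_def)
      then have "p * (f (M v) + f (M u)) + r * (h (M v) + g (M u)) = 0"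
        using M g h gv[OF M] hu[OF M] by (simp add: w' x_def op_simps functional_simps f_simps algebra_simps)
      then show ?thesis unfolding hv'[OF M] fv[OF M] fu[OF M] by (simp add: algebra_simps)
    qed
    then have "r * s - p = 0 \<and> - p = 0" by (rule kz)
    then have "p = 0" "r * s = 0" by auto
    moreover have "r \<noteq> 0" using w(2) w'[of x] \<open>p = 0\<close> by auto
    ultimately show ?thesis by simp
  qed
  have hgv: "h (M v) = - g (M u)" if "M \<in> V" for M using hv'[OF that] s by simp
  \<comment> \<open>The coefficients are those of \<Phi>(t)(t) for t = r z + a v + b u, where
    \<Phi>(t) is the functional y defined below.\<close>
  obtain r a b where nz: "\<not> (r = 0 \<and> a = 0 \<and> b = 0)" and iso:
    "f z * r\<^sup>2 + g v * a\<^sup>2 + h u * b\<^sup>2 + (f v + g z) * r * a + (f u + h z) * r * b + (g u + h v) * a * b = 0"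
    using ternary_form_isotropic by blast
  have ab: "a \<noteq> 0 \<or> b \<noteq> 0" using nz iso f(2) by auto
  define t where "t = r *s z + a *s v + b *s u"
  define y where "y = (\<lambda>x. r * f x + a * g x + b * h x)"
  have t: "t \<in> range P" "t \<notin> C" unfolding t_def by (intro range_add range_scale z v u) (rule outside[OF ab])
  have yt: "y t = 0"
    using iso g h by (simp add: y_def t_def functional_simps f_simps power2_eq_square algebra_simps)
  have yf: "functional y" unfolding y_def
    using functional_lincomb[OF functional_lincomb[OF f(1) g, of r a] h, of 1 b] by simp
  have yM: "y (M t) = 0" if M: "M \<in> V" for M
    using M g h gv[OF M] hu[OF M] f_op_z[OF M]
    by (simp add: y_def t_def op_simps functional_simps f_simps fv[OF M] fu[OF M] hgv[OF M] algebra_simps)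
  then have yA: "y \<in> stab_ann t" using yf by (simp add: stab_ann_def)
  have "t \<noteq> 0" using t(2) subspace_0[OF subspace_C] by auto
  then obtain w where w: "w \<in> ann t" "w t = 1" using exists_ann[OF t(1)] by blast
  have wA: "w \<in> stab_ann t" using w(1) by (simp add: ann_def stab_ann_def)
  have yc: "\<exists>x. y x \<noteq> c * f x" for c using gind[OF ab, of r c] by (simp add: y_def)
  obtain p q where w': "\<And>x. w x = p * f x + q * y x"
    using stab_ann_span_f[OF t yA yc wA] by blast
  \<comment> \<open>Since y vanishes at t whereas w does not, f must occur in w. As w and y both
    kill \<open>V t\<close>, so does f, and this forces a and b to vanish.\<close>
  have p: "p \<noteq> 0" using w'[of t] w(2) yt by auto
  have "a * g (M z) + b * h (M z) = 0" if M: "M \<in> V" for M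
  proof -
    have "w (M t) = 0" using w(1) M by (simp add: ann_def)
    then have "f (M t) = 0" using w' yM[OF M] p by simp
    then have "a * f (M v) + b * f (M u) = 0" using M f_op_z[OF M] by (simp add: t_def op_simps f_simps)
    then have "- (a * g (M z) + b * h (M z)) = 0" unfolding fv[OF M] fu[OF M] by (simp add: algebra_simps)
    then show ?thesis by (metis neg_equal_0_iff_equal)
  qed
  then have "a = 0 \<and> b = 0" by (rule kz)
  then show False using ab by simp
qed

end

section \<open>The rank of the form and the bad set\<close>

context maximal_operator_space
begin

text \<open>The annihilator of the kernel of \<Phi> seen inside the dual: a functional sent to 0 by
  composition with every M, or a plane of functionals stable under composition.\<close>

definition splits :: bool where
  "splits \<longleftrightarrow>
    (\<exists>f. functional f \<and> f \<noteq> (\<lambda>_. 0) \<and> (\<forall>M\<in>V. \<forall>x. f (M x) = 0)) \<or>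
    (\<exists>f g. functional f \<and> functional g \<and> f \<noteq> (\<lambda>_. 0) \<and> (\<forall>c. \<exists>x. g x \<noteq> c * f x) \<and>
      (\<forall>M\<in>V. (\<exists>a b. \<forall>x. f (M x) = a * f x + b * g x) \<and> (\<exists>a b. \<forall>x. g (M x) = a * f x + b * g x)))"

text \<open>The rank of \<Phi> is read off from the functionals of generic vectors: all multiples of
  f, all in the span of f and g, or three independent ones, which \<open>no_triple\<close> excludes.
  In the first two cases the radical is the common kernel of f, or of f and g.\<close>

lemma radical_step:
  assumes q3: "CARD('a) \<ge> 3" and nz: "range P \<noteq> {0}"
    and IH: "\<And>z f. maximal_operator_space scale (deflate f z P) (deflate_ops f z) (n - 1) \<Longrightarrow>
      \<exists>Q. operator_space.radical scale (deflate f z P) (deflate_ops f z) Q"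
  shows "(\<exists>Q. radical Q) \<and> splits"
proof -
  let ?B = "span {x. bad x}"
  have notB: "x \<noteq> 0" "\<not> bad x" if "x \<notin> ?B" for x
    using that span_zero span_base[of x "{x. bad x}"] by auto
  have piv: "\<exists>f Q. pivot scale P V n z f Q" if z: "z \<in> range P" "z \<noteq> 0" "\<not> bad z" for z
  proof -
    obtain f where f: "functional f" "f z = 1" "\<forall>M\<in>V. f (M z) = 0"
      "maximal_operator_space scale (deflate f z P) (deflate_ops f z) (n - 1)"
      using maximal_good[OF z] by blast
    obtain Q where Q: "operator_space.radical scale (deflate f z P) (deflate_ops f z) Q"
      using IH[OF f(4)] by blast
    have "pivot scale P V n z f Q"
      by (rule pivot.intro[OF maximal_operator_space_axioms], rule pivot_axioms.intro[OF q3 z f(1,2) _ f(4) Q])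
        (use f(3) in blast)
    then show ?thesis by blast
  qed
  \<comment> \<open>Any good vector can take the role of the pivot, with any functional of its
    annihilator line in place of f.\<close>
  have polar': "\<exists>d. functional d \<and> (\<forall>M\<in>V. d (M y) + k (M u) = 0)"
    if y: "y \<in> range P" "y \<noteq> 0" "\<not> bad y" and k: "k \<in> ann y" and u: "u \<in> range P" for y k u
  proof -
    obtain f Q where "pivot scale P V n y f Q" using piv[OF y] by blast
    then interpret Y: pivot scale P V n y f Q .
    have kf: "functional k" and kV: "\<And>M. M \<in> V \<Longrightarrow> k (M y) = 0" using k by (auto simp: ann_def)
    obtain c where c: "\<And>x. k x = c * f x" using Y.ann_z[OF kf] kV by blast
    obtain g where g: "functional g" "\<forall>M\<in>V. g (M y) + f (M u) = 0" using Y.polar[OF u] by blast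
    have "c * g (M y) + k (M u) = 0" if "M \<in> V" for M
    proof -
      have "c * (g (M y) + f (M u)) = 0" using g(2) that by simp
      then show ?thesis by (simp add: c distrib_left)
    qed
    then show ?thesis using functional_mult[OF g(1), of c] by blast
  qed
  have killed: "k x = 0" if y: "y \<in> range P" "y \<noteq> 0" "\<not> bad y" and k: "k \<in> ann y" and x: "bad x" for y k x
  proof -
    obtain f Q where "pivot scale P V n y f Q" using piv[OF y] by blast
    then interpret Y: pivot scale P V n y f Q .
    have kf: "functional k" and kV: "\<And>M. M \<in> V \<Longrightarrow> k (M y) = 0" using k by (auto simp: ann_def)
    have "k x = k y * f x" using Y.ann_z[OF kf] kV by blast
    then show ?thesis using Y.f_bad[OF x] by simp
  qed
  obtain z where z: "z \<in> range P" "z \<notin> ?B" using bad_vectors_not_spanning[OF nz] by blast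
  obtain f Q where "pivot scale P V n z f Q" using piv[OF z(1) notB[OF z(2)]] by blast
  then interpret Z: pivot scale P V n z f Q .
  have f0: "f \<noteq> (\<lambda>_. 0)" using Z.f(2) by auto
  show ?thesis
  proof (cases "\<forall>u\<in>range P. u \<notin> Z.C \<longrightarrow> u \<notin> ?B \<longrightarrow> (\<forall>g\<in>ann u. \<exists>c. \<forall>x. g x = c * f x)")
    case True
    \<comment> \<open>Rank one: f annihilates the orbits of generic vectors, hence all orbits by
      linearity.\<close>
    have fM': "\<forall>M\<in>V. f (M u) = 0" if "u \<in> range P" for u
      using that
    proof (induction rule: Z.generic_induct)
      case (generic u)
      obtain g where g: "g \<in> ann u" "g u = 1" by (rule exists_ann[OF generic(1) notB(1)[OF generic(3)]])
      obtain c where c: "\<And>x. g x = c * f x" using True generic g(1) by blast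
      have "c \<noteq> 0" using c[of u] g(2) by auto
      then show ?case using g(1) by (auto simp: ann_def c)
    next
      case (lin s w t)
      then show ?case by (simp add: op_simps Z.f_simps)
    qed
    have fM: "f (M x) = 0" if M: "M \<in> V" for M x
    proof -
      have "f (M (P x)) = 0" using fM'[of "P x"] M by blast
      then show ?thesis by (simp only: op_P[OF M])
    qed
    have fann: "f \<in> ann x" for x using fM Z.f(1) by (simp add: ann_def)
    define Q0 where "Q0 = {x \<in> range P. f x = 0}"
    have "radical Q0"
      unfolding radical_def
    proof (intro conjI ballI impI)
      show "subspace Q0"
        unfolding Q0_def by (rule subspaceI) (simp_all add: Z.f_simps range_zero range_add range_scale)
      show "Q0 \<subseteq> range P" by (auto simp: Q0_def)
      show "Q0 \<noteq> range P"
      proof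
        assume "Q0 = range P"
        then have "z \<in> Q0" using z(1) by blast
        then show False using Z.f(2) by (simp add: Q0_def)
      qed
      show "M x \<in> Q0" if "M \<in> V" "x \<in> Q0" for M x
        using that fM op_in_range by (simp add: Q0_def)
      show "(x \<in> Q0) = bad x" if x: "x \<in> range P" "x \<noteq> 0" for x
      proof
        assume xQ: "x \<in> Q0"
        show "bad x"
        proof (rule ccontr)
          assume b: "\<not> bad x"
          obtain e where e: "e \<in> ann x" "e x = 1" by (rule exists_ann[OF x])
          obtain c where "\<And>y. e y = c * f y" using good_ann_line[OF x b e(1) fann f0] by blast
          then show False using e(2) xQ by (simp add: Q0_def)
        qed
      next
        assume "bad x"
        then show "x \<in> Q0" using Z.f_bad x by (simp add: Q0_def)
      qed
      show "g x = 0" if v: "v \<in> range P - Q0" and g: "g \<in> ann v" and x: "x \<in> Q0" for v g x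
      proof -
        have fv: "f v \<noteq> 0" "v \<in> range P" using v by (auto simp: Q0_def)
        then have "v \<noteq> 0" "\<not> bad v" using Z.f_bad Z.f_simps(5) by auto
        then obtain c where "\<And>y. g y = c * f y" using good_ann_line[OF fv(2) _ _ g fann f0] by blast
        then show ?thesis using x by (simp add: Q0_def)
      qed
    qed
    then show ?thesis using fM Z.f(1) f0 unfolding splits_def by blast
  next
    case False
    then obtain v0 g0 where v0: "v0 \<in> range P" "v0 \<notin> Z.C" "v0 \<notin> ?B" and g0: "g0 \<in> ann v0" "\<And>c. \<exists>x. g0 x \<noteq> c * f x"
      by blast
    obtain c0 where c0: "c0 \<noteq> 0" "\<And>M. M \<in> V \<Longrightarrow> g0 (M z) + c0 * f (M v0) = 0"
      using Z.pencil(1)[OF v0(1,2) notB(2)[OF v0(3)] g0] by blast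
    \<comment> \<open>The vector v is a multiple of v0 for which z + v also avoids the span of the
      bad vectors, because z + v serves as a third pivot below. Rescaling g0 as well makes the
      constant in its relation with f equal to 1.\<close>
    obtain t0 where t0: "\<And>t. t \<noteq> t0 \<Longrightarrow> z + t *s v0 \<notin> ?B"
      using at_most_one_translate[OF subspace_span v0(3), of z] by blast
    obtain t where t: "t \<noteq> 0" "t \<noteq> t0" using exists_avoiding_two[OF q3] by blast
    define v where "v = t *s v0"
    define g where "g = (\<lambda>x. t / c0 * g0 x)"
    have scaled: "v \<notin> S" if S: "subspace S" "v0 \<notin> S" for S
    proof
      assume "v \<in> S"
      then have "inverse t *s v \<in> S" by (rule subspace_scale[OF S(1)])
      then show False using S(2) t(1) by (simp add: v_def)
    qed
    have v: "v \<in> range P" "v \<notin> Z.C" "v \<notin> ?B" "z + v \<notin> ?B"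
      using range_scale[OF v0(1)] scaled[OF Z.subspace_C v0(2)] scaled[OF subspace_span v0(3)] t0[OF t(2)]
      by (simp_all add: v_def)
    have gf: "functional g" unfolding g_def by (rule functional_mult) (use g0(1) in \<open>simp add: ann_def\<close>)
    have gv: "g (M v) = 0" if "M \<in> V" for M
      using g0(1) that by (simp add: g_def v_def ann_def op_simps functional_simps)
    then have gann: "g \<in> ann v" using gf by (simp add: ann_def)
    have gind: "\<exists>x. g x \<noteq> c * f x" for c
    proof -
      obtain x where "g0 x \<noteq> (c * c0 / t) * f x" using g0(2) by blast
      then show ?thesis using t(1) c0(1) by (intro exI[of _ x]) (simp add: g_def field_simps)
    qed
    have gz: "g (M z) + f (M v) = 0" if M: "M \<in> V" for M
    proof -
      have "t / c0 * (g0 (M z) + c0 * f (M v0)) = 0" using c0(2)[OF M] by simp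
      then show ?thesis using c0(1) M by (simp add: g_def v_def op_simps Z.f_simps distrib_left)
    qed
    have v': "v \<noteq> 0" "\<not> bad v" using notB[OF v(3)] by auto
    have PP: "(\<exists>a b. \<forall>x. h x = a * f x + b * g x) \<and> (\<exists>a b. \<forall>x. k x = a * f x + b * g x)"
      if "functional h" "functional k" "\<And>M. M \<in> V \<Longrightarrow> h (M z) + k (M v) = 0" for h k
      using Z.pencil(2)[OF v(1,2) v'(2) gann gind that] .
    \<comment> \<open>One value w of \<Phi> at u has to fit both z and v. The pivots z, v and z + v
      yield candidates c, d and e, whose differences lie in the span of f and g by the second part
      of \<open>pencil\<close>. Changing c by multiples of f and d by multiples of g is harmless,
      since these kill \<open>V z\<close> and \<open>V v\<close>, and this freedom makes the
      candidates agree.\<close>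
    have total: "\<exists>w. functional w \<and> (\<forall>M\<in>V. w (M z) + f (M u) = 0) \<and> (\<forall>M\<in>V. w (M v) + g (M u) = 0)"
      if u: "u \<in> range P" for u
    proof -
      obtain c where c: "functional c" "\<And>M. M \<in> V \<Longrightarrow> c (M z) + f (M u) = 0" using Z.polar[OF u] by blast
      obtain d where d: "functional d" "\<And>M. M \<in> V \<Longrightarrow> d (M v) + g (M u) = 0"
        using polar'[OF v(1) v' gann u] by blast
      have zv: "z + v \<in> range P" by (rule range_add[OF z(1) v(1)])
      have "(\<lambda>x. 1 * f x + 1 * g x) \<in> ann (z + v)"
        unfolding ann_def
      proof (intro CollectI conjI ballI)
        fix M assume M: "M \<in> V"
        show "1 * f (M (z + v)) + 1 * g (M (z + v)) = 0"
          using gz[OF M] gv[OF M] Z.f_op_z[OF M] M gf by (simp add: op_simps functional_simps Z.f_simps add.commute)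
      qed (rule functional_lincomb[OF Z.f(1) gf])
      from polar'[OF zv notB[OF v(4)] this u]
      obtain e where e: "functional e" "\<And>M. M \<in> V \<Longrightarrow> e (M (z + v)) + (1 * f (M u) + 1 * g (M u)) = 0" by blast
      have "(1 * c (M z) + (- 1) * e (M z)) + (1 * d (M v) + (- 1) * e (M v)) = 0" if M: "M \<in> V" for M
      proof -
        have "(c (M z) + f (M u)) + (d (M v) + g (M u)) - (e (M (z + v)) + (1 * f (M u) + 1 * g (M u))) = 0"
          using c(2)[OF M] d(2)[OF M] e(2)[OF M] by simp
        then show ?thesis using M e(1) by (simp add: op_simps functional_simps algebra_simps)
      qed
      from PP[OF functional_lincomb[OF c(1) e(1), of 1 "- 1"] functional_lincomb[OF d(1) e(1), of 1 "- 1"] this]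
      obtain a1 b1 a2 b2 where r1: "\<And>x. 1 * c x + (- 1) * e x = a1 * f x + b1 * g x"
        and r2: "\<And>x. 1 * d x + (- 1) * e x = a2 * f x + b2 * g x" by blast
      define w where "w = (\<lambda>x. 1 * e x + 1 * (a2 * f x + b1 * g x))"
      have w1: "w x = c x + (a2 - a1) * f x" for x using r1[of x] by (simp add: w_def algebra_simps)
      have w2: "w x = d x + (b1 - b2) * g x" for x using r2[of x] by (simp add: w_def algebra_simps)
      have "functional w" unfolding w_def by (intro functional_lincomb e(1) Z.f(1) gf)
      moreover have "w (M z) + f (M u) = 0" if "M \<in> V" for M
        using c(2)[OF that] Z.f_op_z[OF that] by (simp add: w1)
      moreover have "w (M v) + g (M u) = 0" if "M \<in> V" for M
        using d(2)[OF that] gv[OF that] by (simp add: w2)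
      ultimately show ?thesis by blast
    qed
    show ?thesis
    proof (cases "\<forall>u\<in>range P. u \<notin> Z.C \<longrightarrow> u \<notin> ?B \<longrightarrow> (\<forall>k\<in>ann u. \<exists>a b. \<forall>x. k x = a * f x + b * g x)")
      case True
      \<comment> \<open>Rank two. This is the kernel of \<Phi>, described through the orbits; it
        turns out to be the common kernel of f and g.\<close>
      define Q0 where "Q0 = {x \<in> range P. \<forall>M\<in>V. f (M x) = 0 \<and> g (M x) = 0}"
      have subQ: "subspace Q0" unfolding Q0_def
        by (rule subspaceI) (auto simp: Z.f_simps functional_simps[OF gf] op_simps range_zero range_add range_scale)
      have dec: "\<exists>a b k. k \<in> Q0 \<and> u = a *s z + b *s v + k" if "u \<in> range P" for u
        using that
      proof (induction rule: Z.generic_induct)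
        case (generic u)
        obtain w where w: "functional w" "\<And>M. M \<in> V \<Longrightarrow> w (M z) + f (M u) = 0" "\<And>M. M \<in> V \<Longrightarrow> w (M v) + g (M u) = 0"
          using total[OF generic(1)] by blast
        obtain k where k: "k \<in> ann u" "k u = 1" by (rule exists_ann[OF generic(1) notB(1)[OF generic(3)]])
        have kf: "functional k" using k by (simp add: ann_def)
        have "\<exists>a b. \<forall>x. w x = a * f x + b * g x"
        proof (cases "\<exists>c. \<forall>x. k x = c * f x")
          case True
          then obtain c where c: "\<And>x. k x = c * f x" by blast
          have "c \<noteq> 0" using c[of u] k(2) by auto
          then have "f (M u) = 0" if "M \<in> V" for M using k(1) that by (simp add: ann_def c)
          then have "w (M z) = 0" if "M \<in> V" for M using w(2)[OF that] that by simp
          then obtain r where "\<And>x. w x = r * f x" using Z.ann_z[OF w(1)] by blast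
          then have "\<forall>x. w x = r * f x + 0 * g x" by simp
          then show ?thesis by blast
        next
          case False
          obtain p q where pq: "\<And>x. k x = p * f x + q * g x" using True generic k(1) by blast
          obtain c where c: "c \<noteq> 0" "\<And>M. M \<in> V \<Longrightarrow> k (M z) + c * f (M u) = 0"
            using Z.pencil(1)[OF generic(1,2) notB(2)[OF generic(3)] k(1)] False by blast
          have "c * w (M z) + (- 1) * k (M z) = 0" if M: "M \<in> V" for M
          proof -
            have "c * (w (M z) + f (M u)) - (k (M z) + c * f (M u)) = 0" using w(2)[OF M] c(2)[OF M] by simp
            then show ?thesis by (simp add: algebra_simps)
          qed
          then obtain e where e: "\<And>x. c * w x + (- 1) * k x = e * f x"
            using Z.ann_z[OF functional_lincomb[OF w(1) kf, of c "- 1"]] by blast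
          have "w x = (p + e) / c * f x + q / c * g x" for x
          proof -
            have "c * w x = (p + e) * f x + q * g x" using e[of x] pq[of x] by (simp add: algebra_simps)
            then have "w x = ((p + e) * f x + q * g x) / c" using c(1) by (simp add: field_simps)
            then show ?thesis by (simp add: add_divide_distrib distrib_right)
          qed
          then show ?thesis by blast
        qed
        then obtain a b where ab: "\<And>x. w x = a * f x + b * g x" by blast
        \<comment> \<open>As \<Phi>(u) = a f + b g is also the value at a z + b v, the difference of
          the two vectors lies in the kernel.\<close>
        define k where "k = u - (a *s z + b *s v)"
        have "k \<in> range P" unfolding k_def by (intro range_diff range_add range_scale z(1) v(1) generic(1))
        moreover have "f (M k) = 0 \<and> g (M k) = 0" if M: "M \<in> V" for M
        proof
          have fu: "f (M u) = - (b * g (M z))" using w(2)[OF M] Z.f_op_z[OF M]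
            by (simp add: ab eq_neg_iff_add_eq_0 add.commute)
          have gu: "g (M u) = - (a * f (M v))" using w(3)[OF M] gv[OF M]
            by (simp add: ab eq_neg_iff_add_eq_0 add.commute)
          have fv: "f (M v) = - g (M z)" using gz[OF M] by (simp add: eq_neg_iff_add_eq_0 add.commute)
          show "f (M k) = 0" using M fu fv Z.f_op_z[OF M] by (simp add: k_def op_simps Z.f_simps)
          show "g (M k) = 0" using M gu fv gv[OF M] by (simp add: k_def op_simps functional_simps[OF gf])
        qed
        ultimately have "k \<in> Q0" by (simp add: Q0_def)
        moreover have "u = a *s z + b *s v + k" by (simp add: k_def)
        ultimately show ?case by blast
      next
        case (lin s w t)
        then obtain a b k a' b' k' where k: "k \<in> Q0" "s = a *s z + b *s v + k" "k' \<in> Q0" "w = a' *s z + b' *s v + k'"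
          by blast
        have "s + t *s w = (a + t * a') *s z + (b + t * b') *s v + (k + t *s k')"
          unfolding k(2,4) by (simp add: scale_right_distrib scale_left_distrib algebra_simps)
        moreover have "k + t *s k' \<in> Q0" using k(1,3) subQ subspace_add subspace_scale by blast
        ultimately show ?case by blast
      qed
      have Qbad: "bad x" if x: "x \<in> Q0" "x \<noteq> 0" for x
      proof (rule ccontr)
        assume b: "\<not> bad x"
        have "x \<in> range P" "f \<in> ann x" "g \<in> ann x" using x(1) Z.f(1) gf by (auto simp: Q0_def ann_def)
        then obtain c where "\<And>y. g y = c * f y" using good_ann_line[OF _ x(2) b _ _ f0] by blast
        then show False using gind by blast
      qed
      have bfg: "f x = 0 \<and> g x = 0" if "bad x" for x
        using Z.f_bad[OF that] killed[OF v(1) v' gann that] by simp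
      have Qfg: "f x = 0 \<and> g x = 0" if "x \<in> Q0" for x
        using bfg[OF Qbad[OF that]] Z.f_simps(5) functional_0[OF gf] by (cases "x = 0") auto
      \<comment> \<open>A functional y annihilating the orbit of t = a z + b v enters the second
        part of \<open>pencil\<close> through the pair a y, b y. Both are then combinations of f and
        g and vanish at t, although \<open>y t = 1\<close>.\<close>
      have nondeg: "a = 0 \<and> b = 0" if ft: "f (a *s z + b *s v) = 0" and gt: "g (a *s z + b *s v) = 0" for a b
      proof (rule ccontr)
        assume ab: "\<not> (a = 0 \<and> b = 0)"
        let ?t = "a *s z + b *s v"
        have t: "?t \<in> range P" by (intro range_add range_scale z(1) v(1))
        have "?t \<noteq> 0"
        proof
          assume t0: "?t = 0"
          show False
          proof (cases "b = 0")
            case True then show False using t0 ab Z.z by simp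
          next
            case False
            have "b *s v = - (a *s z)" using t0 by (simp add: eq_neg_iff_add_eq_0 add.commute)
            then have "b *s v \<in> Z.C"
              using subspace_neg[OF Z.subspace_C subspace_scale[OF Z.subspace_C Z.z_in_C, of a]] by simp
            then have "inverse b *s b *s v \<in> Z.C" by (rule subspace_scale[OF Z.subspace_C])
            then show False using v(2) False by simp
          qed
        qed
        then obtain y where y: "y \<in> ann ?t" "y ?t = 1" using exists_ann[OF t] by blast
        have yf: "functional y" using y by (simp add: ann_def)
        have "a * y (M z) + b * y (M v) = 0" if "M \<in> V" for M
          using y(1) that yf by (auto simp: ann_def op_simps functional_simps)
        from PP[OF functional_mult[OF yf, of a] functional_mult[OF yf, of b] this]
        obtain p q p' q' where e1: "\<And>x. a * y x = p * f x + q * g x" and e2: "\<And>x. b * y x = p' * f x + q' * g x"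
          by blast
        have "a * y ?t = 0" "b * y ?t = 0" unfolding e1 e2 using ft gt by simp_all
        then show False using y(2) ab by simp
      qed
      have Qiff: "x \<in> Q0" if x: "x \<in> range P" "f x = 0" "g x = 0" for x
      proof -
        obtain a b k where k: "k \<in> Q0" "x = a *s z + b *s v + k" using dec[OF x(1)] by blast
        have "f (a *s z + b *s v) = 0" using x(2) Qfg[OF k(1)] unfolding k(2) by (simp add: Z.f_simps)
        moreover have "g (a *s z + b *s v) = 0" using x(3) Qfg[OF k(1)] unfolding k(2) by (simp add: functional_simps[OF gf])
        ultimately have "a = 0 \<and> b = 0" by (rule nondeg)
        then show ?thesis using k by simp
      qed
      have "radical Q0"
        unfolding radical_def
      proof (intro conjI ballI impI)
        show "subspace Q0" by (rule subQ)
        show "Q0 \<subseteq> range P" by (auto simp: Q0_def)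
        show "Q0 \<noteq> range P" using z(1) Z.f(2) Qfg[of z] by auto
        show "M x \<in> Q0" if "M \<in> V" "x \<in> Q0" for M x
          using that Qiff[of "M x"] op_in_range[of M x] by (simp add: Q0_def)
        show "(x \<in> Q0) = bad x" if x: "x \<in> range P" "x \<noteq> 0" for x
          using Qbad[OF _ x(2)] bfg[of x] Qiff[OF x(1)] by blast
        show "k x = 0" if w: "w \<in> range P - Q0" and k: "k \<in> ann w" and x: "x \<in> Q0" for w k x
        proof (cases "x = 0")
          case True then show ?thesis using k by (auto simp: ann_def functional_0)
        next
          case False
          have "w \<in> range P" "w \<noteq> 0" "\<not> bad w"
            using w subspace_0[OF subQ] bfg[of w] Qiff[of w] by auto
          then show ?thesis using killed k Qbad[OF x False] by blast
        qed
      qed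
      moreover have splits
      proof -
        \<comment> \<open>The determinant of the values of f and g at z and v. If it were zero, both
          functionals would vanish at \<open>f v *s z - v\<close>. The coefficients in
          \<open>rep\<close> express the coordinates along z and v by Cramer's rule.\<close>
        define D where "D = g v - f v * g z"
        have D: "D \<noteq> 0"
        proof
          assume "D = 0"
          then have "f (f v *s z + (- 1) *s v) = 0 \<and> g (f v *s z + (- 1) *s v) = 0"
            using Z.f by (simp add: D_def Z.f_simps functional_simps[OF gf])
          then show False using nondeg[of "f v" "- 1"] by simp
        qed
        have rep: "f (M x) = (- g z * f (M v) / D) * f x + (f (M v) / D) * g x
            \<and> g (M x) = (g v * g (M z) / D) * f x + (- f v * g (M z) / D) * g x" if M: "M \<in> V" for M x
        proof -
          obtain a b k where k: "k \<in> Q0" "P x = a *s z + b *s v + k" using dec[of "P x"] by blast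
          have Mk: "f (M k) = 0" "g (M k) = 0" using k(1) M by (auto simp: Q0_def)
          have Mx: "M x = a *s M z + b *s M v + M k" using op_P[OF M, of x] k(2) M by (simp add: op_simps)
          have fM: "f (M x) = b * f (M v)" unfolding Mx using Mk Z.f_op_z[OF M] by (simp add: Z.f_simps)
          have gM: "g (M x) = a * g (M z)" unfolding Mx using Mk gv[OF M] by (simp add: functional_simps[OF gf])
          have fx: "f x = a + b * f v"
            using functional_P[OF Z.f(1), of x] Qfg[OF k(1)] k(2) Z.f(2) by (simp add: Z.f_simps)
          have gx: "g x = a * g z + b * g v"
            using functional_P[OF gf, of x] Qfg[OF k(1)] k(2) by (simp add: functional_simps[OF gf])
          have eb: "b = (- g z * f x + g x) / D" using D by (simp add: fx gx field_simps) (simp add: D_def algebra_simps)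
          have ea: "a = (g v * f x - f v * g x) / D" using D by (simp add: fx gx field_simps) (simp add: D_def algebra_simps)
          have "f (M x) = (- g z * f (M v) / D) * f x + (f (M v) / D) * g x"
            unfolding fM by (subst eb) (simp add: diff_divide_distrib right_diff_distrib mult.commute mult.left_commute)
          moreover have "g (M x) = (g v * g (M z) / D) * f x + (- f v * g (M z) / D) * g x"
            unfolding gM by (subst ea) (simp add: diff_divide_distrib right_diff_distrib mult.commute mult.left_commute)
          ultimately show ?thesis by blast
        qed
        show ?thesis unfolding splits_def
        proof (rule disjI2, rule exI[of _ f], rule exI[of _ g], intro conjI allI ballI)
          fix M assume M: "M \<in> V"
          show "\<exists>a b. \<forall>x. f (M x) = a * f x + b * g x" using rep[OF M] by blast
          show "\<exists>a b. \<forall>x. g (M x) = a * f x + b * g x" using rep[OF M] by blast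
        qed (use Z.f(1) gf f0 gind in auto)
      qed
      ultimately show ?thesis by blast
    next
      case False
      then obtain u h0 where u: "u \<in> range P" "u \<notin> Z.C" "u \<notin> ?B" and h0: "h0 \<in> ann u"
        and nh: "\<not> (\<exists>a b. \<forall>x. h0 x = a * f x + b * g x)" by blast
      have "\<exists>x. h0 x \<noteq> c * f x" for c
      proof (rule ccontr)
        assume "\<not> ?thesis"
        then have "h0 x = c * f x + 0 * g x" for x by simp
        then show False using nh by blast
      qed
      then obtain c where c: "c \<noteq> 0" "\<And>M. M \<in> V \<Longrightarrow> h0 (M z) + c * f (M u) = 0"
        using Z.pencil(1)[OF u(1,2) notB(2)[OF u(3)] h0] by blast
      define h where "h = (\<lambda>x. inverse c * h0 x)"
      have hf: "functional h" unfolding h_def by (rule functional_mult) (use h0 in \<open>simp add: ann_def\<close>)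
      have hu: "h (M u) = 0" if "M \<in> V" for M using h0 that by (simp add: h_def ann_def)
      have hz: "h (M z) + f (M u) = 0" if M: "M \<in> V" for M
      proof -
        have "inverse c * (h0 (M z) + c * f (M u)) = 0" using c(2)[OF M] by simp
        then show ?thesis using c(1) by (simp add: h_def distrib_left mult.assoc[symmetric])
      qed
      obtain w where w: "functional w" "\<And>M. M \<in> V \<Longrightarrow> w (M z) + f (M u) = 0" "\<And>M. M \<in> V \<Longrightarrow> w (M v) + g (M u) = 0"
        using total[OF u(1)] by blast
      have "1 * w (M z) + (- 1) * h (M z) = 0" if M: "M \<in> V" for M
      proof -
        have "(w (M z) + f (M u)) - (h (M z) + f (M u)) = 0" using w(2)[OF M] hz[OF M] by simp
        then show ?thesis by simp
      qed
      \<comment> \<open>Both w and h satisfy the polar relation with z, so they differ by a multiple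
        of f. This multiple s is the defect that \<open>no_triple\<close> allows for.\<close>
      then obtain s where s: "\<And>x. 1 * w x + (- 1) * h x = s * f x"
        using Z.ann_z[OF functional_lincomb[OF w(1) hf, of 1 "- 1"]] by blast
      have ws: "w x = h x + s * f x" for x using s[of x] by (simp add: algebra_simps)
      have hv: "h (M v) + s * f (M v) + g (M u) = 0" if "M \<in> V" for M
        using w(3)[OF that] by (simp add: ws)
      have ind: "a = 0 \<and> b = 0 \<and> d = 0" if abd: "\<And>x. a * f x + b * g x + d * h x = 0" for a b d
      proof -
        have d: "d = 0"
        proof (rule ccontr)
          assume d: "d \<noteq> 0"
          have "h0 x = (- c * a / d) * f x + (- c * b / d) * g x" for x
          proof -
            have "d * (inverse c * h0 x) = - (a * f x + b * g x)"
              using abd[of x] unfolding h_def by (metis eq_neg_iff_add_eq_0 add.commute)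
            then have "(c / d) * (d * (inverse c * h0 x)) = (c / d) * - (a * f x + b * g x)" by simp
            moreover have "(c / d) * (d * (inverse c * h0 x)) = h0 x" using c(1) d by simp
            moreover have "(c / d) * - (a * f x + b * g x) = (- c * a / d) * f x + (- c * b / d) * g x"
              by (simp add: algebra_simps)
            ultimately show ?thesis by simp
          qed
          then show False using nh by blast
        qed
        have b: "b = 0"
        proof (rule ccontr)
          assume b: "b \<noteq> 0"
          have "g x = (- a / b) * f x" for x
            using abd[of x] d b by (simp add: field_simps eq_neg_iff_add_eq_0)
          then show False using gind by blast
        qed
        show ?thesis using abd[of z] d b Z.f(2) by simp
      qed
      have False
      proof (rule Z.no_triple[of v u g h s])
        show "g (M v) = 0" "h (M u) = 0" "g (M z) + f (M v) = 0" "h (M z) + f (M u) = 0"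
          "h (M v) + s * f (M v) + g (M u) = 0" if "M \<in> V" for M
          using that by (fact gv hu gz hz hv)+
        show "a = 0 \<and> b = 0 \<and> c = 0" if "\<And>x. a * f x + b * g x + c * h x = 0" for a b c
          using that by (rule ind)
      qed (fact v u gf hf)+
      then show ?thesis ..
    qed
  qed
qed

end

text \<open>The radical is what the induction consumes; \<open>splits\<close> is what the matrix
  argument needs. Both come out of the same case distinction on the rank.\<close>

theorem radical_exists:
  fixes scale :: "'a::{field,finite} \<Rightarrow> 'b::ab_group_add \<Rightarrow> 'b"
  assumes "CARD('a) \<ge> 3" "maximal_operator_space scale P V (Suc n)"
  shows "(\<exists>Q. operator_space.radical scale P V Q) \<and> maximal_operator_space.splits scale P V"
  using assms(2)
proof (induction n arbitrary: P V)
  case 0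
  then interpret maximal_operator_space scale P V "Suc 0" by simp
  have "card V = 1" using card_maximal by (simp add: numeral_2_eq_2)
  then have V0: "V = {\<lambda>x. 0}" using V_zero by (metis card_1_singletonE singletonD)
  have "card (range P) = CARD('a)" using card_range by simp
  then have "card (range P) \<noteq> 1" using card_field_ge_2[where 'a='a] by simp
  then have ne: "range P \<noteq> {0}" by auto
  have nb: "\<not> bad x" for x
  proof
    assume "bad x"
    then obtain l where "x \<noteq> 0" "l \<noteq> (\<lambda>_. 0)" "(\<lambda>y. scale (l y) x) \<in> V" unfolding bad_def by blast
    then have "scale (l y) x = 0" for y using V0 by (metis singletonD)
    then show False using \<open>x \<noteq> 0\<close> \<open>l \<noteq> (\<lambda>_. 0)\<close> by auto
  qed
  have op0: "M x = 0" if "M \<in> V" for M x using that V0 by simp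
  have "radical {0}"
    unfolding radical_def using ne range_zero nb op0 by (auto simp: ann_def functional_0)
  moreover have splits
  proof -
    obtain z where z: "z \<in> range P" "z \<noteq> 0" using ne range_zero by blast
    obtain f where f: "f \<in> ann z" "f z = 1" by (rule exists_ann[OF z])
    have "functional f" "f \<noteq> (\<lambda>_. 0)" using f by (auto simp: ann_def)
    moreover have "f (M x) = 0" if "M \<in> V" for M x using that V0 functional_0[OF \<open>functional f\<close>] by simp
    ultimately show ?thesis unfolding splits_def by blast
  qed
  ultimately show ?case by blast
next
  case (Suc n)
  interpret maximal_operator_space scale P V "Suc (Suc n)" by (fact Suc.prems)
  have "card (range P) > 1"
    unfolding card_range using card_field_ge_2[where 'a='a] by (intro one_less_power) auto
  then have ne: "range P \<noteq> {0}" by auto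
  show ?case
    by (rule radical_step[OF assms(1) ne]) (use Suc.IH in simp)
qed

section \<open>Matrix spaces\<close>

definition mat_closed :: "nat \<Rightarrow> 'a :: field mat set \<Rightarrow> bool" where
  "mat_closed n V \<longleftrightarrow> V \<subseteq> carrier_mat n n \<and> 0\<^sub>m n n \<in> V \<and> (\<forall>A\<in>V. \<forall>B\<in>V. A + B \<in> V)
    \<and> (\<forall>A\<in>V. \<forall>c. c \<cdot>\<^sub>m A \<in> V)"

lemma finite_carrier_mat: "finite (carrier_mat n m :: 'a :: finite mat set)"
proof (rule finite_surj)
  show "finite (({..<n} \<times> {..<m}) \<rightarrow>\<^sub>E (UNIV :: 'a set))" by (intro finite_PiE) auto
  show "carrier_mat n m \<subseteq> (\<lambda>g. mat n m g) ` (({..<n} \<times> {..<m}) \<rightarrow>\<^sub>E (UNIV :: 'a set))"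
  proof
    fix A :: "'a mat" assume A: "A \<in> carrier_mat n m"
    show "A \<in> (\<lambda>g. mat n m g) ` (({..<n} \<times> {..<m}) \<rightarrow>\<^sub>E (UNIV :: 'a set))"
      by (rule image_eqI[of _ _ "restrict (\<lambda>p. A $$ p) ({..<n} \<times> {..<m})"]) (use A in auto)
  qed
qed

lemma card_carrier_mat:
  "card (carrier_mat n m :: 'a :: finite mat set) = CARD('a) ^ (n * m)"
proof -
  have "bij_betw (\<lambda>g. mat n m g) (({..<n} \<times> {..<m}) \<rightarrow>\<^sub>E (UNIV :: 'a set)) (carrier_mat n m)"
  proof (rule bij_betwI[of _ _ _ "\<lambda>A. restrict (\<lambda>p. A $$ p) ({..<n} \<times> {..<m})"])
    show "restrict (\<lambda>p. mat n m g $$ p) ({..<n} \<times> {..<m}) = g"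
      if "g \<in> ({..<n} \<times> {..<m}) \<rightarrow>\<^sub>E (UNIV :: 'a set)" for g
      using that by (auto simp: fun_eq_iff restrict_def PiE_def extensional_def)
  qed auto
  then have "card (carrier_mat n m :: 'a mat set) = card (({..<n} \<times> {..<m}) \<rightarrow>\<^sub>E (UNIV :: 'a set))"
    by (metis bij_betw_same_card)
  then show ?thesis by (simp add: card_PiE)
qed

text \<open>Coordinates with respect to a basis turn the dimension into an exponent of the field
  size, the only form in which it is used from here on.\<close>

lemma maximal_trivial_spectrum_card:
  fixes V :: "'a :: {field,finite} mat set"
  assumes "maximal_trivial_spectrum n V"
  shows "mat_closed n V" "card V = CARD('a) ^ (n choose 2)"
proof -
  let ?W = "(mat_space n :: ('a, 'a mat) module)\<lparr>carrier := V\<rparr>"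
  interpret W: vectorspace class_ring "mat_space n :: ('a, 'a mat) module"
    by (rule vectorspace_mat_space)
  have sub: "VectorSpace.subspace class_ring V (mat_space n)" and dim: "vectorspace.dim class_ring ?W = n choose 2"
    using assms by (auto simp: maximal_trivial_spectrum_def mat_subspace_def mat_dim_def)
  interpret S: vectorspace class_ring ?W using W.subspace_is_vs[OF sub] by simp
  interpret sm: submodule class_ring V "mat_space n :: ('a, 'a mat) module"
    using sub by (simp add: VectorSpace.subspace_def)
  show "mat_closed n V"
    unfolding mat_closed_def using sm.subset sm.m_closed sm.smult_closed W.M.zero_closed
      S.M.zero_closed by (auto simp: module_mat_simps)
  have "V \<subseteq> carrier_mat n n" using sm.subset by (simp add: module_mat_simps)
  then have fin: "finite V" by (rule finite_subset) (rule finite_carrier_mat)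
  have "S.gen_set V"
    using S.in_own_span[of V] S.span_is_subset2[of V] by auto
  then have "S.fin_dim" unfolding S.fin_dim_def using fin by auto
  then obtain A where A: "finite A" "S.basis A" using S.finite_basis_exists by blast
  have AV: "A \<subseteq> V" using A(2) by (simp add: S.basis_def)
  have uni: "\<forall>v. v \<in> V \<longrightarrow> (\<exists>!a. a \<in> A \<rightarrow>\<^sub>E (UNIV :: 'a set) \<and> S.lincomb a A = v)"
    using S.basis_criterion[OF A(1)] A(2) AV by simp
  have bij: "bij_betw (\<lambda>a. S.lincomb a A) (A \<rightarrow>\<^sub>E (UNIV :: 'a set)) V"
  proof (rule bij_betw_imageI)
    have cl: "S.lincomb a A \<in> V" for a using S.lincomb_closed[of A a] AV by auto
    show "inj_on (\<lambda>a. S.lincomb a A) (A \<rightarrow>\<^sub>E UNIV)"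
      by (rule inj_onI) (metis uni cl)
    show "(\<lambda>a. S.lincomb a A) ` (A \<rightarrow>\<^sub>E UNIV) = V"
      using cl uni by blast
  qed
  have "card V = card (A \<rightarrow>\<^sub>E (UNIV :: 'a set))" using bij_betw_same_card[OF bij] by simp
  also have "\<dots> = CARD('a) ^ card A" using A(1) by (simp add: card_PiE)
  also have "card A = n choose 2" using S.dim_basis[OF A] dim by simp
  finally show "card V = CARD('a) ^ (n choose 2)" .
qed

lemma trivial_spectrum_iff:
  assumes "V \<subseteq> carrier_mat n n"
  shows "trivial_spectrum n V \<longleftrightarrow> (\<forall>M\<in>V. \<not> eigenvalue M 1)"
proof -
  have "eigenvalue M 1 \<longleftrightarrow> (\<exists>X\<in>carrier_vec n. X \<noteq> 0\<^sub>v n \<and> M *\<^sub>v X = X)" if "M \<in> V" for M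
    using that assms unfolding eigenvalue_def eigenvector_def by auto
  then show ?thesis unfolding trivial_spectrum_def by blast
qed

definition fun_scale :: "'a :: field \<Rightarrow> (nat \<Rightarrow> 'a) \<Rightarrow> nat \<Rightarrow> 'a" where
  "fun_scale c x = (\<lambda>i. c * x i)"

text \<open>The projection P of the operator space: vectors of length n are the functions vanishing
  from n on, so one type serves all dimensions.\<close>

definition cut :: "nat \<Rightarrow> (nat \<Rightarrow> 'a :: field) \<Rightarrow> nat \<Rightarrow> 'a" where
  "cut n x = (\<lambda>i. if i < n then x i else 0)"

text \<open>The action on row vectors, that is, of the transposed matrix.\<close>

definition row_op :: "nat \<Rightarrow> 'a :: field mat \<Rightarrow> (nat \<Rightarrow> 'a) \<Rightarrow> nat \<Rightarrow> 'a" where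
  "row_op n M x = (\<lambda>j. if j < n then \<Sum>i<n. M $$ (i, j) * x i else 0)"

definition unit_fun :: "nat \<Rightarrow> nat \<Rightarrow> 'a :: field" where
  "unit_fun i = (\<lambda>k. if k = i then 1 else 0)"

lemma card_range_cut: "card (range (cut n :: (nat \<Rightarrow> 'a :: {field,finite}) \<Rightarrow> _)) = CARD('a) ^ n"
  and finite_range_cut: "finite (range (cut n :: (nat \<Rightarrow> 'a :: {field,finite}) \<Rightarrow> _))"
proof -
  have bij: "bij_betw (cut n) ({..<n} \<rightarrow>\<^sub>E (UNIV :: 'a set)) (range (cut n))"
  proof (rule bij_betwI[of _ _ _ "\<lambda>x. restrict x {..<n}"])
    show "restrict (cut n x) {..<n} = x" if "x \<in> {..<n} \<rightarrow>\<^sub>E (UNIV :: 'a set)" for x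
      using that by (auto simp: cut_def fun_eq_iff restrict_def PiE_def extensional_def)
  qed (auto simp: cut_def fun_eq_iff)
  show "card (range (cut n :: (nat \<Rightarrow> 'a) \<Rightarrow> _)) = CARD('a) ^ n"
    using bij_betw_same_card[OF bij] by (simp add: card_PiE)
  show "finite (range (cut n :: (nat \<Rightarrow> 'a) \<Rightarrow> _))"
    using bij_betw_finite[OF bij] by (simp add: finite_PiE)
qed

lemma row_op_unit: "i < n \<Longrightarrow> row_op n M (unit_fun i) j = (if j < n then M $$ (i, j) else 0)"
  by (simp add: row_op_def unit_fun_def if_distrib[of "\<lambda>x. _ * x"] sum.delta cong: if_cong)

lemma row_op_inj: "inj_on (row_op n) (carrier_mat n n)"
proof (rule inj_onI)
  fix A B :: "'a mat" assume A: "A \<in> carrier_mat n n" and B: "B \<in> carrier_mat n n" and eq: "row_op n A = row_op n B"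
  show "A = B"
  proof (rule eq_matI)
    fix i j assume "i < dim_row B" "j < dim_col B"
    then show "A $$ (i, j) = B $$ (i, j)"
      using B row_op_unit[of i n A j] row_op_unit[of i n B j] by (simp add: eq)
  qed (use A B in auto)
qed

text \<open>A fixed row vector is an eigenvector of the transpose, which has the same characteristic
  polynomial.\<close>

lemma row_op_fixed:
  fixes M :: "'a :: field mat"
  assumes M: "M \<in> carrier_mat n n" and eq: "row_op n M x = x" and x: "x \<noteq> (\<lambda>_. 0)"
  shows "eigenvalue M 1"
proof -
  obtain j where j: "x j \<noteq> 0" using x by auto
  have jn: "j < n" using j eq by (metis row_op_def)
  have MT: "transpose_mat M \<in> carrier_mat n n" using M by simp
  have "transpose_mat M *\<^sub>v vec n x = 1 \<cdot>\<^sub>v vec n x"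
  proof (rule eq_vecI)
    fix k assume "k < dim_vec (1 \<cdot>\<^sub>v vec n x)"
    then have k: "k < n" by simp
    have "(transpose_mat M *\<^sub>v vec n x) $ k = (\<Sum>i<n. M $$ (i, k) * x i)"
      using M k by (simp add: scalar_prod_def atLeast0LessThan)
    also have "\<dots> = x k" using fun_cong[OF eq, of k] k by (simp add: row_op_def)
    finally show "(transpose_mat M *\<^sub>v vec n x) $ k = (1 \<cdot>\<^sub>v vec n x) $ k" using k by simp
  qed (use M in simp)
  moreover have "vec n x \<noteq> 0\<^sub>v n"
  proof
    assume "vec n x = 0\<^sub>v n"
    then have "vec n x $ j = 0\<^sub>v n $ j" by simp
    then show False using j jn by simp
  qed
  ultimately have "eigenvalue (transpose_mat M) 1"
    unfolding eigenvalue_def eigenvector_def using MT by (intro exI[of _ "vec n x"]) simp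
  then show ?thesis using eigenvalue_root_char_poly[OF MT] eigenvalue_root_char_poly[OF M] M by simp
qed

lemma operator_space_row_op:
  fixes V :: "'a :: {field,finite} mat set"
  assumes V: "mat_closed n V" and ts: "trivial_spectrum n V"
  shows "operator_space fun_scale (cut n) (row_op n ` V)"
proof -
  have sub: "V \<subseteq> carrier_mat n n" using V by (simp add: mat_closed_def)
  interpret vector_space "fun_scale :: 'a \<Rightarrow> _"
    by unfold_locales (auto simp: fun_scale_def fun_eq_iff algebra_simps)
  show ?thesis
  proof
    fix x y :: "nat \<Rightarrow> 'a" and c
    show "cut n (x + y) = cut n x + cut n y" by (auto simp: cut_def fun_eq_iff)
    show "cut n (fun_scale c x) = fun_scale c (cut n x)" by (auto simp: cut_def fun_scale_def fun_eq_iff)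
    show "cut n (cut n x) = cut n x" by (auto simp: cut_def)
    show "finite (range (cut n :: (nat \<Rightarrow> 'a) \<Rightarrow> _))" by (rule finite_range_cut)
    show "(\<lambda>x. 0) \<in> row_op n ` V"
      by (rule image_eqI[of _ _ "0\<^sub>m n n"]) (use V in \<open>auto simp: mat_closed_def row_op_def fun_eq_iff\<close>)
  next
    fix M N and c :: 'a assume "M \<in> row_op n ` V" "N \<in> row_op n ` V"
    then obtain A B where AB: "A \<in> V" "M = row_op n A" "B \<in> V" "N = row_op n B" by blast
    have car: "A \<in> carrier_mat n n" "B \<in> carrier_mat n n" using AB sub by auto
    show "(\<lambda>x. M x + N x) \<in> row_op n ` V"
    proof (rule image_eqI[of _ _ "A + B"])
      show "A + B \<in> V" using AB V by (simp add: mat_closed_def)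
      show "(\<lambda>x. M x + N x) = row_op n (A + B)"
        using car unfolding AB by (auto simp: row_op_def fun_eq_iff distrib_right sum.distrib)
    qed
  next
    fix M and c :: 'a and x y assume "M \<in> row_op n ` V"
    then obtain A where A: "A \<in> V" "M = row_op n A" by blast
    have car: "A \<in> carrier_mat n n" using A sub by auto
    show "M (x + y) = M x + M y"
      unfolding A by (auto simp: row_op_def fun_eq_iff distrib_left sum.distrib)
    show "M (fun_scale c x) = fun_scale c (M x)"
      unfolding A by (auto simp: row_op_def fun_scale_def fun_eq_iff sum_distrib_left intro!: sum.cong)
    show "cut n (M x) = M x" unfolding A by (auto simp: row_op_def cut_def)
    show "M (cut n x) = M x" unfolding A by (auto simp: row_op_def cut_def fun_eq_iff)
    show "(\<lambda>x. fun_scale c (M x)) \<in> row_op n ` V"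
    proof (rule image_eqI[of _ _ "c \<cdot>\<^sub>m A"])
      show "c \<cdot>\<^sub>m A \<in> V" using A V by (simp add: mat_closed_def)
      show "(\<lambda>x. fun_scale c (M x)) = row_op n (c \<cdot>\<^sub>m A)"
        using car unfolding A by (auto simp: row_op_def fun_scale_def fun_eq_iff sum_distrib_left mult.assoc)
    qed
    assume "M x = x"
    then show "x = 0"
      using row_op_fixed[OF car, of x] ts trivial_spectrum_iff[OF sub] A by (auto simp: zero_fun_def)
  qed
qed

lemma card_trivial_spectrum_le:
  fixes V :: "'a :: {field,finite} mat set"
  assumes V: "mat_closed n V" and ts: "trivial_spectrum n V"
  shows "card V \<le> CARD('a) ^ (n choose 2)"
proof -
  have "card (row_op n ` V) = card V"
    using card_image inj_on_subset[OF row_op_inj] V by (auto simp: mat_closed_def)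
  then show ?thesis
    using card_ops_le[OF operator_space_row_op[OF assms] card_range_cut] by simp
qed

text \<open>The core result is applied to the transposes, so that functionals become column vectors.\<close>

lemma common_invariant_vectors:
  fixes V :: "'a :: {field,finite} mat set"
  assumes q3: "CARD('a) \<ge> 3" and V: "mat_closed n V" and ts: "trivial_spectrum n V"
    and card: "card V = CARD('a) ^ (n choose 2)" and n: "n > 0"
  shows "(\<exists>v\<in>carrier_vec n. v \<noteq> 0\<^sub>v n \<and> (\<forall>M\<in>V. M *\<^sub>v v = 0\<^sub>v n)) \<or>
    (\<exists>v\<in>carrier_vec n. \<exists>w\<in>carrier_vec n. v \<noteq> 0\<^sub>v n \<and> (\<forall>c. w \<noteq> c \<cdot>\<^sub>v v) \<and>
      (\<forall>M\<in>V. (\<exists>a b. M *\<^sub>v v = a \<cdot>\<^sub>v v + b \<cdot>\<^sub>v w) \<and> (\<exists>a b. M *\<^sub>v w = a \<cdot>\<^sub>v v + b \<cdot>\<^sub>v w)))"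
proof -
  have sub: "V \<subseteq> carrier_mat n n" using V by (simp add: mat_closed_def)
  interpret operator_space fun_scale "cut n" "row_op n ` V" by (rule operator_space_row_op[OF V ts])
  have cardV: "card (row_op n ` V) = card V"
    using card_image inj_on_subset[OF row_op_inj sub] by blast
  interpret maximal_operator_space fun_scale "cut n" "row_op n ` V" n
    by unfold_locales (use card cardV card_range_cut in auto)
  obtain m where m: "n = Suc m" using n by (cases n) auto
  have spl: splits using radical_exists[OF q3, of fun_scale "cut n" "row_op n ` V" m] maximal_operator_space_axioms m by auto
  \<comment> \<open>The column vector that represents the functional f. Since operators act on rows,
    composing f with M becomes multiplying this column by M.\<close>
  define vc where "vc f = vec n (\<lambda>i. f (unit_fun i :: nat \<Rightarrow> 'a))" for f :: "(nat \<Rightarrow> 'a) \<Rightarrow> 'a"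
  have key: "f x = (\<Sum>i<n. x i * f (unit_fun i))" if f: "functional f" for f x
  proof -
    have cx: "cut n x = (\<Sum>i<n. fun_scale (x i) (unit_fun i))"
    proof
      fix k
      have "(\<Sum>i<n. fun_scale (x i) (unit_fun i)) k = (\<Sum>i<n. fun_scale (x i) (unit_fun i) k)"
        by (induction n) auto
      also have "\<dots> = (\<Sum>i<n. if i = k then x k else 0)"
        by (intro sum.cong) (auto simp: fun_scale_def unit_fun_def)
      finally show "cut n x k = (\<Sum>i<n. fun_scale (x i) (unit_fun i)) k"
        by (simp add: cut_def)
    qed
    have "f x = f (cut n x)" using functional_P[OF f] by simp
    also have "\<dots> = (\<Sum>i<n. f (fun_scale (x i) (unit_fun i)))" unfolding cx by (rule functional_sum[OF f])
    finally show ?thesis by (simp add: functional_scale[OF f])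
  qed
  have mult: "(M *\<^sub>v vc f) $ i = f (row_op n M (unit_fun i))" if "functional f" "M \<in> V" "i < n" for f M i
  proof -
    have Mc: "M \<in> carrier_mat n n" using that(2) sub by blast
    have "(M *\<^sub>v vc f) $ i = (\<Sum>j<n. M $$ (i, j) * f (unit_fun j))"
      using Mc that(3) by (simp add: scalar_prod_def vc_def atLeast0LessThan)
    also have "\<dots> = (\<Sum>j<n. row_op n M (unit_fun i) j * f (unit_fun j))"
      by (intro sum.cong) (use that(3) in \<open>auto simp: row_op_unit\<close>)
    also have "\<dots> = f (row_op n M (unit_fun i))" by (rule key[OF that(1), symmetric])
    finally show ?thesis .
  qed
  have nonz: "vc f \<noteq> 0\<^sub>v n" if f: "functional f" "f \<noteq> (\<lambda>_. 0)" for f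
  proof
    assume v0: "vc f = 0\<^sub>v n"
    have "f (unit_fun i) = 0" if "i < n" for i
      using arg_cong[OF v0, of "\<lambda>v. v $ i"] that by (simp add: vc_def)
    then have "f x = 0" for x using key[OF f(1), of x] by simp
    then show False using f(2) by auto
  qed
  have car: "vc f \<in> carrier_vec n" for f by (simp add: vc_def)
  show ?thesis
    using spl unfolding splits_def
  proof (elim disjE exE conjE)
    fix f assume f: "functional f" "f \<noteq> (\<lambda>_. 0)" "\<forall>M\<in>row_op n ` V. \<forall>x. f (M x) = 0"
    have "M *\<^sub>v vc f = 0\<^sub>v n" if M: "M \<in> V" for M
    proof (rule eq_vecI)
      show "(M *\<^sub>v vc f) $ i = 0\<^sub>v n $ i" if "i < dim_vec (0\<^sub>v n)" for i
        using that f(3) M mult[OF f(1) M, of i] by simp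
    qed (use M sub in auto)
    then show ?thesis using nonz[OF f(1,2)] car by blast
  next
    fix f g assume f: "functional f" "f \<noteq> (\<lambda>_. 0)" and g: "functional g" "\<forall>c. \<exists>x. g x \<noteq> c * f x"
      and inv: "\<forall>M\<in>row_op n ` V. (\<exists>a b. \<forall>x. f (M x) = a * f x + b * g x) \<and> (\<exists>a b. \<forall>x. g (M x) = a * f x + b * g x)"
    have lin: "M *\<^sub>v vc h = a \<cdot>\<^sub>v vc f + b \<cdot>\<^sub>v vc g"
      if h: "functional h" and M: "M \<in> V" and eq: "\<And>x. h (row_op n M x) = a * f x + b * g x" for h M a b
    proof (rule eq_vecI)
      show "(M *\<^sub>v vc h) $ i = (a \<cdot>\<^sub>v vc f + b \<cdot>\<^sub>v vc g) $ i" if "i < dim_vec (a \<cdot>\<^sub>v vc f + b \<cdot>\<^sub>v vc g)" for i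
        using that mult[OF h M, of i] by (simp add: eq) (simp add: vc_def)
    qed (use M sub in \<open>auto simp: vc_def\<close>)
    have "vc g \<noteq> c \<cdot>\<^sub>v vc f" for c
    proof
      assume eq: "vc g = c \<cdot>\<^sub>v vc f"
      have "g (unit_fun i) = c * f (unit_fun i)" if "i < n" for i
        using arg_cong[OF eq, of "\<lambda>v. v $ i"] that by (simp add: vc_def)
      then have "g x = c * f x" for x
        unfolding key[OF g(1), of x] key[OF f(1), of x] by (simp add: sum_distrib_left mult.left_commute)
      then show False using g(2) by blast
    qed
    moreover have "(\<exists>a b. M *\<^sub>v vc f = a \<cdot>\<^sub>v vc f + b \<cdot>\<^sub>v vc g) \<and> (\<exists>a b. M *\<^sub>v vc g = a \<cdot>\<^sub>v vc f + b \<cdot>\<^sub>v vc g)"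
      if M: "M \<in> V" for M
    proof -
      obtain a b a' b' where "\<And>x. f (row_op n M x) = a * f x + b * g x" "\<And>x. g (row_op n M x) = a' * f x + b' * g x"
        using inv M by blast
      then show ?thesis using lin[OF f(1) M] lin[OF g(1) M] by blast
    qed
    ultimately show ?thesis using nonz[OF f] car by blast
  qed
qed

section \<open>Changes of basis and block triangular matrices\<close>

lemma det_nonzero_inverse:
  fixes R :: "'a :: field mat"
  assumes "R \<in> carrier_mat n n" "det R \<noteq> 0"
  obtains R' where "R' \<in> carrier_mat n n" "R * R' = 1\<^sub>m n" "R' * R = 1\<^sub>m n"
  using det_non_zero_imp_unit[OF assms, of "()"] unfolding Units_def ring_mat_def by auto

lemma mult_unit_vec:
  fixes A :: "'a :: field mat"
  assumes "A \<in> carrier_mat nr nc" "j < nc"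
  shows "A *\<^sub>v unit_vec nc j = col A j"
  by (rule eq_vecI) (use assms in auto)

lemma nonzero_vec_index:
  assumes "v \<in> carrier_vec n" "v \<noteq> 0\<^sub>v n"
  obtains i where "i < n" "v $ i \<noteq> 0"
proof -
  have "\<exists>i<n. v $ i \<noteq> 0"
  proof (rule ccontr)
    assume "\<not> ?thesis"
    then have "v = 0\<^sub>v n" by (intro eq_vecI) (use assms(1) in auto)
    then show False using assms(2) by simp
  qed
  then show ?thesis using that by blast
qed

text \<open>An exchange step on the identity matrix: column j becomes v, and column i becomes the
  unit vector j thereby displaced. Because j \<le> i, the columns before j are untouched, so that
  two such steps can be composed.\<close>

lemma invertible_with_column:
  fixes v :: "'a :: field vec"
  assumes v: "v \<in> carrier_vec n" and ij: "j \<le> i" "i < n" and vi: "v $ i \<noteq> 0"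
  obtains R R' where "R \<in> carrier_mat n n" "R' \<in> carrier_mat n n" "R * R' = 1\<^sub>m n" "R' * R = 1\<^sub>m n"
    "R *\<^sub>v unit_vec n j = v" "\<And>l. l < j \<Longrightarrow> R *\<^sub>v unit_vec n l = unit_vec n l"
proof -
  define R where "R = mat n n (\<lambda>(r, c). if c = j then v $ r else if c = i then (if r = j then 1 else 0)
    else (if r = c then 1 else 0))"
  have Rc: "R \<in> carrier_mat n n" by (simp add: R_def)
  have jn: "j < n" using ij by simp
  have row: "(R *\<^sub>v x) $ r = (\<Sum>c<n. R $$ (r, c) * x $ c)" if "x \<in> carrier_vec n" "r < n" for x r
    using that Rc by (simp add: scalar_prod_def atLeast0LessThan)
  have "det R \<noteq> 0"
  proof
    assume "det R = 0"
    then obtain x where x: "x \<in> carrier_vec n" "x \<noteq> 0\<^sub>v n" "R *\<^sub>v x = 0\<^sub>v n"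
      using det_0_iff_vec_prod_zero_field[OF Rc] by blast
    have zero: "(\<Sum>c<n. R $$ (r, c) * x $ c) = 0" if "r < n" for r
      using row[OF x(1) that] x(3) that by simp
    have "(\<Sum>c<n. R $$ (i, c) * x $ c) = (\<Sum>c<n. if c = j then v $ i * x $ j else 0)"
      by (intro sum.cong) (use ij in \<open>auto simp: R_def\<close>)
    then have xj: "x $ j = 0" using zero[OF ij(2)] jn vi by simp
    have xr: "x $ r = 0" if r: "r < n" for r
    proof (cases "r = j \<or> r = i")
      case False
      have "(\<Sum>c<n. R $$ (r, c) * x $ c) = (\<Sum>c<n. if c = r then x $ r else 0)"
        by (intro sum.cong) (use r False xj in \<open>auto simp: R_def\<close>)
      then show ?thesis using zero[OF r] r by simp
    next
      case True
      show ?thesis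
      proof (cases "i = j")
        case True
        then show ?thesis using \<open>r = j \<or> r = i\<close> xj by auto
      next
        case ne: False
        have "(\<Sum>c<n. R $$ (j, c) * x $ c) = (\<Sum>c<n. if c = i then x $ i else 0)"
          by (intro sum.cong) (use jn ne xj in \<open>auto simp: R_def\<close>)
        then have "x $ i = 0" using zero[OF jn] ij by simp
        then show ?thesis using True xj by auto
      qed
    qed
    have "x = 0\<^sub>v n" by (rule eq_vecI) (use x(1) xr in auto)
    then show False using x(2) by simp
  qed
  then obtain R' where R': "R' \<in> carrier_mat n n" "R * R' = 1\<^sub>m n" "R' * R = 1\<^sub>m n"
    by (rule det_nonzero_inverse[OF Rc])
  show ?thesis
  proof (rule that[OF Rc R'])
    show "R *\<^sub>v unit_vec n j = v"
      unfolding mult_unit_vec[OF Rc jn] by (rule eq_vecI) (use v jn in \<open>auto simp: R_def\<close>)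
    show "R *\<^sub>v unit_vec n l = unit_vec n l" if "l < j" for l
    proof -
      have l: "l < n" using that jn by simp
      show ?thesis unfolding mult_unit_vec[OF Rc l]
        by (rule eq_vecI) (use that l ij in \<open>auto simp: R_def unit_vec_def\<close>)
    qed
  qed
qed

definition upper_left :: "nat \<Rightarrow> 'a mat \<Rightarrow> 'a mat" where
  "upper_left k N = mat k k (\<lambda>(i, j). N $$ (i, j))"

definition upper_right :: "nat \<Rightarrow> nat \<Rightarrow> 'a mat \<Rightarrow> 'a mat" where
  "upper_right k m N = mat k m (\<lambda>(i, j). N $$ (i, j + k))"

definition lower_right :: "nat \<Rightarrow> nat \<Rightarrow> 'a mat \<Rightarrow> 'a mat" where
  "lower_right k m N = mat m m (\<lambda>(i, j). N $$ (i + k, j + k))"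

lemma block_carriers:
  "upper_left k N \<in> carrier_mat k k" "upper_right k m N \<in> carrier_mat k m" "lower_right k m N \<in> carrier_mat m m"
  by (auto simp: upper_left_def upper_right_def lower_right_def)

lemma block_form:
  fixes N :: "'a :: field mat"
  assumes N: "N \<in> carrier_mat (k + m) (k + m)" and zero: "\<And>i j. i < m \<Longrightarrow> j < k \<Longrightarrow> N $$ (i + k, j) = 0"
  shows "N = four_block_mat (upper_left k N) (upper_right k m N) (0\<^sub>m m k) (lower_right k m N)"
proof (rule eq_matI)
  fix i j
  assume "i < dim_row (four_block_mat (upper_left k N) (upper_right k m N) (0\<^sub>m m k) (lower_right k m N))"
    "j < dim_col (four_block_mat (upper_left k N) (upper_right k m N) (0\<^sub>m m k) (lower_right k m N))"
  then have ij: "i < k + m" "j < k + m" by (simp_all add: upper_left_def lower_right_def)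
  have "N $$ (i, j) = 0" if "\<not> i < k" "j < k"
    using zero[of "i - k" j] that ij by simp
  then show "N $$ (i, j) = four_block_mat (upper_left k N) (upper_right k m N) (0\<^sub>m m k) (lower_right k m N) $$ (i, j)"
    using ij by (simp add: upper_left_def upper_right_def lower_right_def)
qed (use N in \<open>simp_all add: upper_left_def lower_right_def\<close>)

lemma four_block_inject:
  assumes "A \<in> carrier_mat k k" "B \<in> carrier_mat k m" "D \<in> carrier_mat m k" "C \<in> carrier_mat m m"
    and "A' \<in> carrier_mat k k" "B' \<in> carrier_mat k m" "D' \<in> carrier_mat m k" "C' \<in> carrier_mat m m"
    and eq: "four_block_mat A B D C = four_block_mat A' B' D' C'"
  shows "A = A'" "C = C'"
proof -
  have e: "four_block_mat A B D C $$ (i, j) = four_block_mat A' B' D' C' $$ (i, j)" for i j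
    using eq by simp
  show "A = A'"
  proof (rule eq_matI)
    fix i j assume "i < dim_row A'" "j < dim_col A'"
    then show "A $$ (i, j) = A' $$ (i, j)" using assms(1-8) e[of i j] by simp
  qed (use assms in auto)
  show "C = C'"
  proof (rule eq_matI)
    fix i j assume "i < dim_row C'" "j < dim_col C'"
    then show "C $$ (i, j) = C' $$ (i, j)" using assms(1-8) e[of "i + k" "j + k"] by simp
  qed (use assms in auto)
qed

lemma eigenvalue_four_block:
  fixes A :: "'a :: field mat"
  assumes A: "A \<in> carrier_mat k k" and B: "B \<in> carrier_mat k m" and C: "C \<in> carrier_mat m m"
  shows "eigenvalue (four_block_mat A B (0\<^sub>m m k) C) e \<longleftrightarrow> eigenvalue A e \<or> eigenvalue C e"
proof -
  let ?N = "four_block_mat A B (0\<^sub>m m k) C"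
  have "char_matrix ?N e = four_block_mat (char_matrix A e) B (0\<^sub>m m k) (char_matrix C e)"
    by (rule eq_matI) (use A B C in \<open>auto simp: char_matrix_def\<close>)
  then have "det (char_matrix ?N e) = det (char_matrix A e) * det (char_matrix C e)"
    using det_four_block_mat_lower_left_zero[of "char_matrix A e" k B m "0\<^sub>m m k" "char_matrix C e"] A B C by simp
  then show ?thesis
    using eigenvalue_det[OF A] eigenvalue_det[OF C] eigenvalue_det[OF four_block_carrier_mat[OF A C], of B "0\<^sub>m m k" e]
    by simp
qed

lemma choose_two_add: "(k + m) choose 2 = (k choose 2) + k * m + (m choose 2)"
  by (induction k) (simp_all add: choose_two_Suc numeral_2_eq_2[symmetric])

lemma mult_le_tight:
  fixes a b A B X :: nat
  assumes "a \<le> A" "b \<le> B" "A * X * B \<le> a * X * b" "0 < A * X * B"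
  shows "a = A" "b = B"
proof -
  have pos: "0 < A" "0 < X" "0 < B" using assms(4) by auto
  have "A * X * B \<le> a * X * B" using assms(2,3) by (meson le_trans mult_le_mono2)
  then show "a = A" using pos assms(1) by simp
  then show "b = B" using pos assms(2,3) by simp
qed

lemma mat_closed_image:
  fixes V :: "'a :: field mat set"
  assumes V: "mat_closed n V" and car: "\<And>A. A \<in> V \<Longrightarrow> h A \<in> carrier_mat k k"
    and zero: "h (0\<^sub>m n n) = 0\<^sub>m k k"
    and add: "\<And>A B. A \<in> carrier_mat n n \<Longrightarrow> B \<in> carrier_mat n n \<Longrightarrow> h (A + B) = h A + h B"
    and smult: "\<And>A c. A \<in> carrier_mat n n \<Longrightarrow> h (c \<cdot>\<^sub>m A) = c \<cdot>\<^sub>m h A"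
  shows "mat_closed k (h ` V)"
proof -
  have VA: "A \<in> carrier_mat n n" if "A \<in> V" for A using V that by (auto simp: mat_closed_def)
  show ?thesis unfolding mat_closed_def
  proof (intro conjI ballI allI)
    show "h ` V \<subseteq> carrier_mat k k" using car by blast
    show "0\<^sub>m k k \<in> h ` V" using V zero unfolding mat_closed_def by (metis image_eqI)
    show "X + Y \<in> h ` V" if XY: "X \<in> h ` V" "Y \<in> h ` V" for X Y
    proof -
      obtain A B where AB: "A \<in> V" "B \<in> V" "X = h A" "Y = h B" using XY by blast
      then have "A + B \<in> V" using V by (simp add: mat_closed_def)
      moreover have "X + Y = h (A + B)" using AB add[OF VA VA] by simp
      ultimately show ?thesis by blast
    qed
    show "c \<cdot>\<^sub>m X \<in> h ` V" if X: "X \<in> h ` V" for X c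
    proof -
      obtain A where A: "A \<in> V" "X = h A" using X by blast
      then have "c \<cdot>\<^sub>m A \<in> V" using V by (simp add: mat_closed_def)
      moreover have "c \<cdot>\<^sub>m X = h (c \<cdot>\<^sub>m A)" using A smult[OF VA] by simp
      ultimately show ?thesis by blast
    qed
  qed
qed

lemma mat_join_sizes:
  assumes "V \<subseteq> carrier_mat k k" "W \<subseteq> carrier_mat m m"
  shows "mat_join V W = {four_block_mat A B (0\<^sub>m m k) C | A B C. A \<in> V \<and> B \<in> carrier_mat k m \<and> C \<in> W}"
proof -
  have "dim_row A = k" "dim_col A = k" if "A \<in> V" for A using assms that by auto
  moreover have "dim_row C = m" "dim_col C = m" if "C \<in> W" for C using assms that by auto
  ultimately show ?thesis unfolding mat_join_def
    by (intro equalityI subsetI) (auto, metis+)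
qed

text \<open>Both diagonal parts have trivial spectrum and obey the cardinality bound. The exponents
  of the two bounds and k m for the corner add up to that of V, so all inclusions and estimates are
  equalities; in particular the corner is arbitrary and the diagonal parts are independent.\<close>

lemma maximal_block_triangular:
  fixes V :: "'a :: {field,finite} mat set"
  assumes V: "mat_closed (k + m) V" and ts: "trivial_spectrum (k + m) V"
    and card: "card V = CARD('a) ^ ((k + m) choose 2)"
    and zero: "\<And>N i j. N \<in> V \<Longrightarrow> i < m \<Longrightarrow> j < k \<Longrightarrow> N $$ (i + k, j) = 0"
  shows "V = mat_join (upper_left k ` V) (lower_right k m ` V)"
    and "mat_closed k (upper_left k ` V)" "trivial_spectrum k (upper_left k ` V)"
      "card (upper_left k ` V) = CARD('a) ^ (k choose 2)"
    and "mat_closed m (lower_right k m ` V)" "trivial_spectrum m (lower_right k m ` V)"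
      "card (lower_right k m ` V) = CARD('a) ^ (m choose 2)"
proof -
  let ?q = "CARD('a)"
  let ?A = "upper_left k ` V" and ?C = "lower_right k m ` V"
  have VA: "N \<in> carrier_mat (k + m) (k + m)" if "N \<in> V" for N using V that by (auto simp: mat_closed_def)
  have bf: "N = four_block_mat (upper_left k N) (upper_right k m N) (0\<^sub>m m k) (lower_right k m N)" if "N \<in> V" for N
    by (rule block_form[OF VA[OF that] zero[OF that]])
  have ne: "\<not> eigenvalue N 1" if "N \<in> V" for N
    using ts trivial_spectrum_iff[of V "k + m"] VA that by blast
  have ne2: "\<not> eigenvalue (upper_left k N) 1 \<and> \<not> eigenvalue (lower_right k m N) 1" if "N \<in> V" for N
    using eigenvalue_four_block[OF block_carriers(1)[of k N] block_carriers(2)[of k m N] block_carriers(3)[of k m N], of 1] ne[OF that] bf[OF that] by simp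
  show cA: "mat_closed k ?A"
    by (rule mat_closed_image[OF V]) (auto simp: upper_left_def)
  show cC: "mat_closed m ?C"
    by (rule mat_closed_image[OF V]) (auto simp: lower_right_def)
  show tA: "trivial_spectrum k ?A"
    using trivial_spectrum_iff[of ?A k] ne2 cA by (auto simp: mat_closed_def)
  show tC: "trivial_spectrum m ?C"
    using trivial_spectrum_iff[of ?C m] ne2 cC by (auto simp: mat_closed_def)
  define J where "J = (\<lambda>(A, B, C). four_block_mat A B (0\<^sub>m m k) C) ` (?A \<times> (carrier_mat k m :: 'a mat set) \<times> ?C)"
  have VJ: "V \<subseteq> J"
  proof
    fix N assume N: "N \<in> V"
    have "N = (\<lambda>(A, B, C). four_block_mat A B (0\<^sub>m m k) C) (upper_left k N, upper_right k m N, lower_right k m N)"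
      using bf[OF N] by simp
    then show "N \<in> J" unfolding J_def using N block_carriers by blast
  qed
  have finV: "finite V" by (rule finite_subset[OF _ finite_carrier_mat[of "k + m" "k + m"]]) (use VA in blast)
  have finJ: "finite J" unfolding J_def using finV finite_carrier_mat by (intro finite_imageI finite_cartesian_product) auto
  have "card J \<le> card (?A \<times> (carrier_mat k m :: 'a mat set) \<times> ?C)"
    unfolding J_def by (rule card_image_le) (use finV finite_carrier_mat in \<open>intro finite_cartesian_product, auto\<close>)
  also have "\<dots> = card ?A * ?q ^ (k * m) * card ?C" by (simp add: card_cartesian_product card_carrier_mat)
  finally have cJ: "card J \<le> card ?A * ?q ^ (k * m) * card ?C" .
  have cV: "card V = ?q ^ (k choose 2) * ?q ^ (k * m) * ?q ^ (m choose 2)"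
    by (simp add: card choose_two_add power_add)
  have VleJ: "card V \<le> card J" by (rule card_mono[OF finJ VJ])
  have leA: "card ?A \<le> ?q ^ (k choose 2)" by (rule card_trivial_spectrum_le[OF cA tA])
  have leC: "card ?C \<le> ?q ^ (m choose 2)" by (rule card_trivial_spectrum_le[OF cC tC])
  have le: "?q ^ (k choose 2) * ?q ^ (k * m) * ?q ^ (m choose 2) \<le> card ?A * ?q ^ (k * m) * card ?C"
    using order_trans[OF VleJ cJ] unfolding cV .
  have pos: "0 < ?q ^ (k choose 2) * ?q ^ (k * m) * ?q ^ (m choose 2)" by (simp add: card_gt_0_iff)
  show eA: "card ?A = ?q ^ (k choose 2)" by (rule mult_le_tight(1)[OF leA leC le pos])
  show eC: "card ?C = ?q ^ (m choose 2)" by (rule mult_le_tight(2)[OF leA leC le pos])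
  have "V = J" by (rule card_seteq[OF finJ VJ]) (use cJ cV eA eC in simp)
  also have "J = mat_join ?A ?C"
  proof -
    have "?A \<subseteq> carrier_mat k k" "?C \<subseteq> carrier_mat m m" using cA cC by (auto simp: mat_closed_def)
    note js = mat_join_sizes[OF this]
    have "N \<in> mat_join ?A ?C" if "N \<in> J" for N
      using that unfolding J_def js by (elim imageE) (simp add: mem_Times_iff split_beta, blast)
    moreover have "N \<in> J" if N: "N \<in> mat_join ?A ?C" for N
    proof -
      obtain A B C where "N = four_block_mat A B (0\<^sub>m m k) C" "A \<in> ?A" "B \<in> carrier_mat k m" "C \<in> ?C"
        using N unfolding js by blast
      then show ?thesis unfolding J_def by (intro image_eqI[of _ _ "(A, B, C)"]) simp_all
    qed
    ultimately show ?thesis by blast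
  qed
  finally show "V = mat_join ?A ?C" .
qed

lemma similar_mat_sets_trans:
  fixes V :: "'a :: field mat set"
  assumes V: "V \<subseteq> carrier_mat n n" and VW: "similar_mat_sets n V W" and WX: "similar_mat_sets n W X"
  shows "similar_mat_sets n V X"
proof -
  obtain R R' where R: "R \<in> carrier_mat n n" "R' \<in> carrier_mat n n" "R * R' = 1\<^sub>m n" "R' * R = 1\<^sub>m n" "W = (\<lambda>M. R * M * R') ` V"
    using VW unfolding similar_mat_sets_def by blast
  obtain S S' where S: "S \<in> carrier_mat n n" "S' \<in> carrier_mat n n" "S * S' = 1\<^sub>m n" "S' * S = 1\<^sub>m n" "X = (\<lambda>M. S * M * S') ` W"
    using WX unfolding similar_mat_sets_def by blast
  have "S * (R * M * R') * S' = (S * R) * M * (R' * S')" if "M \<in> V" for M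
  proof -
    have M: "M \<in> carrier_mat n n" using V that by blast
    then show ?thesis using R(1,2) S(1,2) by (simp add: assoc_mult_mat[of _ n n _ n _ n])
  qed
  then have "X = (\<lambda>M. (S * R) * M * (R' * S')) ` V" unfolding S(5) R(5) image_image by (intro image_cong) auto
  moreover have "(S * R) * (R' * S') = 1\<^sub>m n"
  proof -
    have "(S * R) * (R' * S') = S * ((R * R') * S')" using R(1,2) S(1,2) by (simp add: assoc_mult_mat[of _ n n _ n _ n])
    then show ?thesis using R S by simp
  qed
  moreover have "(R' * S') * (S * R) = 1\<^sub>m n"
  proof -
    have "(R' * S') * (S * R) = R' * ((S' * S) * R)" using R(1,2) S(1,2) by (simp add: assoc_mult_mat[of _ n n _ n _ n])
    then show ?thesis using R S by simp
  qed
  ultimately show ?thesis unfolding similar_mat_sets_def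
    using R S by (intro bexI[of _ "S * R"] bexI[of _ "R' * S'"]) auto
qed

lemma conj_cancel:
  fixes M :: "'a :: field mat"
  assumes "R \<in> carrier_mat n n" "R' \<in> carrier_mat n n" "R' * R = 1\<^sub>m n" "M \<in> carrier_mat n n"
  shows "R' * (R * M * R') * R = M"
proof -
  have "R' * (R * M * R') * R = (R' * R) * M * (R' * R)"
    using assms(1,2,4) by (simp add: assoc_mult_mat[of _ n n _ n _ n])
  then show ?thesis using assms by simp
qed

lemma similar_mat_sets_sym:
  fixes V :: "'a :: field mat set"
  assumes V: "V \<subseteq> carrier_mat n n" and VW: "similar_mat_sets n V W"
  shows "similar_mat_sets n W V"
proof -
  obtain R R' where R: "R \<in> carrier_mat n n" "R' \<in> carrier_mat n n" "R * R' = 1\<^sub>m n" "R' * R = 1\<^sub>m n" "W = (\<lambda>M. R * M * R') ` V"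
    using VW unfolding similar_mat_sets_def by blast
  have "(\<lambda>M. R' * M * R) ` W = (\<lambda>M. M) ` V"
    unfolding R(5) image_image by (rule image_cong) (use conj_cancel[OF R(1,2,4)] V in auto)
  then have "V = (\<lambda>M. R' * M * R) ` W" by simp
  then show ?thesis unfolding similar_mat_sets_def using R(1-4) by blast
qed

lemma similar_maximal:
  fixes V :: "'a :: field mat set"
  assumes V: "mat_closed n V" and ts: "trivial_spectrum n V"
    and R: "R \<in> carrier_mat n n" "R' \<in> carrier_mat n n" "R * R' = 1\<^sub>m n" "R' * R = 1\<^sub>m n"
  shows "mat_closed n ((\<lambda>M. R * M * R') ` V)" "trivial_spectrum n ((\<lambda>M. R * M * R') ` V)"
    "card ((\<lambda>M. R * M * R') ` V) = card V"
proof -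
  have VA: "M \<in> carrier_mat n n" if "M \<in> V" for M using V that by (auto simp: mat_closed_def)
  show cl: "mat_closed n ((\<lambda>M. R * M * R') ` V)"
  proof (rule mat_closed_image[OF V])
    show "R * M * R' \<in> carrier_mat n n" if "M \<in> V" for M using VA[OF that] R by auto
    show "R * 0\<^sub>m n n * R' = 0\<^sub>m n n" using R(1,2) by simp
    show "R * (A + B) * R' = R * A * R' + R * B * R'" if "A \<in> carrier_mat n n" "B \<in> carrier_mat n n" for A B
      using that R(1,2) by (simp add: mult_add_distrib_mat[of _ n n] add_mult_distrib_mat[of _ n n])
    show "R * (c \<cdot>\<^sub>m A) * R' = c \<cdot>\<^sub>m (R * A * R')" if "A \<in> carrier_mat n n" for A c
      using that R(1,2) by (simp add: mult_smult_distrib[of _ n n] mult_smult_assoc_mat[of _ n n])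
  qed
  have "\<not> eigenvalue (R * M * R') 1" if M: "M \<in> V" for M
  proof -
    have "similar_mat (R * M * R') M"
      unfolding similar_mat_def by (intro exI, rule similar_mat_witI[OF R(3,4) refl]) (use R VA[OF M] in auto)
    then have "char_poly (R * M * R') = char_poly M" by (rule char_poly_similar)
    moreover have "R * M * R' \<in> carrier_mat n n" using R VA[OF M] by auto
    moreover have "\<not> eigenvalue M 1" using ts trivial_spectrum_iff[of V n] VA M by blast
    ultimately show ?thesis using eigenvalue_root_char_poly VA[OF M] by metis
  qed
  then show "trivial_spectrum n ((\<lambda>M. R * M * R') ` V)"
    using trivial_spectrum_iff[of "(\<lambda>M. R * M * R') ` V" n] cl by (auto simp: mat_closed_def)
  show "card ((\<lambda>M. R * M * R') ` V) = card V"
    by (rule card_image, rule inj_on_inverseI[of _ "\<lambda>M. R' * M * R"]) (use conj_cancel[OF R(1,2,4)] VA in blast)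
qed

lemma mult_block_triangular:
  fixes A :: "'a :: field mat"
  assumes "A \<in> carrier_mat k k" "B \<in> carrier_mat k m" "C \<in> carrier_mat m m"
    "A' \<in> carrier_mat k k" "B' \<in> carrier_mat k m" "C' \<in> carrier_mat m m"
  shows "four_block_mat A B (0\<^sub>m m k) C * four_block_mat A' B' (0\<^sub>m m k) C'
    = four_block_mat (A * A') (A * B' + B * C') (0\<^sub>m m k) (C * C')"
  using mult_four_block_mat[of A k k B m "0\<^sub>m m k" m C A' k B' m "0\<^sub>m m k" C'] assms by simp

text \<open>Conjugation by the block diagonal matrix with blocks 1 and S sends the corner B to
  \<open>B * S'\<close>, which again runs through all matrices.\<close>

lemma mat_join_similar_right:
  fixes V W :: "'a :: field mat set"
  assumes V: "V \<subseteq> carrier_mat k k" and W: "W \<subseteq> carrier_mat m m" and sim: "similar_mat_sets m W W'"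
  shows "similar_mat_sets (k + m) (mat_join V W) (mat_join V W')"
proof -
  obtain S S' where S: "S \<in> carrier_mat m m" "S' \<in> carrier_mat m m" "S * S' = 1\<^sub>m m" "S' * S = 1\<^sub>m m" "W' = (\<lambda>M. S * M * S') ` W"
    using sim unfolding similar_mat_sets_def by blast
  define D where "D = four_block_mat (1\<^sub>m k) (0\<^sub>m k m) (0\<^sub>m m k) S"
  define D' where "D' = four_block_mat (1\<^sub>m k) (0\<^sub>m k m) (0\<^sub>m m k) S'"
  have carD: "D \<in> carrier_mat (k + m) (k + m)" "D' \<in> carrier_mat (k + m) (k + m)"
    unfolding D_def D'_def using S by auto
  have DD: "D * D' = 1\<^sub>m (k + m)" "D' * D = 1\<^sub>m (k + m)"
    unfolding D_def D'_def using S by (simp_all add: mult_block_triangular)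
  have W': "W' \<subseteq> carrier_mat m m" using S W by auto
  have conj: "D * four_block_mat A B (0\<^sub>m m k) C * D' = four_block_mat A (B * S') (0\<^sub>m m k) (S * C * S')"
    if "A \<in> carrier_mat k k" "B \<in> carrier_mat k m" "C \<in> carrier_mat m m" for A B C
    unfolding D_def D'_def using S(1,2) that by (simp add: mult_block_triangular)
  have "mat_join V W' = (\<lambda>N. D * N * D') ` mat_join V W"
  proof (intro equalityI subsetI)
    fix N assume "N \<in> mat_join V W'"
    then obtain A B C where N: "N = four_block_mat A B (0\<^sub>m m k) (S * C * S')" "A \<in> V" "B \<in> carrier_mat k m" "C \<in> W"
      unfolding mat_join_sizes[OF V W'] by (auto simp: S(5))
    have car: "A \<in> carrier_mat k k" "B * S \<in> carrier_mat k m" "C \<in> carrier_mat m m"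
      using N V W S(1) by auto
    have "B * S * S' = B" using N(3) S by (simp add: assoc_mult_mat[of B k m S m S' m])
    then have "N = D * four_block_mat A (B * S) (0\<^sub>m m k) C * D'"
      unfolding conj[OF car] using N(1) by simp
    moreover have "four_block_mat A (B * S) (0\<^sub>m m k) C \<in> mat_join V W"
      unfolding mat_join_sizes[OF V W] using N(2,4) car(2) by blast
    ultimately show "N \<in> (\<lambda>N. D * N * D') ` mat_join V W" by blast
  next
    fix N assume "N \<in> (\<lambda>N. D * N * D') ` mat_join V W"
    then obtain A B C where N: "N = D * four_block_mat A B (0\<^sub>m m k) C * D'" "A \<in> V" "B \<in> carrier_mat k m" "C \<in> W"
      unfolding mat_join_sizes[OF V W] by auto
    then have "N = four_block_mat A (B * S') (0\<^sub>m m k) (S * C * S')" using conj[of A B C] V W by auto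
    moreover have "S * C * S' \<in> W'" "B * S' \<in> carrier_mat k m" using N S by auto
    ultimately show "N \<in> mat_join V W'"
      unfolding mat_join_sizes[OF V W'] using N(2) by blast
  qed
  then show ?thesis unfolding similar_mat_sets_def using carD DD by blast
qed

section \<open>Existence of the decomposition\<close>

lemma mult_zero_vec: "A \<in> carrier_mat nr nc \<Longrightarrow> A *\<^sub>v 0\<^sub>v nc = (0\<^sub>v nr :: 'a :: field vec)"
  by (rule eq_vecI) auto

lemma mat_line_subset: "A \<in> carrier_mat k k \<Longrightarrow> mat_line A \<subseteq> carrier_mat k k"
  by (auto simp: mat_line_def)

lemma card_mat_line:
  fixes A :: "'a :: {field,finite} mat"
  assumes A: "A \<in> carrier_mat k k" "A \<noteq> 0\<^sub>m k k"
  shows "card (mat_line A) = CARD('a)"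
proof -
  have "\<exists>i<k. \<exists>j<k. A $$ (i, j) \<noteq> 0"
  proof (rule ccontr)
    assume "\<not> ?thesis"
    then have "A = 0\<^sub>m k k" by (intro eq_matI) (use A(1) in auto)
    then show False using A(2) by simp
  qed
  then obtain i j where ij: "i < k" "j < k" "A $$ (i, j) \<noteq> 0" by blast
  have "inj (\<lambda>c. c \<cdot>\<^sub>m A)"
  proof (rule injI)
    fix c d assume "c \<cdot>\<^sub>m A = d \<cdot>\<^sub>m A"
    then have "(c \<cdot>\<^sub>m A) $$ (i, j) = (d \<cdot>\<^sub>m A) $$ (i, j)" by simp
    then show "c = d" using ij A(1) by simp
  qed
  moreover have "mat_line A = range (\<lambda>c. c \<cdot>\<^sub>m A)" by (auto simp: mat_line_def)
  ultimately show ?thesis by (simp add: card_image)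
qed

lemma mat_joins_Cons: "mat_joins (W # Ws) = mat_join W (mat_joins Ws)"
  by (simp add: mat_joins_def)

text \<open>Splits off the invariant subspace spanned by the first k columns of R. The assumption
  \<open>block\<close> concerns only the diagonal part that arises from V, because in size two its
  proof has to go back to V.\<close>

lemma block_decomposition_step:
  fixes V :: "'a :: {field,finite} mat set"
  assumes V: "mat_closed (k + m) V" and ts: "trivial_spectrum (k + m) V"
    and card: "card V = CARD('a) ^ ((k + m) choose 2)"
    and R: "R \<in> carrier_mat (k + m) (k + m)" "R' \<in> carrier_mat (k + m) (k + m)" "R * R' = 1\<^sub>m (k + m)" "R' * R = 1\<^sub>m (k + m)"
    and zero: "\<And>M i j. M \<in> V \<Longrightarrow> i < m \<Longrightarrow> j < k \<Longrightarrow> (R' * M * R) $$ (i + k, j) = 0"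
    and IH: "\<And>W :: 'a mat set. mat_closed m W \<Longrightarrow> trivial_spectrum m W \<Longrightarrow>
      card W = CARD('a) ^ (m choose 2) \<Longrightarrow> \<exists>Ms. block_decomposition m W Ms"
    and block: "\<And>U :: 'a mat set. mat_closed k U \<Longrightarrow> trivial_spectrum k U \<Longrightarrow> card U = CARD('a) ^ (k choose 2) \<Longrightarrow>
      U = upper_left k ` (\<lambda>M. R' * M * R) ` V \<Longrightarrow>
      \<exists>M. basic_block M \<and> U = mat_line M"
  shows "\<exists>Ms. block_decomposition (k + m) V Ms"
proof -
  define V' where "V' = (\<lambda>M. R' * M * R) ` V"
  note sm = similar_maximal[OF V ts R(2,1,4,3), folded V'_def]
  have sub: "V \<subseteq> carrier_mat (k + m) (k + m)" using V by (simp add: mat_closed_def)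
  have simV: "similar_mat_sets (k + m) V V'" unfolding similar_mat_sets_def V'_def using R by blast
  have zero': "N $$ (i + k, j) = 0" if "N \<in> V'" "i < m" "j < k" for N i j
    using that zero unfolding V'_def by blast
  have card': "card V' = CARD('a) ^ ((k + m) choose 2)" using sm(3) card by simp
  note mb = maximal_block_triangular[OF sm(1,2) card' zero']
  obtain M where M: "basic_block M" "upper_left k ` V' = mat_line M"
    using block[OF mb(2,3,4)] unfolding V'_def by blast
  obtain Ms where Ms: "block_decomposition m (lower_right k m ` V') Ms" using IH[OF mb(5,6,7)] by blast
  have c1: "upper_left k ` V' \<subseteq> carrier_mat k k" and c2: "lower_right k m ` V' \<subseteq> carrier_mat m m"
    using mb(2,5) by (auto simp: mat_closed_def)
  have "similar_mat_sets (k + m) V' (mat_join (mat_line M) (mat_joins (map mat_line Ms)))"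
    using mat_join_similar_right[OF c1 c2] Ms mb(1) M(2) unfolding block_decomposition_def by metis
  then have "similar_mat_sets (k + m) V (mat_joins (map mat_line (M # Ms)))"
    using similar_mat_sets_trans[OF sub simV] by (simp add: mat_joins_Cons)
  then show ?thesis using M(1) Ms unfolding block_decomposition_def by (intro exI[of _ "M # Ms"]) auto
qed

theorem exists_block_decomposition:
  fixes V :: "'a :: {field,finite} mat set"
  assumes q3: "CARD('a) \<ge> 3"
  shows "mat_closed n V \<Longrightarrow> trivial_spectrum n V \<Longrightarrow> card V = CARD('a) ^ (n choose 2) \<Longrightarrow>
    \<exists>Ms. block_decomposition n V Ms"
proof (induction n arbitrary: V rule: less_induct)
  case (less n)
  note V = less.prems(1) and ts = less.prems(2) and card = less.prems(3)
  have VA: "M \<in> carrier_mat n n" if "M \<in> V" for M using V that by (auto simp: mat_closed_def)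
  show ?case
  proof (cases "n = 0")
    case True
    have "V = {0\<^sub>m 0 0}"
    proof -
      have "M = 0\<^sub>m 0 0" if "M \<in> V" for M by (rule eq_matI) (use VA[OF that] True in auto)
      moreover have "0\<^sub>m 0 0 \<in> V" using V True by (simp add: mat_closed_def)
      ultimately show ?thesis by blast
    qed
    moreover have "1\<^sub>m 0 * 0\<^sub>m 0 0 * 1\<^sub>m 0 = (0\<^sub>m 0 0 :: 'a mat)" by simp
    ultimately have "block_decomposition n V []"
      unfolding block_decomposition_def similar_mat_sets_def mat_joins_def True
      by (intro conjI bexI[of _ "1\<^sub>m 0"]) auto
    then show ?thesis by blast
  next
    case False
    then have n: "n > 0" by simp
    show ?thesis
    proof (cases "\<exists>v\<in>carrier_vec n. v \<noteq> 0\<^sub>v n \<and> (\<forall>M\<in>V. M *\<^sub>v v = 0\<^sub>v n)")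
      case True
      then obtain v where v: "v \<in> carrier_vec n" "v \<noteq> 0\<^sub>v n" "\<And>M. M \<in> V \<Longrightarrow> M *\<^sub>v v = 0\<^sub>v n" by blast
      obtain i where i: "i < n" "v $ i \<noteq> 0" by (rule nonzero_vec_index[OF v(1,2)])
      obtain R R' where R: "R \<in> carrier_mat n n" "R' \<in> carrier_mat n n" "R * R' = 1\<^sub>m n" "R' * R = 1\<^sub>m n"
        "R *\<^sub>v unit_vec n 0 = v"
        using invertible_with_column[OF v(1) _ i, of 0] by blast
      obtain m where m: "n = 1 + m" using n by (cases n) auto
      have col0: "(R' * M * R) $$ (r, 0) = 0" if M: "M \<in> V" and r: "r < n" for M r
      proof -
        have "(R' * M * R) *\<^sub>v unit_vec n 0 = R' *\<^sub>v (M *\<^sub>v (R *\<^sub>v unit_vec n 0))"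
          using R(1,2) VA[OF M] by (simp add: assoc_mult_mat_vec[of _ n n _ n])
        also have "\<dots> = 0\<^sub>v n" unfolding R(5) v(3)[OF M] by (rule mult_zero_vec[OF R(2)])
        finally have "col (R' * M * R) 0 = 0\<^sub>v n"
          using mult_unit_vec[of "R' * M * R" n n 0] R(1,2) VA[OF M] n by simp
        then have "col (R' * M * R) 0 $ r = 0" using r by simp
        then show ?thesis using r n R(1,2) VA[OF M] by simp
      qed
      show ?thesis unfolding m
      proof (rule block_decomposition_step[OF _ _ _ _ _ _ _ _ less.IH, where R = R and R' = R', folded m])
        show "(R' * M * R) $$ (i + 1, j) = 0" if "M \<in> V" "i < m" "j < 1" for M i j
          using col0[of M "i + 1"] that m by simp
        fix U :: "'a mat set"
        assume U: "mat_closed 1 U" "card U = CARD('a) ^ (1 choose 2)"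
        have z: "0\<^sub>m 1 1 \<in> U" using U(1) by (simp add: mat_closed_def)
        have "card U = 1" using U(2) by (simp add: numeral_2_eq_2)
        then have "U = {0\<^sub>m 1 1}" using z by (metis card_1_singletonE singletonD)
        moreover have "mat_line (0\<^sub>m 1 1 :: 'a mat) = {0\<^sub>m 1 1}" by (auto simp: mat_line_def)
        moreover have "basic_block (0\<^sub>m 1 1 :: 'a mat)" by (simp add: basic_block_def)
        ultimately show "\<exists>M. basic_block M \<and> U = mat_line M" by (intro exI[of _ "0\<^sub>m 1 1"]) simp
      qed (use V ts card R m in auto)
    next
      \<comment> \<open>That no nonzero vector is killed by all of V is used again below, to exclude
        the eigenvalue 0 of the block of size two.\<close>
      case nocommon: False
      then obtain v w where v: "v \<in> carrier_vec n" "v \<noteq> 0\<^sub>v n" and w: "w \<in> carrier_vec n" "\<And>c. w \<noteq> c \<cdot>\<^sub>v v"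
        and inv: "\<And>M. M \<in> V \<Longrightarrow> (\<exists>a b. M *\<^sub>v v = a \<cdot>\<^sub>v v + b \<cdot>\<^sub>v w) \<and> (\<exists>a b. M *\<^sub>v w = a \<cdot>\<^sub>v v + b \<cdot>\<^sub>v w)"
        using common_invariant_vectors[OF q3 V ts card n] by blast
      obtain i where i: "i < n" "v $ i \<noteq> 0" by (rule nonzero_vec_index[OF v(1,2)])
      obtain R1 R1' where R1: "R1 \<in> carrier_mat n n" "R1' \<in> carrier_mat n n" "R1 * R1' = 1\<^sub>m n" "R1' * R1 = 1\<^sub>m n"
        "R1 *\<^sub>v unit_vec n 0 = v"
        using invertible_with_column[OF v(1) _ i, of 0] by blast
      \<comment> \<open>The coordinates of w once v has become the first unit vector. Independence
        gives w' a nonzero entry beyond the first, so the second exchange step can leave the first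
        column alone.\<close>
      define w' where "w' = R1' *\<^sub>v w"
      have w': "w' \<in> carrier_vec n" using R1(2) w(1) by (simp add: w'_def)
      have R1w': "R1 *\<^sub>v w' = w"
        unfolding w'_def using R1(1,2,3) w(1) by (simp add: assoc_mult_mat_vec[of _ n n _ n, symmetric])
      have "\<exists>i. 1 \<le> i \<and> i < n \<and> w' $ i \<noteq> 0"
      proof (rule ccontr)
        assume no: "\<not> ?thesis"
        have "w' = (w' $ 0) \<cdot>\<^sub>v unit_vec n 0"
        proof (rule eq_vecI)
          fix i assume "i < dim_vec (w' $ 0 \<cdot>\<^sub>v unit_vec n 0)"
          then have "i < n" by simp
          then show "w' $ i = (w' $ 0 \<cdot>\<^sub>v unit_vec n 0) $ i" using no n by (cases "i = 0") auto
        qed (use w' in simp)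
        then have "R1 *\<^sub>v w' = (w' $ 0) \<cdot>\<^sub>v (R1 *\<^sub>v unit_vec n 0)"
          using mult_mat_vec[OF R1(1) unit_vec_carrier] by metis
        then show False using R1w' R1(5) w(2) by simp
      qed
      then obtain i1 where i1: "1 \<le> i1" "i1 < n" "w' $ i1 \<noteq> 0" by blast
      obtain S S' where S: "S \<in> carrier_mat n n" "S' \<in> carrier_mat n n" "S * S' = 1\<^sub>m n" "S' * S = 1\<^sub>m n"
        "S *\<^sub>v unit_vec n 1 = w'" "\<And>l. l < 1 \<Longrightarrow> S *\<^sub>v unit_vec n l = unit_vec n l"
        using invertible_with_column[OF w' i1] by blast
      define R where "R = R1 * S"
      define R' where "R' = S' * R1'"
      have Rc: "R \<in> carrier_mat n n" "R' \<in> carrier_mat n n" using R1 S by (auto simp: R_def R'_def)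
      have "R * R' = R1 * ((S * S') * R1')" unfolding R_def R'_def using R1(1,2) S(1,2) by (simp add: assoc_mult_mat[of _ n n _ n _ n])
      then have RR': "R * R' = 1\<^sub>m n" using S R1 by simp
      have R'R: "R' * R = 1\<^sub>m n" by (rule mat_mult_left_right_inverse[OF Rc RR'])
      have Rv: "R *\<^sub>v unit_vec n 0 = v" unfolding R_def using R1 S by (simp add: assoc_mult_mat_vec[of _ n n _ n])
      have Rw: "R *\<^sub>v unit_vec n 1 = w" unfolding R_def using R1(1) S R1w' by (simp add: assoc_mult_mat_vec[of _ n n _ n])
      have R'x: "R' *\<^sub>v (R *\<^sub>v x) = x" if "x \<in> carrier_vec n" for x
        using that Rc R'R by (simp add: assoc_mult_mat_vec[of _ n n _ n, symmetric])
      have "n = 2 + (n - 2)" using i1(1,2) by simp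
      then obtain m where m: "n = 2 + m" by blast
      have cols: "(R' * M * R) $$ (r + 2, j) = 0" if M: "M \<in> V" and r: "r < m" and j: "j < 2" for M r j
      proof -
        obtain a b where ab: "M *\<^sub>v (R *\<^sub>v unit_vec n j) = a \<cdot>\<^sub>v v + b \<cdot>\<^sub>v w"
          using inv[OF M] j Rv Rw by (cases "j = 0") (auto simp: less_2_cases_iff)
        have jn: "j < n" using j m by simp
        have "(R' * M * R) *\<^sub>v unit_vec n j = R' *\<^sub>v (M *\<^sub>v (R *\<^sub>v unit_vec n j))"
          using Rc VA[OF M] by (simp add: assoc_mult_mat_vec[of _ n n _ n])
        also have "\<dots> = a \<cdot>\<^sub>v (R' *\<^sub>v v) + b \<cdot>\<^sub>v (R' *\<^sub>v w)"
          unfolding ab using Rc(2) v(1) w(1) by (simp add: mult_add_distrib_mat_vec[of _ n n] mult_mat_vec[of _ n n])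
        also have "\<dots> = a \<cdot>\<^sub>v unit_vec n 0 + b \<cdot>\<^sub>v unit_vec n 1"
          using R'x[of "unit_vec n 0"] R'x[of "unit_vec n 1"] Rv Rw by simp
        finally have "col (R' * M * R) j = a \<cdot>\<^sub>v unit_vec n 0 + b \<cdot>\<^sub>v unit_vec n 1"
          using mult_unit_vec[of "R' * M * R" n n j] Rc VA[OF M] jn by simp
        then have "col (R' * M * R) j $ (r + 2) = 0" using r m by simp
        moreover have "R' * M * R \<in> carrier_mat n n" using Rc VA[OF M] by simp
        then have "col (R' * M * R) j $ (r + 2) = (R' * M * R) $$ (r + 2, j)"
          using r jn m by (intro index_col) auto
        ultimately show ?thesis by simp
      qed
      show ?thesis unfolding m
      proof (rule block_decomposition_step[OF _ _ _ _ _ _ _ _ less.IH, where R = R and R' = R', folded m])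
        fix U :: "'a mat set"
        assume U: "mat_closed 2 U" "trivial_spectrum 2 U" "card U = CARD('a) ^ (2 choose 2)"
          and Ueq: "U = upper_left 2 ` (\<lambda>M. R' * M * R) ` V"
        have Uc: "A \<in> carrier_mat 2 2" if "A \<in> U" for A using U(1) that by (auto simp: mat_closed_def)
        have cU: "card U = CARD('a)" using U(3) by simp
        have finU: "finite U" by (rule finite_subset[OF _ finite_carrier_mat[of 2 2]]) (use Uc in blast)
        have "\<exists>A\<in>U. A \<noteq> 0\<^sub>m 2 2"
        proof (rule ccontr)
          assume "\<not> ?thesis"
          then have "U \<subseteq> {0\<^sub>m 2 2}" by blast
          then have "card U \<le> 1" using card_mono[of "{0\<^sub>m 2 2 :: 'a mat}" U] by simp
          then show False using cU q3 by simp
        qed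
        then obtain A where A: "A \<in> U" "A \<noteq> 0\<^sub>m 2 2" by blast
        \<comment> \<open>In size two the maximal cardinality is that of the field, so a single
          nonzero matrix spans U.\<close>
        have "mat_line A \<subseteq> U" using U(1) A(1) by (auto simp: mat_closed_def mat_line_def)
        then have UA: "U = mat_line A"
          using card_subset_eq[OF finU] cU card_mat_line[OF Uc[OF A(1)] A(2)] by metis
        have "\<not> eigenvalue A c" for c
        proof
          assume "eigenvalue A c"
          then obtain x where x: "x \<in> carrier_vec 2" "x \<noteq> 0\<^sub>v 2" "A *\<^sub>v x = c \<cdot>\<^sub>v x"
            unfolding eigenvalue_def eigenvector_def using Uc[OF A(1)] by auto
          show False
          proof (cases "c = 0")
            case False
            \<comment> \<open>A nonzero eigenvalue of A is rescaled to the eigenvalue 1 of a matrix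
              in U.\<close>
            have "(inverse c \<cdot>\<^sub>m A) *\<^sub>v x = inverse c \<cdot>\<^sub>v (A *\<^sub>v x)"
              using Uc[OF A(1)] x(1) by (intro eq_vecI) auto
            also have "\<dots> = x" unfolding x(3) using False by (simp add: smult_smult_assoc)
            finally have "(inverse c \<cdot>\<^sub>m A) *\<^sub>v x = x" .
            moreover have "inverse c \<cdot>\<^sub>m A \<in> U" using U(1) A(1) by (simp add: mat_closed_def)
            ultimately show False using U(2) x(1,2) unfolding trivial_spectrum_def by blast
          next
            case True
            have Ax: "A' *\<^sub>v x = 0\<^sub>v 2" if A': "A' \<in> U" for A'
            proof -
              obtain d where "A' = d \<cdot>\<^sub>m A" using A' unfolding UA mat_line_def by blast
              then have "A' *\<^sub>v x = d \<cdot>\<^sub>v (A *\<^sub>v x)"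
                using Uc[OF A(1)] x(1) by (intro eq_vecI) auto
              then show ?thesis unfolding x(3) True using x(1) by (auto intro!: eq_vecI)
            qed
            \<comment> \<open>Padded with zeros, x is killed by all conjugated matrices, since their
              lower left blocks vanish. Transported back by R it would be a common kernel vector of
              V.\<close>
            define u where "u = x @\<^sub>v 0\<^sub>v m"
            have u: "u \<in> carrier_vec n" unfolding u_def m by (rule append_carrier_vec[OF x(1) zero_carrier_vec])
            have "M *\<^sub>v (R *\<^sub>v u) = 0\<^sub>v n" if M: "M \<in> V" for M
            proof -
              define N where "N = R' * M * R"
              have N: "N \<in> carrier_mat (2 + m) (2 + m)" unfolding N_def using Rc VA[OF M] m by auto
              have "N = four_block_mat (upper_left 2 N) (upper_right 2 m N) (0\<^sub>m m 2) (lower_right 2 m N)"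
                by (rule block_form[OF N]) (use cols[OF M] in \<open>simp add: N_def\<close>)
              then have "N *\<^sub>v u = (upper_left 2 N *\<^sub>v x + upper_right 2 m N *\<^sub>v 0\<^sub>v m) @\<^sub>v (0\<^sub>m m 2 *\<^sub>v x + lower_right 2 m N *\<^sub>v 0\<^sub>v m)"
                unfolding u_def
                using four_block_mat_mult_vec[OF block_carriers(1)[of 2 N] block_carriers(2)[of 2 m N] zero_carrier_mat block_carriers(3)[of 2 m N] x(1) zero_carrier_vec]
                by simp
              also have "upper_left 2 N *\<^sub>v x = 0\<^sub>v 2" by (rule Ax) (use M in \<open>auto simp: Ueq N_def\<close>)
              also have "(0\<^sub>v 2 + upper_right 2 m N *\<^sub>v 0\<^sub>v m) @\<^sub>v (0\<^sub>m m 2 *\<^sub>v x + lower_right 2 m N *\<^sub>v 0\<^sub>v m) = 0\<^sub>v n"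
                using x(1) m by (intro eq_vecI) (auto simp: upper_right_def lower_right_def scalar_prod_def)
              finally have Nu: "N *\<^sub>v u = 0\<^sub>v n" .
              have "M *\<^sub>v (R *\<^sub>v u) = (R * R') *\<^sub>v (M *\<^sub>v (R *\<^sub>v u))" using RR' Rc VA[OF M] u by simp
              also have "\<dots> = R *\<^sub>v (N *\<^sub>v u)" unfolding N_def using Rc VA[OF M] u by (simp add: assoc_mult_mat_vec[of _ n n _ n])
              finally show ?thesis unfolding Nu by (simp add: mult_zero_vec[OF Rc(1)])
            qed
            moreover have "R *\<^sub>v u \<noteq> 0\<^sub>v n"
            proof
              assume "R *\<^sub>v u = 0\<^sub>v n"
              then have "u = R' *\<^sub>v 0\<^sub>v n" using R'x[OF u] by simp
              then have u0: "u = 0\<^sub>v n" by (simp add: mult_zero_vec[OF Rc(2)])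
              have "x = 0\<^sub>v 2"
              proof (rule eq_vecI)
                fix i assume "i < dim_vec (0\<^sub>v 2)"
                then have i: "i < 2" by simp
                have "u $ i = 0" using u0 i m by simp
                then show "x $ i = 0\<^sub>v 2 $ i" using i x(1) by (simp add: u_def)
              qed (use x(1) in simp)
              then show False using x(2) by simp
            qed
            moreover have "R *\<^sub>v u \<in> carrier_vec n" using Rc u by simp
            ultimately show False using nocommon by blast
          qed
        qed
        then have "basic_block A" using Uc[OF A(1)] by (simp add: basic_block_def)
        then show "\<exists>M. basic_block M \<and> U = mat_line M" using UA by blast
      next
        show "(R' * M * R) $$ (i + 2, j) = 0" if "M \<in> V" "i < m" "j < 2" for M i j
          using cols[OF that] .
      qed (use V ts card Rc RR' R'R m in auto)
    qed
  qed
qed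

section \<open>Uniqueness of the blocks\<close>

lemma basic_block_cases:
  assumes "basic_block M"
  obtains "M = 0\<^sub>m 1 1" "dim_row M = 1" "M \<in> carrier_mat 1 1"
  | "M \<in> carrier_mat 2 2" "dim_row M = 2" "\<And>e. \<not> eigenvalue M e"
  using assms unfolding basic_block_def by auto

lemma basic_block_carrier: "basic_block M \<Longrightarrow> M \<in> carrier_mat (dim_row M) (dim_row M)"
  by (auto simp: basic_block_def)

lemma zero_in_mat_line: "M \<in> carrier_mat k k \<Longrightarrow> 0\<^sub>m k k \<in> mat_line (M :: 'a :: field mat)"
  unfolding mat_line_def by (intro CollectI exI[of _ 0]) (auto intro!: eq_matI)

lemma self_in_mat_line: "(M :: 'a :: field mat) \<in> mat_line M"
  unfolding mat_line_def by (intro CollectI exI[of _ 1]) (auto intro!: eq_matI)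

lemma zero_mult_vec: "v \<in> carrier_vec nc \<Longrightarrow> 0\<^sub>m nr nc *\<^sub>v v = (0\<^sub>v nr :: 'a :: field vec)"
  by (rule eq_vecI) auto

lemma mat_join_carrier:
  assumes "V \<subseteq> carrier_mat k k" "W \<subseteq> carrier_mat m m"
  shows "mat_join V W \<subseteq> carrier_mat (k + m) (k + m)"
proof
  fix N assume "N \<in> mat_join V W"
  then obtain A B C where "N = four_block_mat A B (0\<^sub>m m k) C" "A \<in> V" "C \<in> W"
    unfolding mat_join_sizes[OF assms] by blast
  then show "N \<in> carrier_mat (k + m) (k + m)"
    using four_block_carrier_mat[OF subsetD[OF assms(1)] subsetD[OF assms(2)]] by simp
qed

lemma mat_joins_carrier:
  fixes Ms :: "'a :: field mat list"
  assumes "\<forall>M\<in>set Ms. basic_block M"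
  shows "mat_joins (map mat_line Ms) \<subseteq> carrier_mat (sum_list (map dim_row Ms)) (sum_list (map dim_row Ms))
    \<and> 0\<^sub>m (sum_list (map dim_row Ms)) (sum_list (map dim_row Ms)) \<in> mat_joins (map mat_line Ms)"
  using assms
proof (induction Ms)
  case Nil
  then show ?case by (auto simp: mat_joins_def)
next
  case (Cons M Ms)
  let ?k = "dim_row M" and ?m = "sum_list (map dim_row Ms)"
  have M: "M \<in> carrier_mat ?k ?k" by (rule basic_block_carrier) (use Cons.prems in simp)
  have IH: "mat_joins (map mat_line Ms) \<subseteq> carrier_mat ?m ?m" "0\<^sub>m ?m ?m \<in> mat_joins (map mat_line Ms)"
    using Cons by auto
  note js = mat_join_sizes[OF mat_line_subset[OF M] IH(1)]
  have "mat_join (mat_line M) (mat_joins (map mat_line Ms)) \<subseteq> carrier_mat (?k + ?m) (?k + ?m)"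
    by (rule mat_join_carrier[OF mat_line_subset[OF M] IH(1)])
  moreover have "four_block_mat (0\<^sub>m ?k ?k) (0\<^sub>m ?k ?m) (0\<^sub>m ?m ?k) (0\<^sub>m ?m ?m) \<in> mat_join (mat_line M) (mat_joins (map mat_line Ms))"
    unfolding js using zero_in_mat_line[OF M] IH(2) zero_carrier_mat by blast
  ultimately show ?case by (simp add: mat_joins_Cons)
qed

text \<open>If u has a nonzero lower part, the free corner B moves u to any vector of the first
  block. Otherwise u lies in that block, which it spans alone if k = 1, and together with its image
  under M if k = 2, as M has no eigenvector.\<close>

lemma first_block_minimal_invariant:
  fixes M :: "'a :: field mat"
  assumes M: "basic_block M" "M \<in> carrier_mat k k" and W: "W \<subseteq> carrier_mat m m" "0\<^sub>m m m \<in> W"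
    and U: "U \<subseteq> carrier_vec (k + m)" "\<And>x y. x \<in> U \<Longrightarrow> y \<in> U \<Longrightarrow> x + y \<in> U" "\<And>c x. x \<in> U \<Longrightarrow> c \<cdot>\<^sub>v x \<in> U"
    and inv: "\<And>N x. N \<in> mat_join (mat_line M) W \<Longrightarrow> x \<in> U \<Longrightarrow> N *\<^sub>v x \<in> U"
    and u: "u \<in> U" "u \<noteq> 0\<^sub>v (k + m)" and y: "y \<in> carrier_vec k"
  shows "y @\<^sub>v 0\<^sub>v m \<in> U"
proof -
  note js = mat_join_sizes[OF mat_line_subset[OF M(2)] W(1)]
  define u1 u2 where "u1 = vec_first u k" and "u2 = vec_last u m"
  have c12: "u1 \<in> carrier_vec k" "u2 \<in> carrier_vec m" by (simp_all add: u1_def u2_def)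
  have ueq: "u = u1 @\<^sub>v u2" unfolding u1_def u2_def using u(1) U(1) by (subst vec_first_last_append) auto
  show ?thesis
  proof (cases "u2 = 0\<^sub>v m")
    case False
    obtain j where j: "j < m" "u2 $ j \<noteq> 0" by (rule nonzero_vec_index[OF c12(2) False])
    \<comment> \<open>A single nonzero column, scaled so that the nonzero entry j of u2 is turned
      into y.\<close>
    define B where "B = mat k m (\<lambda>(i, c). if c = j then y $ i / u2 $ j else 0)"
    have B: "B \<in> carrier_mat k m" by (simp add: B_def)
    have "B *\<^sub>v u2 = y"
    proof (rule eq_vecI)
      fix i assume "i < dim_vec y"
      then have i: "i < k" using y by simp
      have "(B *\<^sub>v u2) $ i = (\<Sum>c<m. B $$ (i, c) * u2 $ c)"
        using B i c12 by (simp add: scalar_prod_def atLeast0LessThan)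
      also have "\<dots> = (\<Sum>c<m. if c = j then y $ i else 0)"
        by (intro sum.cong) (use i j in \<open>auto simp: B_def\<close>)
      finally show "(B *\<^sub>v u2) $ i = y $ i" using j by simp
    qed (use y B in simp)
    then have "four_block_mat (0\<^sub>m k k) B (0\<^sub>m m k) (0\<^sub>m m m) *\<^sub>v u = y @\<^sub>v 0\<^sub>v m"
      unfolding ueq using four_block_mat_mult_vec[OF zero_carrier_mat[of k k] B zero_carrier_mat[of m k] zero_carrier_mat[of m m] c12]
        y zero_mult_vec[OF c12(1)] zero_mult_vec[OF c12(2)] by simp
    moreover have "four_block_mat (0\<^sub>m k k) B (0\<^sub>m m k) (0\<^sub>m m m) \<in> mat_join (mat_line M) W"
      unfolding js using zero_in_mat_line[OF M(2)] B W(2) by blast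
    ultimately show ?thesis using inv u(1) by metis
  next
    case True
    have u1: "u1 \<noteq> 0\<^sub>v k"
    proof
      assume "u1 = 0\<^sub>v k"
      then have "u = 0\<^sub>v (k + m)" unfolding ueq True by (intro eq_vecI) auto
      then show False using u(2) by simp
    qed
    from M(1) show ?thesis
    proof (cases rule: basic_block_cases)
      case 1
      then have k: "k = 1" using M(2) by auto
      have u10: "u1 $ 0 \<noteq> 0"
      proof
        assume "u1 $ 0 = 0"
        then have "u1 = 0\<^sub>v k" by (intro eq_vecI) (use c12 k in auto)
        then show False using u1 by simp
      qed
      have "y @\<^sub>v 0\<^sub>v m = (y $ 0 / u1 $ 0) \<cdot>\<^sub>v u"
        unfolding ueq True by (rule eq_vecI) (use c12 y k u10 in auto)
      then show ?thesis using U(3)[OF u(1)] by simp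
    next
      case 2
      then have k: "k = 2" using M(2) by auto
      define r where "r = M *\<^sub>v u1"
      have rc: "r \<in> carrier_vec k" using M(2) c12 by (simp add: r_def)
      have "four_block_mat M (0\<^sub>m k m) (0\<^sub>m m k) (0\<^sub>m m m) *\<^sub>v u = r @\<^sub>v 0\<^sub>v m"
        unfolding ueq r_def using four_block_mat_mult_vec[OF M(2) zero_carrier_mat[of k m] zero_carrier_mat[of m k] zero_carrier_mat[of m m] c12]
          zero_mult_vec[OF c12(1)] zero_mult_vec[OF c12(2)] c12 M(2) by simp
      moreover have "four_block_mat M (0\<^sub>m k m) (0\<^sub>m m k) (0\<^sub>m m m) \<in> mat_join (mat_line M) W"
        unfolding js using self_in_mat_line W(2) zero_carrier_mat by blast
      ultimately have rU: "r @\<^sub>v 0\<^sub>v m \<in> U" using inv u(1) by metis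
      \<comment> \<open>The determinant of u1 and its image under M. Were it zero, u1 would be an
        eigenvector; a and b below are Cramer's rule.\<close>
      define d where "d = u1 $ 0 * r $ 1 - u1 $ 1 * r $ 0"
      have d: "d \<noteq> 0"
      proof
        assume d0: "d = 0"
        have "\<exists>c. r $ 0 = c * u1 $ 0 \<and> r $ 1 = c * u1 $ 1"
        proof (cases "u1 $ 0 = 0")
          case True
          have "u1 $ 1 \<noteq> 0"
          proof
            assume "u1 $ 1 = 0"
            then have "u1 = 0\<^sub>v k" by (intro eq_vecI) (use c12 k True in \<open>auto simp: less_2_cases_iff\<close>)
            then show False using u1 by simp
          qed
          then show ?thesis using True d0 by (intro exI[of _ "r $ 1 / u1 $ 1"]) (simp add: d_def)
        next
          case False
          then show ?thesis using d0 by (intro exI[of _ "r $ 0 / u1 $ 0"]) (simp add: d_def field_simps)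
        qed
        then obtain c where c: "r $ 0 = c * u1 $ 0" "r $ 1 = c * u1 $ 1" by blast
        have "M *\<^sub>v u1 = c \<cdot>\<^sub>v u1"
          unfolding r_def[symmetric] by (rule eq_vecI) (use rc c12 k c in \<open>auto simp: less_2_cases_iff\<close>)
        then have "eigenvalue M c" unfolding eigenvalue_def eigenvector_def
          using u1 c12 k 2 by (intro exI[of _ u1]) auto
        then show False using 2 by blast
      qed
      define a where "a = (y $ 0 * r $ 1 - y $ 1 * r $ 0) / d"
      define b where "b = (u1 $ 0 * y $ 1 - u1 $ 1 * y $ 0) / d"
      have ab: "a * u1 $ 0 + b * r $ 0 = y $ 0" "a * u1 $ 1 + b * r $ 1 = y $ 1"
        unfolding a_def b_def using d by (simp_all add: field_simps, simp_all add: d_def algebra_simps)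
      have "y @\<^sub>v 0\<^sub>v m = a \<cdot>\<^sub>v u + b \<cdot>\<^sub>v (r @\<^sub>v 0\<^sub>v m)"
        unfolding ueq True
      proof (rule eq_vecI)
        fix i assume "i < dim_vec (a \<cdot>\<^sub>v (u1 @\<^sub>v 0\<^sub>v m) + b \<cdot>\<^sub>v (r @\<^sub>v 0\<^sub>v m))"
        then have i: "i < 2 + m" using c12 rc k by simp
        show "(y @\<^sub>v 0\<^sub>v m) $ i = (a \<cdot>\<^sub>v (u1 @\<^sub>v 0\<^sub>v m) + b \<cdot>\<^sub>v (r @\<^sub>v 0\<^sub>v m)) $ i"
        proof (cases "i < 2")
          case True
          then have "i = 0 \<or> i = 1" by auto
          then show ?thesis using ab i c12 rc y k by auto
        next
          case False
          then show ?thesis using i c12 rc y k by simp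
        qed
      qed (use c12 rc y in simp)
      then show ?thesis using U(2)[OF U(3)[OF u(1)] U(3)[OF rU]] by simp
    qed
  qed
qed

text \<open>The preimage under S of the first block of the target is a nonzero subspace invariant
  under the source join. By minimality it contains the first block of the source.\<close>

lemma first_block_mapped:
  fixes M M' :: "'a :: field mat"
  assumes M: "basic_block M" "M \<in> carrier_mat k k" and W: "W \<subseteq> carrier_mat m m" "0\<^sub>m m m \<in> W"
    and M': "basic_block M'" "M' \<in> carrier_mat k' k'" and W': "W' \<subseteq> carrier_mat m' m'"
    and n: "k + m = n" "k' + m' = n"
    and S: "S \<in> carrier_mat n n" "S' \<in> carrier_mat n n" "S * S' = 1\<^sub>m n" "S' * S = 1\<^sub>m n"
    and sub: "\<And>N. N \<in> mat_join (mat_line M) W \<Longrightarrow> S * N * S' \<in> mat_join (mat_line M') W'"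
    and ij: "i < m'" "j < k"
  shows "S $$ (i + k', j) = 0"
proof -
  define U where "U = {x \<in> carrier_vec n. \<exists>y\<in>carrier_vec k'. S *\<^sub>v x = y @\<^sub>v 0\<^sub>v m'}"
  note js = mat_join_sizes[OF mat_line_subset[OF M(2)] W(1)]
  note js' = mat_join_sizes[OF mat_line_subset[OF M'(2)] W']
  have k': "k' > 0" using M' by (auto elim!: basic_block_cases)
  have Jc: "N \<in> carrier_mat n n" if "N \<in> mat_join (mat_line M) W" for N
    using subsetD[OF mat_join_carrier[OF mat_line_subset[OF M(2)] W(1)] that] n(1) by simp
  \<comment> \<open>A nonzero vector of the target block; its preimage shows that U is not
    zero.\<close>
  define e where "e = unit_vec k' 0 @\<^sub>v (0\<^sub>v m' :: 'a vec)"
  have e: "e \<in> carrier_vec n" unfolding e_def n(2)[symmetric] by (rule append_carrier_vec) auto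
  have SS'e: "S *\<^sub>v (S' *\<^sub>v e) = e" using S e by (simp add: assoc_mult_mat_vec[of _ n n _ n, symmetric])
  have "unit_vec k j @\<^sub>v 0\<^sub>v m \<in> U"
  proof (rule first_block_minimal_invariant[OF M W, of U "S' *\<^sub>v e"])
    show "U \<subseteq> carrier_vec (k + m)" unfolding U_def n(1) by auto
    show "x + y \<in> U" if xy: "x \<in> U" "y \<in> U" for x y
    proof -
      obtain a b where ab: "a \<in> carrier_vec k'" "b \<in> carrier_vec k'" "S *\<^sub>v x = a @\<^sub>v 0\<^sub>v m'" "S *\<^sub>v y = b @\<^sub>v 0\<^sub>v m'"
        and c: "x \<in> carrier_vec n" "y \<in> carrier_vec n"
        using xy unfolding U_def by blast
      have "S *\<^sub>v (x + y) = (a @\<^sub>v 0\<^sub>v m') + (b @\<^sub>v 0\<^sub>v m')" using mult_add_distrib_mat_vec[OF S(1) c] ab by simp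
      also have "\<dots> = (a + b) @\<^sub>v 0\<^sub>v m'" by (rule eq_vecI) (use ab in auto)
      finally show ?thesis unfolding U_def using ab c by auto
    qed
    show "c \<cdot>\<^sub>v x \<in> U" if x: "x \<in> U" for c x
    proof -
      obtain a where a: "a \<in> carrier_vec k'" "S *\<^sub>v x = a @\<^sub>v 0\<^sub>v m'" and c: "x \<in> carrier_vec n"
        using x unfolding U_def by blast
      have "S *\<^sub>v (c \<cdot>\<^sub>v x) = c \<cdot>\<^sub>v (a @\<^sub>v 0\<^sub>v m')" using mult_mat_vec[OF S(1) c] a by simp
      also have "\<dots> = (c \<cdot>\<^sub>v a) @\<^sub>v 0\<^sub>v m'" by (rule eq_vecI) (use a in auto)
      finally show ?thesis unfolding U_def using a c by auto
    qed
    show "N *\<^sub>v x \<in> U" if N: "N \<in> mat_join (mat_line M) W" and x: "x \<in> U" for N x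
    proof -
      obtain a where a: "a \<in> carrier_vec k'" "S *\<^sub>v x = a @\<^sub>v 0\<^sub>v m'" and c: "x \<in> carrier_vec n"
        using x unfolding U_def by blast
      obtain A B C where N': "S * N * S' = four_block_mat A B (0\<^sub>m m' k') C" "A \<in> mat_line M'" "B \<in> carrier_mat k' m'" "C \<in> W'"
        using sub[OF N] unfolding js' by blast
      have Ac: "A \<in> carrier_mat k' k'" and Cc: "C \<in> carrier_mat m' m'"
        using N' mat_line_subset[OF M'(2)] W' by auto
      have "S *\<^sub>v (N *\<^sub>v x) = S *\<^sub>v (N *\<^sub>v ((S' * S) *\<^sub>v x))" using S(4) c by simp
      also have "\<dots> = (S * N * S') *\<^sub>v (S *\<^sub>v x)"
        using S(1,2) Jc[OF N] c by (simp add: assoc_mult_mat_vec[of _ n n _ n])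
      also have "\<dots> = (A *\<^sub>v a + B *\<^sub>v 0\<^sub>v m') @\<^sub>v (0\<^sub>m m' k' *\<^sub>v a + C *\<^sub>v 0\<^sub>v m')"
        unfolding a(2) N'(1) by (rule four_block_mat_mult_vec[OF Ac N'(3) zero_carrier_mat Cc a(1) zero_carrier_vec])
      also have "\<dots> = (A *\<^sub>v a) @\<^sub>v 0\<^sub>v m'"
        using a(1) Ac by (simp add: mult_zero_vec[OF N'(3)] mult_zero_vec[OF Cc] zero_mult_vec[OF a(1)])
      finally show ?thesis unfolding U_def using Ac a(1) c Jc[OF N] by auto
    qed
    show "S' *\<^sub>v e \<in> U" unfolding U_def using SS'e S(2) e
      by (intro CollectI conjI bexI[of _ "unit_vec k' 0"]) (auto simp: e_def)
    show "S' *\<^sub>v e \<noteq> 0\<^sub>v (k + m)"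
    proof
      assume "S' *\<^sub>v e = 0\<^sub>v (k + m)"
      then have "e = 0\<^sub>v n" using SS'e mult_zero_vec[OF S(1)] n by simp
      then have "e $ 0 = 0" using k' n by simp
      then show False using k' by (simp add: e_def)
    qed
  qed auto
  then obtain y where y: "y \<in> carrier_vec k'" "S *\<^sub>v (unit_vec k j @\<^sub>v 0\<^sub>v m) = y @\<^sub>v 0\<^sub>v m'"
    unfolding U_def by blast
  have jn: "j < n" using ij n by simp
  have "unit_vec k j @\<^sub>v 0\<^sub>v m = (unit_vec n j :: 'a vec)"
    by (rule eq_vecI) (use ij n in auto)
  then have "col S j = y @\<^sub>v 0\<^sub>v m'" using y(2) mult_unit_vec[OF S(1) jn] by simp
  then have "col S j $ (i + k') = (y @\<^sub>v 0\<^sub>v m') $ (i + k')" by simp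
  then show ?thesis using y(1) ij n S(1) jn by simp
qed

text \<open>Two columns supported in one and the same row are dependent. This is how first blocks of
  different sizes 1 and 2 are excluded.\<close>

lemma no_rank_drop:
  fixes S S' :: "'a :: field mat"
  assumes S: "S \<in> carrier_mat n n" "S' \<in> carrier_mat n n" "S' * S = 1\<^sub>m n" and n: "n \<ge> 2"
    and zero: "\<And>r j. 1 \<le> r \<Longrightarrow> r < n \<Longrightarrow> j < 2 \<Longrightarrow> S $$ (r, j) = 0"
  shows False
proof -
  have prod: "S' $$ (i, 0) * S $$ (0, j) = (if i = j then 1 else 0)" if ij: "i < n" "j < 2" for i j
  proof -
    have jn: "j < n" using ij n by simp
    have "(S' * S) $$ (i, j) = (\<Sum>r<n. S' $$ (i, r) * S $$ (r, j))"
      using S(1,2) ij jn by (simp add: scalar_prod_def atLeast0LessThan)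
    also have "\<dots> = (\<Sum>r<n. if r = 0 then S' $$ (i, 0) * S $$ (0, j) else 0)"
      by (intro sum.cong) (use zero ij in auto)
    also have "\<dots> = S' $$ (i, 0) * S $$ (0, j)" using n by simp
    finally show ?thesis unfolding S(3) using ij jn by simp
  qed
  have "S' $$ (0, 0) \<noteq> 0" using prod[of 0 0] n by auto
  then have "S $$ (0, 1) = 0" using prod[of 0 1] n by auto
  then show False using prod[of 1 1] n by simp
qed

text \<open>Both S and its inverse respect the first blocks, so these have equal size and S is block
  triangular. Its diagonal blocks then conjugate the first lines into each other and the remaining
  joins into each other, and induction applies to the latter.\<close>

lemma block_decomposition_unique:
  fixes Ms Ms' :: "'a :: field mat list"
  assumes "\<forall>M\<in>set Ms. basic_block M" "\<forall>M\<in>set Ms'. basic_block M"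
    and "sum_list (map dim_row Ms) = n" "sum_list (map dim_row Ms') = n"
    and "S \<in> carrier_mat n n" "S' \<in> carrier_mat n n" "S * S' = 1\<^sub>m n" "S' * S = 1\<^sub>m n"
    and "mat_joins (map mat_line Ms') = (\<lambda>N. S * N * S') ` mat_joins (map mat_line Ms)"
  shows "length Ms' = length Ms \<and> (\<forall>k < length Ms. \<exists>c. c \<noteq> 0 \<and> similar_mat (Ms' ! k) (c \<cdot>\<^sub>m Ms ! k))"
  using assms
proof (induction Ms arbitrary: Ms' n S S')
  case Nil
  have "Ms' = []"
  proof (cases Ms')
    case (Cons M Ts)
    then have "basic_block M" "dim_row M = 0" using Nil by auto
    then show ?thesis by (auto elim!: basic_block_cases)
  qed
  then show ?case by simp
next
  case (Cons M Ts Ms2)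
  note bM = Cons.prems(1) and bM2 = Cons.prems(2) and S = Cons.prems(5-8)
  define k where "k = dim_row M"
  define m where "m = sum_list (map dim_row Ts)"
  have Mb: "basic_block M" and M: "M \<in> carrier_mat k k" using bM basic_block_carrier unfolding k_def by auto
  have n: "k + m = n" using Cons.prems(3) by (simp add: k_def m_def)
  have k12: "k = 1 \<or> k = 2" using Mb unfolding k_def by (auto elim!: basic_block_cases)
  obtain M' Ts' where Ms2: "Ms2 = M' # Ts'"
    using Cons.prems(4) n k12 by (cases Ms2) auto
  define k' where "k' = dim_row M'"
  define m' where "m' = sum_list (map dim_row Ts')"
  have Mb': "basic_block M'" and M': "M' \<in> carrier_mat k' k'" using bM2 basic_block_carrier unfolding k'_def Ms2 by auto
  have n': "k' + m' = n" using Cons.prems(4) by (simp add: k'_def m'_def Ms2)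
  have k12': "k' = 1 \<or> k' = 2" using Mb' unfolding k'_def by (auto elim!: basic_block_cases)
  define W where "W = mat_joins (map mat_line Ts)"
  define W' where "W' = mat_joins (map mat_line Ts')"
  have W: "W \<subseteq> carrier_mat m m" "0\<^sub>m m m \<in> W" using mat_joins_carrier[of Ts] bM by (auto simp: W_def m_def)
  have W': "W' \<subseteq> carrier_mat m' m'" "0\<^sub>m m' m' \<in> W'" using mat_joins_carrier[of Ts'] bM2 by (auto simp: W'_def m'_def Ms2)
  let ?J = "mat_join (mat_line M) W" and ?J' = "mat_join (mat_line M') W'"
  have J: "?J' = (\<lambda>N. S * N * S') ` ?J" using Cons.prems(9) by (simp add: Ms2 W_def W'_def mat_joins_Cons)
  note js = mat_join_sizes[OF mat_line_subset[OF M] W(1)]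
  note js' = mat_join_sizes[OF mat_line_subset[OF M'] W'(1)]
  have Jc: "N \<in> carrier_mat n n" if "N \<in> ?J" for N
    using subsetD[OF mat_join_carrier[OF mat_line_subset[OF M] W(1)] that] n by simp
  have bwd: "S' * N * S \<in> ?J" if "N \<in> ?J'" for N
    using that conj_cancel[OF S(1,2,4)] Jc unfolding J by auto
  have zS: "S $$ (i + k', j) = 0" if "i < m'" "j < k" for i j
    by (rule first_block_mapped[OF Mb M W Mb' M' W'(1) n n' S _ that]) (use J in blast)
  have zS': "S' $$ (i + k, j) = 0" if "i < m" "j < k'" for i j
    by (rule first_block_mapped[OF Mb' M' W' Mb M W(1) n' n S(2,1,4,3) bwd that])
  have kk: "k' = k"
  proof (rule ccontr)
    assume ne: "k' \<noteq> k"
    then consider "k = 2" "k' = 1" | "k = 1" "k' = 2" using k12 k12' by auto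
    then show False
    proof cases
      case 1
      show False
      proof (rule no_rank_drop[OF S(1,2,4)])
        show "2 \<le> n" using n 1 by simp
        show "S $$ (r, j) = 0" if "1 \<le> r" "r < n" "j < 2" for r j
          using zS[of "r - 1" j] that 1 n' by simp
      qed
    next
      case 2
      show False
      proof (rule no_rank_drop[OF S(2,1,3)])
        show "2 \<le> n" using n' 2 by simp
        show "S' $$ (r, j) = 0" if "1 \<le> r" "r < n" "j < 2" for r j
          using zS'[of "r - 1" j] that 2 n by simp
      qed
    qed
  qed
  then have mm: "m' = m" using n n' by simp
  note M' = M'[unfolded kk] and W' = W'[unfolded mm] and js' = js'[unfolded kk mm]
  define S1 S2 S4 where "S1 = upper_left k S" and "S2 = upper_right k m S" and "S4 = lower_right k m S"
  define T1 T2 T4 where "T1 = upper_left k S'" and "T2 = upper_right k m S'" and "T4 = lower_right k m S'"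
  have cS: "S1 \<in> carrier_mat k k" "S2 \<in> carrier_mat k m" "S4 \<in> carrier_mat m m"
    and cT: "T1 \<in> carrier_mat k k" "T2 \<in> carrier_mat k m" "T4 \<in> carrier_mat m m"
    unfolding S1_def S2_def S4_def T1_def T2_def T4_def by (rule block_carriers)+
  have Sb: "S = four_block_mat S1 S2 (0\<^sub>m m k) S4"
    unfolding S1_def S2_def S4_def by (rule block_form) (use S(1) n zS kk mm in auto)
  have Tb: "S' = four_block_mat T1 T2 (0\<^sub>m m k) T4"
    unfolding T1_def T2_def T4_def by (rule block_form) (use S(2) n zS' kk in auto)
  have one: "1\<^sub>m n = four_block_mat (1\<^sub>m k) (0\<^sub>m k m) (0\<^sub>m m k) (1\<^sub>m m)" using n by simp
  have ST: "four_block_mat (S1 * T1) (S1 * T2 + S2 * T4) (0\<^sub>m m k) (S4 * T4)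
      = four_block_mat (1\<^sub>m k) (0\<^sub>m k m) (0\<^sub>m m k) (1\<^sub>m m)"
    using S(3) one mult_block_triangular[OF cS cT] Sb Tb by simp
  have ST1: "S1 * T1 = 1\<^sub>m k"
    by (rule four_block_inject(1)[where k = k and m = m, OF _ _ _ _ _ _ _ _ ST]) (use cS cT in auto)
  have ST4: "S4 * T4 = 1\<^sub>m m"
    by (rule four_block_inject(2)[where k = k and m = m, OF _ _ _ _ _ _ _ _ ST]) (use cS cT in auto)
  have TS1: "T1 * S1 = 1\<^sub>m k" by (rule mat_mult_left_right_inverse[OF cS(1) cT(1) ST1])
  have TS4: "T4 * S4 = 1\<^sub>m m" by (rule mat_mult_left_right_inverse[OF cS(3) cT(3) ST4])
  have conj: "\<exists>X\<in>carrier_mat k m. S * four_block_mat A B (0\<^sub>m m k) C * S' = four_block_mat (S1 * A * T1) X (0\<^sub>m m k) (S4 * C * T4)"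
    if c: "A \<in> carrier_mat k k" "B \<in> carrier_mat k m" "C \<in> carrier_mat m m" for A B C
  proof -
    have "S * four_block_mat A B (0\<^sub>m m k) C = four_block_mat (S1 * A) (S1 * B + S2 * C) (0\<^sub>m m k) (S4 * C)"
      unfolding Sb by (rule mult_block_triangular[OF cS c])
    then have "S * four_block_mat A B (0\<^sub>m m k) C * S' =
        four_block_mat (S1 * A * T1) (S1 * A * T2 + (S1 * B + S2 * C) * T4) (0\<^sub>m m k) (S4 * C * T4)"
      unfolding Tb using mult_block_triangular[of "S1 * A" k "S1 * B + S2 * C" m "S4 * C" T1 T2 T4] cS cT c by simp
    moreover have "S1 * A * T2 + (S1 * B + S2 * C) * T4 \<in> carrier_mat k m" using cS cT c by auto
    ultimately show ?thesis by blast
  qed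
  have dec: "\<exists>A\<in>mat_line M. \<exists>C\<in>W. A' = S1 * A * T1 \<and> C' = S4 * C * T4"
    if AC: "A' \<in> mat_line M'" "C' \<in> W'" for A' C'
  proof -
    have c': "A' \<in> carrier_mat k k" "C' \<in> carrier_mat m m" using AC mat_line_subset[OF M'] W'(1) by auto
    have "four_block_mat A' (0\<^sub>m k m) (0\<^sub>m m k) C' \<in> ?J'" unfolding js' using AC zero_carrier_mat by blast
    then obtain A B C where N: "four_block_mat A' (0\<^sub>m k m) (0\<^sub>m m k) C' = S * four_block_mat A B (0\<^sub>m m k) C * S'"
      "A \<in> mat_line M" "B \<in> carrier_mat k m" "C \<in> W"
      unfolding J js by blast
    have c: "A \<in> carrier_mat k k" "C \<in> carrier_mat m m" using N mat_line_subset[OF M] W(1) by auto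
    obtain X where X: "X \<in> carrier_mat k m" "S * four_block_mat A B (0\<^sub>m m k) C * S' = four_block_mat (S1 * A * T1) X (0\<^sub>m m k) (S4 * C * T4)"
      using conj[OF c(1) N(3) c(2)] by blast
    have "A' = S1 * A * T1"
      by (rule four_block_inject(1)[where k = k and m = m, OF _ _ _ _ _ _ _ _ N(1)[unfolded X(2)]])
        (use c' c cS cT X(1) in auto)
    moreover have "C' = S4 * C * T4"
      by (rule four_block_inject(2)[where k = k and m = m, OF _ _ _ _ _ _ _ _ N(1)[unfolded X(2)]])
        (use c' c cS cT X(1) in auto)
    ultimately show ?thesis using N by blast
  qed
  have W'eq: "W' = (\<lambda>C. S4 * C * T4) ` W"
  proof (intro equalityI subsetI)
    fix C' assume "C' \<in> W'"
    then show "C' \<in> (\<lambda>C. S4 * C * T4) ` W" using dec[OF self_in_mat_line] by blast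
  next
    fix C' assume "C' \<in> (\<lambda>C. S4 * C * T4) ` W"
    then obtain C where C: "C \<in> W" "C' = S4 * C * T4" by blast
    have Cc: "C \<in> carrier_mat m m" using C W(1) by blast
    have "four_block_mat (0\<^sub>m k k) (0\<^sub>m k m) (0\<^sub>m m k) C \<in> ?J"
      unfolding js using zero_in_mat_line[OF M] C(1) zero_carrier_mat by blast
    then have "S * four_block_mat (0\<^sub>m k k) (0\<^sub>m k m) (0\<^sub>m m k) C * S' \<in> ?J'" unfolding J by blast
    then obtain A2 B2 C2 where N: "S * four_block_mat (0\<^sub>m k k) (0\<^sub>m k m) (0\<^sub>m m k) C * S' = four_block_mat A2 B2 (0\<^sub>m m k) C2"
      "A2 \<in> mat_line M'" "B2 \<in> carrier_mat k m" "C2 \<in> W'" unfolding js' by blast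
    obtain X where X: "X \<in> carrier_mat k m" "S * four_block_mat (0\<^sub>m k k) (0\<^sub>m k m) (0\<^sub>m m k) C * S' = four_block_mat (S1 * 0\<^sub>m k k * T1) X (0\<^sub>m m k) (S4 * C * T4)"
      using conj[OF zero_carrier_mat zero_carrier_mat Cc] by blast
    have "S4 * C * T4 = C2"
      by (rule four_block_inject(2)[where k = k and m = m, OF _ _ _ _ _ _ _ _ N(1)[unfolded X(2)]])
        (use N mat_line_subset[OF M'] W'(1) Cc cS cT X(1) in auto)
    then show "C' \<in> W'" using C N by simp
  qed
  have "length Ts' = length Ts \<and> (\<forall>k < length Ts. \<exists>c. c \<noteq> 0 \<and> similar_mat (Ts' ! k) (c \<cdot>\<^sub>m Ts ! k))"
  proof (rule Cons.IH[OF _ _ _ _ cS(3) cT(3) ST4 TS4])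
    show "sum_list (map dim_row Ts) = m" "sum_list (map dim_row Ts') = m" using mm by (simp_all add: m_def m'_def)
    show "mat_joins (map mat_line Ts') = (\<lambda>N. S4 * N * T4) ` mat_joins (map mat_line Ts)"
      using W'eq by (simp add: W_def W'_def)
  qed (use bM bM2 Ms2 in auto)
  moreover have "\<exists>c. c \<noteq> 0 \<and> similar_mat M' (c \<cdot>\<^sub>m M)"
  proof -
    obtain c where c: "M' = S1 * (c \<cdot>\<^sub>m M) * T1"
      using dec[OF self_in_mat_line W'(2)] unfolding mat_line_def by blast
    have sim: "similar_mat M' (c \<cdot>\<^sub>m M)"
      unfolding similar_mat_def by (intro exI, rule similar_mat_witI[OF ST1 TS1 c]) (use M M' cS cT in auto)
    show ?thesis
    proof (cases "c = 0")
      case False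
      then show ?thesis using sim by blast
    next
      case True
      \<comment> \<open>Here M' is zero. In size two it would have the eigenvalue 0, so the size is
        one, both blocks are zero and the scalar 1 serves instead of c.\<close>
      have "c \<cdot>\<^sub>m M = 0\<^sub>m k k" using True M by (intro eq_matI) auto
      then have M0: "M' = 0\<^sub>m k k" using c cS cT by simp
      from Mb' show ?thesis
      proof (cases rule: basic_block_cases)
        case 1
        then have "k = 1" using M' by auto
        then have "M = 0\<^sub>m 1 1" using Mb M by (auto elim!: basic_block_cases)
        then have "similar_mat M' (1 \<cdot>\<^sub>m M)" using 1 similar_mat_refl[of "0\<^sub>m 1 1" 1] by simp
        then show ?thesis by (intro exI[of _ 1]) simp
      next
        case 2
        then have k2: "k = 2" using M' by auto
        have "eigenvector M' (unit_vec 2 0) 0"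
          unfolding eigenvector_def M0 k2 by (auto intro!: eq_vecI)
        then show ?thesis using 2 unfolding eigenvalue_def by blast
      qed
    qed
  qed
  ultimately show ?case unfolding Ms2 by (auto simp: nth_Cons split: nat.splits)
qed

theorem corollary6:
  fixes V :: "'a :: {field, finite} mat set" and n :: nat
  assumes "card (UNIV :: 'a set) \<ge> 3"
    and "maximal_trivial_spectrum n V"
  shows "(\<exists>Ms. block_decomposition n V Ms) \<and>
    (\<forall>Ms Ms'. block_decomposition n V Ms \<longrightarrow> block_decomposition n V Ms' \<longrightarrow>
      length Ms' = length Ms \<and>
      (\<forall>k < length Ms. \<exists>c. c \<noteq> 0 \<and> similar_mat (Ms' ! k) (c \<cdot>\<^sub>m Ms ! k)))"
proof -
  have V: "mat_closed n V" and card: "card V = CARD('a) ^ (n choose 2)"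
    using maximal_trivial_spectrum_card[OF assms(2)] by auto
  have ts: "trivial_spectrum n V" using assms(2) by (simp add: maximal_trivial_spectrum_def)
  have sub: "V \<subseteq> carrier_mat n n" using V by (simp add: mat_closed_def)
  have ex: "\<exists>Ms. block_decomposition n V Ms" by (rule exists_block_decomposition[OF assms(1) V ts card])
  \<comment> \<open>The join reads its size off the blocks, so agreement with n has to be derived:
    the zero matrix of the total block size belongs to the join, which is a set of n by n
    matrices.\<close>
  have size: "sum_list (map dim_row Ks) = n" if K: "block_decomposition n V Ks" for Ks
  proof -
    have b: "\<forall>M\<in>set Ks. basic_block M" using K by (simp add: block_decomposition_def)
    obtain R R' where "R \<in> carrier_mat n n" "R' \<in> carrier_mat n n" "mat_joins (map mat_line Ks) = (\<lambda>M. R * M * R') ` V"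
      using K unfolding block_decomposition_def similar_mat_sets_def by blast
    then have "mat_joins (map mat_line Ks) \<subseteq> carrier_mat n n" using sub by auto
    then have "0\<^sub>m (sum_list (map dim_row Ks)) (sum_list (map dim_row Ks)) \<in> (carrier_mat n n :: 'a mat set)"
      using mat_joins_carrier[OF b] by blast
    from carrier_matD(1)[OF this] show ?thesis by simp
  qed
  have "length Ms' = length Ms \<and> (\<forall>k < length Ms. \<exists>c. c \<noteq> 0 \<and> similar_mat (Ms' ! k) (c \<cdot>\<^sub>m Ms ! k))"
    if d: "block_decomposition n V Ms" "block_decomposition n V Ms'" for Ms Ms'
  proof -
    have s1: "similar_mat_sets n V (mat_joins (map mat_line Ms))" and s2: "similar_mat_sets n V (mat_joins (map mat_line Ms'))"
      using d by (auto simp: block_decomposition_def)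
    have "mat_joins (map mat_line Ms) \<subseteq> carrier_mat n n"
      using mat_joins_carrier[of Ms] d(1) size[OF d(1)] by (simp add: block_decomposition_def)
    then have "similar_mat_sets n (mat_joins (map mat_line Ms)) (mat_joins (map mat_line Ms'))"
      using similar_mat_sets_trans similar_mat_sets_sym[OF sub s1] s2 by blast
    then obtain S S' where S: "S \<in> carrier_mat n n" "S' \<in> carrier_mat n n" "S * S' = 1\<^sub>m n" "S' * S = 1\<^sub>m n"
      "mat_joins (map mat_line Ms') = (\<lambda>N. S * N * S') ` mat_joins (map mat_line Ms)"
      unfolding similar_mat_sets_def by blast
    show ?thesis
      by (rule block_decomposition_unique[OF _ _ size[OF d(1)] size[OF d(2)] S])
        (use d in \<open>auto simp: block_decomposition_def\<close>)
  qed
  then show ?thesis using ex by blast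
qed

end
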